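(* Let $\bar u\in L^2(\Omega)$, $\bar y=S(\bar u)$ and $\bar q=Q(\bar u)$. Assume: (1) (Regularity) $\bar y\in C^1(\Omega)$. (2) (Structure of the active set) There is a set $\mathcal C\subseteq\partial\{\bar y\ne0\}\cup\partial\Omega$ such that: $\mathcal C$ is closed and has $H^1(\mathbb{R}^d)$-capacity zero; $(\partial\{\bar y\neq0\}\cup\partial\Omega)\setminus\mathcal C$ is a strong $(d-1)$-dimensional Lipschitz submanifold of $\mathbb{R}^d$; and the sets $\mathcal N_+:=(\{\nabla\bar y=0\}\cap\partial\{\bar y>0\})\setminus\mathcal C$ and $\mathcal N_-:=(\{\nabla\bar y=0\}\cap\partial\{\bar y<0\})\setminus\mathcal C$ are relatively open in $(\partial\{\bar y\ne0\}\cup\partial\Omega)\setminus\mathcal C$. (3) The set $\mathcal M:=\{x\in\Omega:\bar y(x)=0,\ \nabla\bar y(x)\neq0\}$ is empty. (4) There exist $\bar p\in H_0^1(\Omega)$ and $\bar\mu\in H^{-1}(\Omega)$ such that $$\bar p+\nu(\bar u-u_d)=0\ \text{ a.e. in }\Omega,$$ $$a(\bar p,v)=(\bar y-y_d,v)-\langle\bar\mu,v\rangle\quad\forall v\in H_0^1(\Omega),$$ $$\bar p\in\mathcal K(\bar y),\qquad\langle\bar\mu,v\rangle\ge0\quad\forall v\in\mathcal K(\bar y),$$ where $$\mathcal K(\bar y)=\{v\in H_0^1(\Omega):\ |v|=\bar q\,v\ \text{a.e. where }\bar y=0,\ \ \operatorname{tr}(v^\pm)=0\ \text{a.e. on }\mathcal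 N_\mp\}.$$ (5) There exists $\epsilon>0$ such that for every $u\in L^2(\Omega)$ with $\|u-\bar u\|_{L^2(\Omega)}\le\epsilon$, $$\langle\bar\mu,S(u)-\bar y\rangle-\langle Q(u)-\bar q,\bar p\rangle\ge0.$$ Then $\bar u$ satisfies the quadratic growth condition: there are $\epsilon',\delta>0$ such that $$f(\bar u)\le f(u)-\delta\|u-\bar u\|^2_{L^2(\Omega)}\quad\text{for all }u\in L^2(\Omega)\text{ with }\|u-\bar u\|_{L^2(\Omega)}\le\epsilon'.$$
   Context: Domain and data: $\Omega\subset\mathbb{R}^d$, $d\in\{1,2,3\}$, is a bounded interval ($d=1$) or a bounded polygonal/polyhedral domain which is $W^{2,p}$-regular for all $p<\infty$ if $d=2$ and for all $p\le 6$ if $d=3$ (i.e. the solution $w$ of $-\Delta w=g$ with homogeneous Dirichlet condition lies in $W^{2,p}(\Omega)$ whenever $g\in L^p(\Omega)$). Further $y_d\in L^2(\Omega)$, $u_d\in L^\infty(\Omega)$, $\nu>0$. $a(y,v):=\int_\Omega\nabla y\cdot\nabla v\,dx$; $(\cdot,\cdot)$ is the $L^2(\Omega)$ inner product; $\langle\cdot,\cdot\rangle$ is the duality pairing of $H^{-1}(\Omega)$ and $H_0^1(\Omega)$. For $u\in H^{-1}(\Omega)$, $S(u)=y\in H^1_0(\Omega)$ is the unique solution of $a(y,v-y)+\|v\|_{L^1(\Omega)}-\|y\|_{L^1(\Omega)}\ge\langle u,v-y\rangle$ for all $v\in H_0^1(\Omega)$. Equivalently, there is a (unique) $q\in L^\infty(\Omega)$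 with $a(y,v)+(q,v)=\langle u,v\rangle$ for all $v\in H_0^1(\Omega)$, $q\,y=|y|$ and $|q|\le1$ a.e. in $\Omega$; one writes $Q(u):=q$ (slack variable). With $J(y,u)=\frac12\|y-y_d\|_{L^2(\Omega)}^2+\frac\nu2\|u-u_d\|_{L^2(\Omega)}^2$, $f(u):=J(S(u),u)$ for $u\in L^2(\Omega)$. $v^+$, $v^-$ denote positive and negative part of $v$; $\operatorname{tr}$ is the trace on the respective Lipschitz submanifold; $\operatorname{tr}(v^\pm)=0$ on $\mathcal N_\mp$ means $\operatorname{tr}(v^+)=0$ a.e. on $\mathcal N_-$ and $\operatorname{tr}(v^-)=0$ a.e. on $\mathcal N_+$ (w.r.t. $(d-1)$-dimensional surface measure). A subset of $\mathbb{R}^d$ is a strong $(d-1)$-dimensional Lipschitz submanifold if it is locally the graph of a Lipschitz function defined on $\mathbb{R}^{d-1}$. *)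

theory Defs
  imports "HOL-Analysis.Analysis"
begin

text \<open>
  Elements of Lebesgue and Sobolev spaces over an open set \<open>\<Omega>\<close> are represented by functions on
  the whole space; only their values on \<open>\<Omega>\<close>, up to null sets, are relevant. Consequently
  operators with values in such spaces (weak gradient, solution operator, slack operator, trace)
  choose a representative with \<open>SOME\<close>, and equations between elements are stated almost
  everywhere.
\<close>


section \<open>Differentiable functions and test functions\<close>

definition grad :: "('a::real_inner \<Rightarrow> real) \<Rightarrow> 'a \<Rightarrow> 'a" where
  "grad f x = (THE D. GDERIV f x :> D)"

text \<open>The second argument is meant to be an open set.\<close>

primrec C_k_on :: "nat \<Rightarrow> 'a::euclidean_space set \<Rightarrow> ('a \<Rightarrow> real) \<Rightarrow> bool" where
  "C_k_on 0 S f \<longleftrightarrow> continuous_on S f"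
| "C_k_on (Suc k) S f \<longleftrightarrow>
     (\<exists>D. (\<forall>x\<in>S. GDERIV f x :> D x) \<and> (\<forall>b\<in>Basis. C_k_on k S (\<lambda>x. D x \<bullet> b)))"

definition test_functions :: "'a::euclidean_space set \<Rightarrow> ('a \<Rightarrow> real) set" where
  "test_functions \<Omega> =
     {\<phi>. (\<forall>k. C_k_on k UNIV \<phi>) \<and> (\<exists>K. compact K \<and> K \<subseteq> \<Omega> \<and> (\<forall>x. x \<notin> K \<longrightarrow> \<phi> x = 0))}"


section \<open>Lebesgue spaces\<close>

definition Lp :: "real \<Rightarrow> 'a::euclidean_space set \<Rightarrow> ('a \<Rightarrow> 'b::real_normed_vector) set" where
  "Lp p \<Omega> = {f \<in> borel_measurable (lebesgue_on \<Omega>).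
               integrable (lebesgue_on \<Omega>) (\<lambda>x. norm (f x) powr p)}"

abbreviation L2 :: "'a::euclidean_space set \<Rightarrow> ('a \<Rightarrow> 'b::real_normed_vector) set" where
  "L2 \<equiv> Lp 2"

definition Linf :: "'a::euclidean_space set \<Rightarrow> ('a \<Rightarrow> real) set" where
  "Linf \<Omega> = {f \<in> borel_measurable (lebesgue_on \<Omega>). \<exists>c. AE x in lebesgue_on \<Omega>. \<bar>f x\<bar> \<le> c}"

definition L1_norm :: "'a::euclidean_space set \<Rightarrow> ('a \<Rightarrow> real) \<Rightarrow> real" where
  "L1_norm \<Omega> v = (\<integral>x. \<bar>v x\<bar> \<partial>lebesgue_on \<Omega>)"

definition L2_norm :: "'a::euclidean_space set \<Rightarrow> ('a \<Rightarrow> real) \<Rightarrow> real" where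
  "L2_norm \<Omega> v = sqrt (\<integral>x. (v x)\<^sup>2 \<partial>lebesgue_on \<Omega>)"

definition L2_inner :: "'a::euclidean_space set \<Rightarrow> ('a \<Rightarrow> real) \<Rightarrow> ('a \<Rightarrow> real) \<Rightarrow> real" where
  "L2_inner \<Omega> u v = (\<integral>x. u x * v x \<partial>lebesgue_on \<Omega>)"


section \<open>Sobolev spaces\<close>

definition locally_integrable ::
  "'a::euclidean_space set \<Rightarrow> ('a \<Rightarrow> 'b::{banach, second_countable_topology}) \<Rightarrow> bool" where
  "locally_integrable \<Omega> v \<longleftrightarrow> (\<forall>K. compact K \<and> K \<subseteq> \<Omega> \<longrightarrow> integrable (lebesgue_on K) v)"

definition has_weak_gradient ::
  "'a::euclidean_space set \<Rightarrow> ('a \<Rightarrow> real) \<Rightarrow> ('a \<Rightarrow> 'a) \<Rightarrow> bool" where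
  "has_weak_gradient \<Omega> v g \<longleftrightarrow>
     locally_integrable \<Omega> v \<and> locally_integrable \<Omega> g \<and>
     (\<forall>\<phi>\<in>test_functions \<Omega>. \<forall>b\<in>Basis.
        (\<integral>x. v x * (grad \<phi> x \<bullet> b) \<partial>lebesgue_on \<Omega>) = - (\<integral>x. (g x \<bullet> b) * \<phi> x \<partial>lebesgue_on \<Omega>))"

definition weak_grad :: "'a::euclidean_space set \<Rightarrow> ('a \<Rightarrow> real) \<Rightarrow> 'a \<Rightarrow> 'a" where
  "weak_grad \<Omega> v = (SOME g. has_weak_gradient \<Omega> v g)"

definition H1 :: "'a::euclidean_space set \<Rightarrow> ('a \<Rightarrow> real) set" where
  "H1 \<Omega> = {v \<in> L2 \<Omega>. \<exists>g\<in>L2 \<Omega>. has_weak_gradient \<Omega> v g}"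

definition H1_norm :: "'a::euclidean_space set \<Rightarrow> ('a \<Rightarrow> real) \<Rightarrow> real" where
  "H1_norm \<Omega> v = sqrt ((\<integral>x. (v x)\<^sup>2 \<partial>lebesgue_on \<Omega>) + (\<integral>x. (norm (weak_grad \<Omega> v x))\<^sup>2 \<partial>lebesgue_on \<Omega>))"

definition H10 :: "'a::euclidean_space set \<Rightarrow> ('a \<Rightarrow> real) set" where
  "H10 \<Omega> = {v \<in> H1 \<Omega>. \<exists>\<phi>. (\<forall>n::nat. \<phi> n \<in> test_functions \<Omega>) \<and>
                              (\<lambda>n. H1_norm \<Omega> (\<lambda>x. \<phi> n x - v x)) \<longlonglongrightarrow> 0}"

text \<open>Boundedness makes the functionals independent of the chosen representatives.\<close>

definition Hm1 :: "'a::euclidean_space set \<Rightarrow> (('a \<Rightarrow> real) \<Rightarrow> real) set" where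
  "Hm1 \<Omega> = {F. (\<forall>v\<in>H10 \<Omega>. \<forall>w\<in>H10 \<Omega>. F (\<lambda>x. v x + w x) = F v + F w) \<and>
               (\<forall>c. \<forall>v\<in>H10 \<Omega>. F (\<lambda>x. c * v x) = c * F v) \<and>
               (\<exists>B. \<forall>v\<in>H10 \<Omega>. \<bar>F v\<bar> \<le> B * H1_norm \<Omega> v)}"

definition W2p :: "real \<Rightarrow> 'a::euclidean_space set \<Rightarrow> ('a \<Rightarrow> real) set" where
  "W2p p \<Omega> = {w \<in> Lp p \<Omega>. \<exists>g\<in>Lp p \<Omega>. has_weak_gradient \<Omega> w g \<and>
                 (\<forall>b\<in>Basis. \<exists>h\<in>Lp p \<Omega>. has_weak_gradient \<Omega> (\<lambda>x. g x \<bullet> b) h)}"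

definition bilin_a :: "'a::euclidean_space set \<Rightarrow> ('a \<Rightarrow> real) \<Rightarrow> ('a \<Rightarrow> real) \<Rightarrow> real" where
  "bilin_a \<Omega> y v = (\<integral>x. weak_grad \<Omega> y x \<bullet> weak_grad \<Omega> v x \<partial>lebesgue_on \<Omega>)"


section \<open>The domain\<close>

text \<open>
  The Poisson equation is tested with \<open>C\<^sub>c\<^sup>\<infinity>\<close> functions, so that the right-hand side
  makes sense for every \<open>g \<in> L\<^sup>p\<close> with \<open>p > 1\<close>. For \<open>p \<ge> 2\<close> on a bounded domain this is the usual
  weak formulation in \<open>H\<^sub>0\<^sup>1\<close>.
\<close>

definition W2p_regular :: "real \<Rightarrow> 'a::euclidean_space set \<Rightarrow> bool" where
  "W2p_regular p \<Omega> \<longleftrightarrow>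
     (\<forall>g\<in>Lp p \<Omega>. \<forall>w\<in>H10 \<Omega>.
        (\<forall>\<phi>\<in>test_functions \<Omega>. bilin_a \<Omega> w \<phi> = L2_inner \<Omega> g \<phi>) \<longrightarrow> w \<in> W2p p \<Omega>)"

text \<open>
  The domain is bounded and open by construction; taking the interior of a closed set rules out
  slits and punctures.
\<close>

definition polyhedral_domain :: "'a::euclidean_space set \<Rightarrow> bool" where
  "polyhedral_domain \<Omega> \<longleftrightarrow> \<Omega> \<noteq> {} \<and> connected \<Omega> \<and>
     (\<exists>\<P>. finite \<P> \<and> (\<forall>P\<in>\<P>. polytope P) \<and> \<Omega> = interior (\<Union>\<P>))"

definition admissible_domain :: "'a::euclidean_space set \<Rightarrow> bool" where
  "admissible_domain \<Omega> \<longleftrightarrow>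
     DIM('a) = 1 \<and> \<Omega> \<noteq> {} \<and> (\<exists>a b. \<Omega> = box a b) \<or>
     DIM('a) = 2 \<and> polyhedral_domain \<Omega> \<and> (\<forall>p>1. W2p_regular p \<Omega>) \<or>
     DIM('a) = 3 \<and> polyhedral_domain \<Omega> \<and> (\<forall>p. 1 < p \<and> p \<le> 6 \<longrightarrow> W2p_regular p \<Omega>)"


section \<open>Variational inequality and optimal control problem\<close>

text \<open>The canonical embedding of \<open>L\<^sup>2\<close> into \<open>H\<^sup>-\<^sup>1\<close>.\<close>

definition L2_functional :: "'a::euclidean_space set \<Rightarrow> ('a \<Rightarrow> real) \<Rightarrow> ('a \<Rightarrow> real) \<Rightarrow> real" where
  "L2_functional \<Omega> u = (\<lambda>v. L2_inner \<Omega> u v)"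

definition solves_VI ::
  "'a::euclidean_space set \<Rightarrow> (('a \<Rightarrow> real) \<Rightarrow> real) \<Rightarrow> ('a \<Rightarrow> real) \<Rightarrow> bool" where
  "solves_VI \<Omega> F y \<longleftrightarrow> y \<in> H10 \<Omega> \<and>
     (\<forall>v\<in>H10 \<Omega>. bilin_a \<Omega> y (\<lambda>x. v x - y x) + L1_norm \<Omega> v - L1_norm \<Omega> y \<ge> F (\<lambda>x. v x - y x))"

definition sol_op :: "'a::euclidean_space set \<Rightarrow> (('a \<Rightarrow> real) \<Rightarrow> real) \<Rightarrow> 'a \<Rightarrow> real" where
  "sol_op \<Omega> F = (SOME y. solves_VI \<Omega> F y)"

definition is_slack ::
  "'a::euclidean_space set \<Rightarrow> (('a \<Rightarrow> real) \<Rightarrow> real) \<Rightarrow> ('a \<Rightarrow> real) \<Rightarrow> ('a \<Rightarrow> real) \<Rightarrow> bool" where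
  "is_slack \<Omega> F y q \<longleftrightarrow> q \<in> Linf \<Omega> \<and>
     (\<forall>v\<in>H10 \<Omega>. bilin_a \<Omega> y v + L2_inner \<Omega> q v = F v) \<and>
     (AE x in lebesgue_on \<Omega>. q x * y x = \<bar>y x\<bar> \<and> \<bar>q x\<bar> \<le> 1)"

definition slack_op :: "'a::euclidean_space set \<Rightarrow> (('a \<Rightarrow> real) \<Rightarrow> real) \<Rightarrow> 'a \<Rightarrow> real" where
  "slack_op \<Omega> F = (SOME q. is_slack \<Omega> F (sol_op \<Omega> F) q)"

definition cost_J ::
  "'a::euclidean_space set \<Rightarrow> ('a \<Rightarrow> real) \<Rightarrow> ('a \<Rightarrow> real) \<Rightarrow> real \<Rightarrow> ('a \<Rightarrow> real) \<Rightarrow> ('a \<Rightarrow> real) \<Rightarrow> real" where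
  "cost_J \<Omega> y\<^sub>d u\<^sub>d \<nu> y u =
     1 / 2 * (L2_norm \<Omega> (\<lambda>x. y x - y\<^sub>d x))\<^sup>2 + \<nu> / 2 * (L2_norm \<Omega> (\<lambda>x. u x - u\<^sub>d x))\<^sup>2"

definition reduced_cost ::
  "'a::euclidean_space set \<Rightarrow> ('a \<Rightarrow> real) \<Rightarrow> ('a \<Rightarrow> real) \<Rightarrow> real \<Rightarrow> ('a \<Rightarrow> real) \<Rightarrow> real" where
  "reduced_cost \<Omega> y\<^sub>d u\<^sub>d \<nu> u = cost_J \<Omega> y\<^sub>d u\<^sub>d \<nu> (sol_op \<Omega> (L2_functional \<Omega> u)) u"


section \<open>Capacity, Lipschitz submanifolds, surface measure and traces\<close>

definition H1_capacity :: "'a::euclidean_space set \<Rightarrow> ennreal" where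
  "H1_capacity A =
     (INF v \<in> {v \<in> H1 UNIV. \<exists>U. open U \<and> A \<subseteq> U \<and> (AE x in lebesgue. x \<in> U \<longrightarrow> 1 \<le> v x)}.
        ennreal ((H1_norm UNIV v)\<^sup>2))"

text \<open>
  Here \<open>\<real>\<^sup>d\<^sup>-\<^sup>1\<close> is identified with the hyperplane orthogonal to a unit vector \<open>e\<close>,
  which may depend on the point.
\<close>

definition strong_lipschitz_submanifold :: "'a::euclidean_space set \<Rightarrow> bool" where
  "strong_lipschitz_submanifold \<Gamma> \<longleftrightarrow>
     (\<forall>x\<in>\<Gamma>. \<exists>U e h L. open U \<and> x \<in> U \<and> norm e = 1 \<and> L-lipschitz_on {z. z \<bullet> e = 0} h \<and>
        \<Gamma> \<inter> U = {z + h z *\<^sub>R e | z. z \<bullet> e = 0} \<inter> U)"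

text \<open>
  The Hausdorff measure, normalised so that it is the surface measure on \<open>s\<close>-dimensional
  submanifolds. The library's diameter is meaningful for bounded sets only; the empty set has to
  be treated separately because of \<open>0 ^ 0 = 1\<close>.
\<close>

definition hausdorff_outer :: "nat \<Rightarrow> 'a::euclidean_space set \<Rightarrow> ennreal" where
  "hausdorff_outer s A =
     (SUP \<delta>\<in>{0<..}. INF C\<in>{C :: nat \<Rightarrow> 'a set.
         A \<subseteq> (\<Union>i. C i) \<and> (\<forall>i. bounded (C i) \<and> diameter (C i) \<le> \<delta>)}.
        (\<Sum>i. if C i = {} then 0 else ennreal (unit_ball_vol (real s) * (diameter (C i) / 2) ^ s)))"

definition surface_measure :: "'a::euclidean_space measure" where
  "surface_measure = measure_of UNIV (sets borel) (hausdorff_outer (DIM('a) - 1))"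

text \<open>
  The trace of \<open>w \<in> H\<^sub>0\<^sup>1(\<Omega>)\<close> on a Lipschitz submanifold \<open>N\<close>: the continuous extension of the
  restriction map \<open>\<phi> \<mapsto> \<phi>|\<^sub>N\<close> from test functions, with values in \<open>L\<^sup>2\<close> on compact subsets of \<open>N\<close>.
\<close>

definition has_trace ::
  "'a::euclidean_space set \<Rightarrow> 'a set \<Rightarrow> ('a \<Rightarrow> real) \<Rightarrow> ('a \<Rightarrow> real) \<Rightarrow> bool" where
  "has_trace \<Omega> N w g \<longleftrightarrow> g \<in> borel_measurable borel \<and>
     (\<exists>\<phi>. (\<forall>n::nat. \<phi> n \<in> test_functions \<Omega>) \<and>
          (\<lambda>n. H1_norm \<Omega> (\<lambda>x. \<phi> n x - w x)) \<longlonglongrightarrow> 0 \<and>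
          (\<forall>K. compact K \<and> K \<subseteq> N \<longrightarrow>
             (\<lambda>n. \<integral>\<^sup>+x. ennreal ((\<phi> n x - g x)\<^sup>2) * indicator K x \<partial>surface_measure) \<longlonglongrightarrow> 0))"

definition trace_on :: "'a::euclidean_space set \<Rightarrow> 'a set \<Rightarrow> ('a \<Rightarrow> real) \<Rightarrow> 'a \<Rightarrow> real" where
  "trace_on \<Omega> N w = (SOME g. has_trace \<Omega> N w g)"


section \<open>Structure of the active set\<close>

definition active_interface :: "'a::euclidean_space set \<Rightarrow> ('a \<Rightarrow> real) \<Rightarrow> 'a set" where
  "active_interface \<Omega> y = frontier {x\<in>\<Omega>. y x \<noteq> 0} \<union> frontier \<Omega>"

definition N_plus :: "'a::euclidean_space set \<Rightarrow> ('a \<Rightarrow> real) \<Rightarrow> 'a set \<Rightarrow> 'a set" where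
  "N_plus \<Omega> y C = ({x\<in>\<Omega>. grad y x = 0} \<inter> frontier {x\<in>\<Omega>. y x > 0}) - C"

definition N_minus :: "'a::euclidean_space set \<Rightarrow> ('a \<Rightarrow> real) \<Rightarrow> 'a set \<Rightarrow> 'a set" where
  "N_minus \<Omega> y C = ({x\<in>\<Omega>. grad y x = 0} \<inter> frontier {x\<in>\<Omega>. y x < 0}) - C"

definition cone_K ::
  "'a::euclidean_space set \<Rightarrow> ('a \<Rightarrow> real) \<Rightarrow> ('a \<Rightarrow> real) \<Rightarrow> 'a set \<Rightarrow> ('a \<Rightarrow> real) set" where
  "cone_K \<Omega> y q C = {v \<in> H10 \<Omega>.
     (AE x in lebesgue_on \<Omega>. y x = 0 \<longrightarrow> \<bar>v x\<bar> = q x * v x) \<and>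
     (AE x in surface_measure. x \<in> N_minus \<Omega> y C \<longrightarrow>
        trace_on \<Omega> (N_minus \<Omega> y C) (\<lambda>x. max (v x) 0) x = 0) \<and>
     (AE x in surface_measure. x \<in> N_plus \<Omega> y C \<longrightarrow>
        trace_on \<Omega> (N_plus \<Omega> y C) (\<lambda>x. max (- v x) 0) x = 0)}"

end

theory Submission
  imports Defs
begin

text \<open>
  Expand both quadratic terms of the cost around \<open>ubar\<close>. The adjoint equation tested with
  \<open>S(u) - ybar\<close> and the difference of the state equations tested with \<open>pbar\<close> cancel all linear
  terms except \<open>\<langle>\<mu>bar, S(u) - ybar\<rangle> - (Q(u) - qbar, pbar)\<close>, which is nonnegative near \<open>ubar\<close>
  by assumption. What remains is at least \<open>\<nu>/2 \<parallel>u - ubar\<parallel>\<^sup>2\<close>, so the growth constant is \<open>\<nu>/2\<close>.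

  This needs the choice operators \<open>sol_op\<close> and \<open>slack_op\<close> to pick genuine solutions. The state
  is the limit of a minimising sequence of test functions for the energy
  \<open>a(v,v)/2 + \<parallel>v\<parallel>\<^sub>1 - (u,v)\<close>. By the variational inequality the residual \<open>(u,w) - a(y,w)\<close> is
  bounded by \<open>\<parallel>w\<parallel>\<^sub>1\<close>, so it is represented by a function \<open>q\<close> with \<open>\<bar>q\<bar> \<le> 1\<close>, the slack variable.
\<close>

section \<open>Smooth functions and test functions\<close>

text \<open>\<open>weak_grad\<close>, \<open>sol_op\<close> and \<open>slack_op\<close> are choices
  by \<open>SOME\<close>, so nothing can be said about them before existence is proved.
  \<open>weak_grad\<close> must also respect linear combinations and limits, which requires a.e.
  uniqueness; this is why the fundamental lemma of the calculus of variations is built up from bump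
  functions. Both existence proofs minimise over test functions only: the parallelogram law makes a
  minimising sequence Cauchy, and completeness of \<open>L2\<close> provides the limit. For the
  state it is the gradients that are Cauchy, and Poincare's inequality transfers this to the
  functions. For the slack variable the residual is represented on test functions first; its
  continuity in the \<open>L1\<close> norm extends the representation to \<open>H10\<close> by
  density. The final expansion has no remainder because the cost is quadratic in the pair of state
  and control; the nonsmoothness of the solution map is confined to the multiplier and slack
  terms.\<close>

lemma C_k_on_SucI:
  assumes "\<And>x. x \<in> S \<Longrightarrow> GDERIV f x :> D x" "\<And>b. b \<in> Basis \<Longrightarrow> C_k_on k S (\<lambda>x. D x \<bullet> b)"
  shows "C_k_on (Suc k) S f"
  using assms by auto

lemma GDERIV_imp_continuous_on:
  assumes "\<And>x. x \<in> S \<Longrightarrow> GDERIV f x :> D x"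
  shows "continuous_on S f"
  using assms unfolding gderiv_def
  by (meson has_derivative_continuous continuous_at_imp_continuous_on)

lemma C_k_on_Suc_imp: "C_k_on (Suc k) S f \<Longrightarrow> C_k_on k S f"
proof (induction k arbitrary: f)
  case 0
  then show ?case by (auto intro: GDERIV_imp_continuous_on)
next
  case (Suc k)
  then show ?case
    by (metis C_k_on.simps(2))
qed

lemma C_k_on_const: "C_k_on k S (\<lambda>x. c)"
proof (induction k arbitrary: c)
  case (Suc k)
  then show ?case
    by (intro C_k_on_SucI[where D = "\<lambda>x. 0"] GDERIV_const) simp_all
qed simp

lemma C_k_on_add:
  assumes "C_k_on k S f" "C_k_on k S g"
  shows "C_k_on k S (\<lambda>x. f x + g x)"
  using assms
proof (induction k arbitrary: f g)
  case 0
  then show ?case by (auto intro: continuous_on_add)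
next
  case (Suc k)
  from Suc.prems obtain D D' where
      D: "\<forall>x\<in>S. GDERIV f x :> D x" "\<forall>b\<in>Basis. C_k_on k S (\<lambda>x. D x \<bullet> b)"
    and D': "\<forall>x\<in>S. GDERIV g x :> D' x" "\<forall>b\<in>Basis. C_k_on k S (\<lambda>x. D' x \<bullet> b)"
    by auto
  show ?case
    using D D' Suc.IH
    by (intro C_k_on_SucI[where D = "\<lambda>x. D x + D' x"] GDERIV_add) (auto simp: inner_add_left)
qed

lemma C_k_on_mult:
  assumes "C_k_on k S f" "C_k_on k S g"
  shows "C_k_on k S (\<lambda>x. f x * g x)"
  using assms
proof (induction k arbitrary: f g)
  case 0
  then show ?case by (auto intro: continuous_on_mult)
next
  case (Suc k)
  from Suc.prems obtain D D' where
      D: "\<forall>x\<in>S. GDERIV f x :> D x" "\<forall>b\<in>Basis. C_k_on k S (\<lambda>x. D x \<bullet> b)"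
    and D': "\<forall>x\<in>S. GDERIV g x :> D' x" "\<forall>b\<in>Basis. C_k_on k S (\<lambda>x. D' x \<bullet> b)"
    by auto
  have "C_k_on k S f" "C_k_on k S g"
    using Suc.prems C_k_on_Suc_imp by blast+
  then show ?case
    using D D' Suc.IH
    by (intro C_k_on_SucI[where D = "\<lambda>x. f x *\<^sub>R D' x + g x *\<^sub>R D x"] GDERIV_mult)
       (auto simp: inner_add_left intro!: C_k_on_add)
qed

lemma C_k_on_prod:
  assumes "\<And>i. i \<in> I \<Longrightarrow> C_k_on k S (f i)"
  shows "C_k_on k S (\<lambda>x. \<Prod>i\<in>I. f i x)"
  using assms
  by (induction I rule: infinite_finite_induct) (auto intro: C_k_on_const C_k_on_mult)

lemma C_k_on_power:
  assumes "C_k_on k S f"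
  shows "C_k_on k S (\<lambda>x. f x ^ n)"
  using assms by (induction n) (auto intro: C_k_on_const C_k_on_mult)

section \<open>A smooth function that is flat at the origin\<close>

text \<open>For \<open>k = 0\<close> this is the classical smooth, non-analytic function. The powers
  of \<open>1/t\<close> are carried along because differentiation produces them.\<close>

definition flat_exp :: "nat \<Rightarrow> real \<Rightarrow> real" where
  "flat_exp k t = (if t > 0 then inverse t ^ k * exp (- inverse t) else 0)"

lemma tendsto_inverse_power_exp_at_right_0:
  "((\<lambda>t::real. inverse t ^ k * exp (- inverse t)) \<longlongrightarrow> 0) (at_right 0)"
proof -
  have "((\<lambda>t::real. t ^ k * exp (- t)) \<longlongrightarrow> 0) at_top"
    using tendsto_power_div_exp_0[of k] by (simp add: exp_minus field_simps)
  from filterlim_compose[OF this filterlim_inverse_at_top_right] show ?thesis .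
qed

text \<open>Derivatives stay in the span of the family, so smoothness of every order becomes a
  single induction with \<open>k\<close> generalised.\<close>

lemma flat_exp_deriv: "DERIV (flat_exp k) t :> flat_exp (k + 2) t - k * flat_exp (k + 1) t"
proof -
  consider "t > 0" | "t = 0" | "t < 0" by linarith
  then show ?thesis
  proof cases
    case 1
    define s where "s = inverse t"
    have "DERIV (\<lambda>t. inverse t) t :> - (s\<^sup>2)"
      using DERIV_inverse[of t] 1 by (simp add: s_def numeral_2_eq_2)
    moreover have "DERIV (\<lambda>s. s ^ k * exp (- s)) (inverse t) :> (k * s ^ (k - 1) - s ^ k) * exp (- s)"
      unfolding s_def by (auto intro!: derivative_eq_intros simp: algebra_simps)
    ultimately have "DERIV (\<lambda>t. inverse t ^ k * exp (- inverse t)) t :>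
        (k * s ^ (k - 1) - s ^ k) * exp (- s) * - (s\<^sup>2)"
      using DERIV_chain2 by blast
    \<comment> \<open>The truncated exponent \<open>k - 1\<close> is harmless at
      \<open>k = 0\<close>, where the factor \<open>k\<close> vanishes; the case split aligns the
      powers.\<close>
    also have "(k * s ^ (k - 1) - s ^ k) * exp (- s) * - (s\<^sup>2) =
        flat_exp (k + 2) t - k * flat_exp (k + 1) t"
      using 1 by (cases k) (simp_all add: flat_exp_def s_def[symmetric] algebra_simps power2_eq_square)
    finally have "DERIV (\<lambda>t. inverse t ^ k * exp (- inverse t)) t :>
        flat_exp (k + 2) t - k * flat_exp (k + 1) t" .
    then show ?thesis
      by (rule has_field_derivative_transform_within_open[where S = "{0<..}"])
         (use 1 in \<open>auto simp: flat_exp_def\<close>)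
  next
    case 2
    \<comment> \<open>To the right of 0 the difference quotient at the origin is the member of index
      \<open>k + 1\<close>, which tends to 0; to the left it is identically 0.\<close>
    have R: "((\<lambda>y. flat_exp k y / y) \<longlongrightarrow> 0) (at_right 0)"
      using tendsto_inverse_power_exp_at_right_0[of "Suc k"]
      by (rule Lim_transform_eventually)
         (auto simp: flat_exp_def eventually_at_filter divide_inverse mult_ac)
    have L: "((\<lambda>y. flat_exp k y / y) \<longlongrightarrow> 0) (at_left 0)"
      by (rule Lim_transform_eventually[OF tendsto_const])
         (auto simp: flat_exp_def eventually_at_filter)
    have "((\<lambda>y. flat_exp k y / y) \<longlongrightarrow> 0) (at 0)"
      using L R by (simp add: filterlim_split_at)
    then show ?thesis
      using 2 by (simp add: has_field_derivative_iff flat_exp_def)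
  next
    case 3
    have "DERIV (\<lambda>t. 0) t :> flat_exp (k + 2) t - k * flat_exp (k + 1) t"
      using 3 by (simp add: flat_exp_def)
    then show ?thesis
      by (rule has_field_derivative_transform_within_open[where S = "{..<0}"])
         (use 3 in \<open>auto simp: flat_exp_def\<close>)
  qed
qed

text \<open>The affine argument allows a cut-off on either side of a box, with \<open>v = i\<close>
  or \<open>v = - i\<close>.\<close>

lemma C_k_on_flat_exp: "C_k_on n UNIV (\<lambda>x. flat_exp k (x \<bullet> v + c))"
proof (induction n arbitrary: k)
  case 0
  have "continuous_on UNIV (flat_exp k)"
    using flat_exp_deriv DERIV_isCont by (blast intro: continuous_at_imp_continuous_on)
  then have "continuous_on UNIV (\<lambda>x. flat_exp k (x \<bullet> v + c))"
    by (rule continuous_on_compose2) (auto intro!: continuous_intros)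
  then show ?case by simp
next
  case (Suc n)
  show ?case
  proof (rule C_k_on_SucI)
    fix x
    have "GDERIV (\<lambda>x. x \<bullet> v + c) x :> v"
      unfolding gderiv_def by (auto intro!: derivative_eq_intros)
    from GDERIV_DERIV_compose[OF this flat_exp_deriv]
    show "GDERIV (\<lambda>x. flat_exp k (x \<bullet> v + c)) x :>
        (flat_exp (k + 2) (x \<bullet> v + c) - k * flat_exp (k + 1) (x \<bullet> v + c)) *\<^sub>R v" .
  next
    fix b :: 'a
    have "C_k_on n UNIV (\<lambda>x. (flat_exp (k + 2) (x \<bullet> v + c)
        + (- real k) * flat_exp (k + 1) (x \<bullet> v + c)) * (v \<bullet> b))"
      using Suc by (intro C_k_on_mult C_k_on_add C_k_on_const) auto
    then show "C_k_on n UNIV (\<lambda>x. (flat_exp (k + 2) (x \<bullet> v + c)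
        - k * flat_exp (k + 1) (x \<bullet> v + c)) *\<^sub>R v \<bullet> b)"
      by simp
  qed
qed

section \<open>Test functions and bump functions\<close>

lemma test_functionsI:
  assumes "\<And>k. C_k_on k UNIV \<phi>" "compact K" "K \<subseteq> \<Omega>" "\<And>x. x \<notin> K \<Longrightarrow> \<phi> x = 0"
  shows "\<phi> \<in> test_functions \<Omega>"
  using assms unfolding test_functions_def by auto

lemma test_functions_zero: "(\<lambda>x. 0) \<in> test_functions \<Omega>"
  by (rule test_functionsI[where K = "{}"]) (auto intro: C_k_on_const)

lemma test_functions_mono: "U \<subseteq> \<Omega> \<Longrightarrow> test_functions U \<subseteq> test_functions \<Omega>"
  unfolding test_functions_def by blast

lemma test_functions_add:
  assumes "\<phi> \<in> test_functions \<Omega>" "\<psi> \<in> test_functions \<Omega>"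
  shows "(\<lambda>x. \<phi> x + \<psi> x) \<in> test_functions \<Omega>"
proof -
  obtain K L where "compact K" "K \<subseteq> \<Omega>" "\<forall>x. x \<notin> K \<longrightarrow> \<phi> x = 0"
     "compact L" "L \<subseteq> \<Omega>" "\<forall>x. x \<notin> L \<longrightarrow> \<psi> x = 0"
    using assms unfolding test_functions_def by blast
  with assms show ?thesis
    by (intro test_functionsI[where K = "K \<union> L"] C_k_on_add) (auto simp: test_functions_def)
qed

lemma test_functions_cmult:
  assumes "\<phi> \<in> test_functions \<Omega>"
  shows "(\<lambda>x. c * \<phi> x) \<in> test_functions \<Omega>"
proof -
  obtain K where "compact K" "K \<subseteq> \<Omega>" "\<forall>x. x \<notin> K \<longrightarrow> \<phi> x = 0"
    using assms unfolding test_functions_def by blast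
  with assms show ?thesis
    by (intro test_functionsI[where K = K] C_k_on_mult C_k_on_const) (auto simp: test_functions_def)
qed

text \<open>Two flat factors per coordinate, one for each face, give a product that is positive
  inside a box and zero outside. Each factor is at most 1 since \<open>exp (- 1/t)\<close> is, so no
  normalisation occurs.\<close>

lemma bump_function:
  fixes x :: "'a::euclidean_space"
  assumes "open U" "x \<in> U"
  shows "\<exists>\<phi>\<in>test_functions U. (\<forall>y. 0 \<le> \<phi> y \<and> \<phi> y \<le> 1) \<and> 0 < \<phi> x"
proof -
  obtain a b where ab: "x \<in> box a b" "cbox a b \<subseteq> U"
    using open_contains_cbox[OF assms] by metis
  define \<phi> where
    "\<phi> = (\<lambda>y. \<Prod>i\<in>Basis. flat_exp 0 (y \<bullet> i + - (a \<bullet> i)) * flat_exp 0 (y \<bullet> (- i) + b \<bullet> i))"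
  have bd: "0 \<le> flat_exp 0 t" "flat_exp 0 t \<le> 1" for t
    by (auto simp: flat_exp_def)
  show ?thesis
  proof (intro bexI conjI allI)
    show "\<phi> \<in> test_functions U"
    proof (rule test_functionsI[OF _ _ ab(2)])
      show "C_k_on k UNIV \<phi>" for k
        unfolding \<phi>_def by (intro C_k_on_prod C_k_on_mult C_k_on_flat_exp)
      fix y assume "y \<notin> cbox a b"
      then obtain i where "i \<in> Basis" "y \<bullet> i < a \<bullet> i \<or> y \<bullet> i > b \<bullet> i"
        by (auto simp: mem_box not_le)
      then show "\<phi> y = 0"
        unfolding \<phi>_def by (intro prod_zero) (auto simp: flat_exp_def intro!: bexI[of _ i])
    qed simp
    show "0 \<le> \<phi> y" "\<phi> y \<le> 1" for y
      unfolding \<phi>_def using bd by (auto intro!: prod_nonneg prod_le_1 mult_le_one)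
    show "0 < \<phi> x"
      unfolding \<phi>_def using ab(1) by (auto intro!: prod_pos simp: flat_exp_def mem_box)
  qed
qed

text \<open>Lindelof selects countably many bumps whose positivity sets cover \<open>U\<close>. In 1
  minus the product of the \<open>n\<close>-th powers of \<open>1 - \<phi> i\<close>,
  \<open>i < n\<close>, the growing exponent drives the product to 0 wherever some bump is positive,
  and off \<open>U\<close> every factor is 1. This plays the part usually given to
  mollification.\<close>

lemma test_functions_open_indicator:
  fixes U :: "'a::euclidean_space set"
  assumes "open U"
  obtains \<psi> :: "nat \<Rightarrow> 'a \<Rightarrow> real" where
    "\<And>n. \<psi> n \<in> test_functions U" "\<And>n x. 0 \<le> \<psi> n x" "\<And>n x. \<psi> n x \<le> 1"
    "\<And>x. (\<lambda>n. \<psi> n x) \<longlonglongrightarrow> indicator U x"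
proof -
  define \<B> where "\<B> = {\<phi> \<in> test_functions U. \<forall>y. 0 \<le> \<phi> y \<and> \<phi> y \<le> 1}"
  define \<F> where "\<F> = (\<lambda>\<phi>::'a\<Rightarrow>real. {y. 0 < \<phi> y}) ` \<B>"
  have cont: "continuous_on UNIV \<phi>" if "\<phi> \<in> test_functions U" for \<phi>
    using that unfolding test_functions_def by (metis (mono_tags, lifting) C_k_on.simps(1) mem_Collect_eq)
  have "open S" if "S \<in> \<F>" for S
    using that cont unfolding \<F>_def \<B>_def by (auto intro!: open_Collect_less)
  then obtain \<F>' where F': "\<F>' \<subseteq> \<F>" "countable \<F>'" "\<Union>\<F>' = \<Union>\<F>"
    using Lindelof by metis
  then obtain \<B>' where B': "\<B>' \<subseteq> \<B>" "countable \<B>'" "\<F>' = (\<lambda>\<phi>::'a\<Rightarrow>real. {y. 0 < \<phi> y}) ` \<B>'"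
    unfolding \<F>_def using countable_subset_image[of \<F>' _ \<B>] by auto
  \<comment> \<open>The zero function keeps the family nonempty, as \<open>from_nat_into\<close>
    demands, even for empty \<open>U\<close>.\<close>
  define \<B>0 where "\<B>0 = insert (\<lambda>x. 0) \<B>'"
  define \<phi> where "\<phi> = from_nat_into \<B>0"
  have rng: "range \<phi> = \<B>0"
    unfolding \<phi>_def using B'(2) by (intro range_from_nat_into) (auto simp: \<B>0_def)
  have "\<B>0 \<subseteq> \<B>"
    using B'(1) test_functions_zero by (auto simp: \<B>0_def \<B>_def)
  then have \<phi>: "\<phi> n \<in> test_functions U" "0 \<le> \<phi> n y" "\<phi> n y \<le> 1" for n y
    using rng by (auto simp: \<B>_def)
  define \<psi> where "\<psi> = (\<lambda>n x. 1 + (-1) * (\<Prod>i<n. (1 + (-1) * \<phi> i x) ^ n))"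
  show thesis
  proof (rule that[of \<psi>])
    have bd: "0 \<le> (\<Prod>i<n. (1 - \<phi> i x) ^ n)" "(\<Prod>i<n. (1 - \<phi> i x) ^ n) \<le> 1" for n x
      using \<phi> by (auto intro!: prod_nonneg prod_le_1 power_le_one)
    then show "0 \<le> \<psi> n x" "\<psi> n x \<le> 1" for n x by (auto simp: \<psi>_def)
    obtain K where K: "\<And>i. compact (K i) \<and> K i \<subseteq> U \<and> (\<forall>x. x \<notin> K i \<longrightarrow> \<phi> i x = 0)"
      using \<phi>(1) unfolding test_functions_def by simp metis
    show "\<psi> n \<in> test_functions U" for n
    proof (rule test_functionsI[where K = "\<Union>i<n. K i"])
      show "C_k_on k UNIV (\<psi> n)" for k
        unfolding \<psi>_def using \<phi>(1)
        by (intro C_k_on_add C_k_on_mult C_k_on_const C_k_on_prod C_k_on_power) (auto simp: test_functions_def)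
    qed (use K in \<open>auto simp: \<psi>_def intro!: compact_UN\<close>)
    fix x
    show "(\<lambda>n. \<psi> n x) \<longlonglongrightarrow> indicator U x"
    proof (cases "x \<in> U")
      case True
      obtain \<eta> where "\<eta> \<in> \<B>" "0 < \<eta> x"
        using bump_function[OF assms True] by (auto simp: \<B>_def)
      then have "x \<in> \<Union>\<F>'" unfolding F' \<F>_def by auto
      then obtain i where i: "0 < \<phi> i x"
        using B'(3) rng unfolding \<B>0_def by auto (metis insert_iff rangeE)
      \<comment> \<open>All factors lie in the unit interval, so the product is dominated by the one
        factor that decays geometrically.\<close>
      have "(\<Prod>j<n. (1 - \<phi> j x) ^ n) \<le> (1 - \<phi> i x) ^ n" if "n > i" for n
      proof -
        have "(\<Prod>j<n. (1 - \<phi> j x) ^ n) = (1 - \<phi> i x) ^ n * (\<Prod>j\<in>{..<n}-{i}. (1 - \<phi> j x) ^ n)"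
          using that by (intro prod.remove) auto
        also have "\<dots> \<le> (1 - \<phi> i x) ^ n"
          using \<phi> by (intro mult_left_le prod_le_1) (auto intro!: power_le_one)
        finally show ?thesis .
      qed
      then have "(\<lambda>n. \<Prod>j<n. (1 - \<phi> j x) ^ n) \<longlonglongrightarrow> 0"
        using bd i \<phi>(3)[of i x]
        by (intro tendsto_sandwich[OF _ _ tendsto_const LIMSEQ_realpow_zero[of "1 - \<phi> i x"]])
           (auto simp: eventually_at_top_dense)
      then show ?thesis
        using True tendsto_diff[OF tendsto_const[of 1]] by (fastforce simp: \<psi>_def)
    next
      case False
      then have "\<phi> i x = 0" for i using K by blast
      then show ?thesis using False by (simp add: \<psi>_def)
    qed
  qed
qed

section \<open>Classical gradients\<close>

lemma GDERIV_unique: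
  assumes "GDERIV f x :> D" "GDERIV f x :> D'"
  shows "D = D'"
proof -
  have "(\<lambda>h. h \<bullet> D) = (\<lambda>h. h \<bullet> D')"
    using assms has_derivative_unique unfolding gderiv_def by blast
  then show ?thesis by (metis vector_eq_ldot)
qed

lemma GDERIV_imp_grad: "GDERIV f x :> D \<Longrightarrow> grad f x = D"
  unfolding grad_def by (blast intro: the_equality GDERIV_unique)

lemma C_1_on_imp_continuous_gradient:
  assumes "C_k_on 1 S f"
  shows "\<And>x. x \<in> S \<Longrightarrow> GDERIV f x :> grad f x" "continuous_on S (grad f)"
proof -
  obtain D where D: "\<And>x. x \<in> S \<Longrightarrow> GDERIV f x :> D x" "\<And>b. b \<in> Basis \<Longrightarrow> continuous_on S (\<lambda>x. D x \<bullet> b)"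
    using assms by (auto simp: One_nat_def)
  then have eq: "grad f x = D x" if "x \<in> S" for x
    using that GDERIV_imp_grad by blast
  then show "GDERIV f x :> grad f x" if "x \<in> S" for x
    using D that by auto
  have "continuous_on S D"
    using D(2) by (subst continuous_on_componentwise) auto
  then show "continuous_on S (grad f)"
    using eq by (simp cong: continuous_on_cong)
qed

lemma grad_eq_0_off_support:
  assumes "closed K" "\<And>x. x \<notin> K \<Longrightarrow> f x = 0" "x \<notin> K"
  shows "grad f x = 0"
proof (rule GDERIV_imp_grad)
  have "((\<lambda>x. 0) has_derivative (\<lambda>h. 0)) (at x)" by simp
  then have "(f has_derivative (\<lambda>h. 0)) (at x)"
    by (rule has_derivative_transform_within_open[where s = "- K"]) (use assms in auto)
  then show "GDERIV f x :> 0" by (simp add: gderiv_def)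
qed

lemma test_functionsE:
  assumes "\<phi> \<in> test_functions \<Omega>"
  obtains K where "compact K" "K \<subseteq> \<Omega>" "\<And>x. x \<notin> K \<Longrightarrow> \<phi> x = 0" "\<And>x. x \<notin> K \<Longrightarrow> grad \<phi> x = 0"
    "\<And>x. GDERIV \<phi> x :> grad \<phi> x" "continuous_on UNIV \<phi>" "continuous_on UNIV (grad \<phi>)"
proof -
  obtain K where K: "compact K" "K \<subseteq> \<Omega>" "\<And>x. x \<notin> K \<Longrightarrow> \<phi> x = 0"
    using assms unfolding test_functions_def by blast
  have "C_k_on 0 UNIV \<phi>" "C_k_on 1 UNIV \<phi>"
    using assms unfolding test_functions_def by blast+
  with K C_1_on_imp_continuous_gradient[of UNIV \<phi>] that[of K] grad_eq_0_off_support[of K \<phi>]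
  show thesis by (simp add: compact_imp_closed)
qed

section \<open>Integration by parts\<close>

lemma GDERIV_imp_directional_derivative:
  assumes "GDERIV h x :> D"
  shows "((\<lambda>t. h (x + t *\<^sub>R b)) has_real_derivative D \<bullet> b) (at 0)"
proof -
  have "((\<lambda>t. x + t *\<^sub>R b) has_derivative (\<lambda>t. t *\<^sub>R b)) (at 0)"
    by (auto intro!: derivative_eq_intros)
  moreover have "(h has_derivative (\<lambda>v. v \<bullet> D)) (at (x + 0 *\<^sub>R b))"
    using assms by (simp add: gderiv_def)
  ultimately have "((\<lambda>t. h (x + t *\<^sub>R b)) has_derivative (\<lambda>t. (t *\<^sub>R b) \<bullet> D)) (at 0)"
    by (rule has_derivative_compose)
  then show ?thesis
    by (simp add: has_field_derivative_def mult_commute_abs inner_commute)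
qed

lemma continuous_compact_support_bounded:
  fixes f :: "'a::topological_space \<Rightarrow> 'b::real_normed_vector"
  assumes "continuous_on UNIV f" "compact K" "\<And>x. x \<notin> K \<Longrightarrow> f x = 0"
  obtains B where "B > 0" "\<And>x. norm (f x) \<le> B"
proof -
  have "bounded (f ` K)"
    using assms by (meson compact_continuous_image compact_imp_bounded continuous_on_subset subset_UNIV)
  then obtain B where "B > 0" "\<forall>y\<in>f ` K. norm y \<le> B"
    using bounded_pos by blast
  then show thesis
    using assms(3) by (intro that[of B]) (metis image_eqI less_le norm_zero)+
qed

lemma continuous_compact_support_integrable:
  fixes f :: "'a::euclidean_space \<Rightarrow> 'b::{banach, second_countable_topology}"
  assumes "continuous_on UNIV f" "compact K" "\<And>x. x \<notin> K \<Longrightarrow> f x = 0"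
  shows "integrable lborel f"
proof -
  have "integrable lborel (\<lambda>x. indicator K x *\<^sub>R f x)"
    using assms by (intro borel_integrable_compact) (auto intro: continuous_on_subset)
  moreover have "(\<lambda>x. indicator K x *\<^sub>R f x) = f"
    using assms(3) by (auto simp: indicator_def)
  ultimately show ?thesis by simp
qed

text \<open>Translation invariance of Lebesgue measure makes the integral of every difference
  quotient 0, and dominated convergence passes this on to the derivative. Nothing is integrated
  coordinate by coordinate.\<close>

lemma integral_directional_derivative_eq_0:
  fixes h :: "'a::euclidean_space \<Rightarrow> real"
  assumes h: "\<And>x. GDERIV h x :> D x" and D: "continuous_on UNIV D"
    and K: "compact K" "\<And>x. x \<notin> K \<Longrightarrow> h x = 0"
  shows "(\<integral>x. D x \<bullet> b \<partial>lebesgue) = 0"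
proof -
  have D0: "D x = 0" if "x \<notin> K" for x
    using grad_eq_0_off_support[of K h x] K that GDERIV_imp_grad[OF h] by (simp add: compact_imp_closed)
  obtain B where B: "B > 0" "\<And>x. norm (D x) \<le> B"
    using continuous_compact_support_bounded[OF D K(1) D0] by blast
  obtain R where R: "\<And>x. x \<in> K \<Longrightarrow> norm x \<le> R"
    using compact_imp_bounded[OF K(1)] bounded_iff by blast
  have cont_h: "continuous_on UNIV h"
    using h GDERIV_imp_continuous_on by blast
  have [measurable]: "h \<in> borel_measurable borel" "D \<in> borel_measurable borel"
    using cont_h D by (auto intro: borel_measurable_continuous_onI)
  have int_h: "integrable lborel h"
    using continuous_compact_support_integrable[OF cont_h K] .
  define q where "q = (\<lambda>n x. (h (x + inverse (real (Suc n)) *\<^sub>R b) - h x) / inverse (real (Suc n)))"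
  have "(\<lambda>n. \<integral>x. q n x \<partial>lborel) \<longlonglongrightarrow> (\<integral>x. D x \<bullet> b \<partial>lborel)"
  proof (rule integral_dominated_convergence)
    \<comment> \<open>On the ball the mean value inequality bounds the quotient by
      \<open>B * norm b\<close>. Off the ball both \<open>x\<close> and the shifted point miss
      \<open>K\<close>, because the step is at most 1.\<close>
    let ?w = "\<lambda>x::'a. indicator (cball 0 (R + norm b)) x *\<^sub>R (B * norm b)"
    show "integrable lborel ?w"
      by (rule borel_integrable_compact) auto
    show "AE x in lborel. (\<lambda>n. q n x) \<longlonglongrightarrow> D x \<bullet> b"
    proof (rule AE_I2)
      fix x
      have "((\<lambda>t. (h (x + t *\<^sub>R b) - h x) / t) \<longlongrightarrow> D x \<bullet> b) (at 0)"
        using GDERIV_imp_directional_derivative[OF h, of x b] by (simp add: has_field_derivative_iff)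
      moreover have "filterlim (\<lambda>n. inverse (real (Suc n))) (at 0) sequentially"
        by (rule filterlim_atI[OF LIMSEQ_inverse_real_of_nat]) simp
      ultimately show "(\<lambda>n. q n x) \<longlonglongrightarrow> D x \<bullet> b"
        unfolding q_def by (rule filterlim_compose)
    qed
    show "AE x in lborel. norm (q n x) \<le> ?w x" for n
    proof (rule AE_I2)
      fix x
      let ?t = "inverse (real (Suc n))"
      have t: "0 < ?t" "?t \<le> 1" by (auto simp: inverse_le_1_iff)
      show "norm (q n x) \<le> ?w x"
      proof (cases "x \<in> cball 0 (R + norm b)")
        case True
        have "norm (h (x + ?t *\<^sub>R b) - h x) \<le> B * norm (x + ?t *\<^sub>R b - x)"
        proof (rule differentiable_bound[of UNIV h "\<lambda>x v. v \<bullet> D x"])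
          show "onorm (\<lambda>v. v \<bullet> D y) \<le> B" for y
            by (rule onorm_le) (metis B(2) Cauchy_Schwarz_ineq2 mult.commute mult_right_mono
                norm_ge_zero order_trans real_norm_def)
        qed (use h in \<open>auto simp: gderiv_def\<close>)
        also have "\<dots> = B * (?t * norm b)" using t(1) by simp
        finally have "norm (h (x + ?t *\<^sub>R b) - h x) / ?t \<le> B * norm b"
          using t(1) by (simp add: divide_le_eq mult_ac)
        then show ?thesis using True t(1) by (simp add: q_def)
      next
        case False
        have "norm (x + ?t *\<^sub>R b) \<ge> norm x - norm (?t *\<^sub>R b)"
          by (metis add_diff_cancel_right' norm_triangle_ineq4 diff_le_eq)
        moreover have "norm (?t *\<^sub>R b) \<le> norm b"
          using t by (simp add: mult_left_le_one_le)
        moreover have "norm x > R + norm b"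
          using False by simp
        ultimately have "x \<notin> K" "x + ?t *\<^sub>R b \<notin> K"
          using R[of x] R[of "x + ?t *\<^sub>R b"] norm_ge_zero[of b] by linarith+
        then show ?thesis using K(2) False by (simp add: q_def)
      qed
    qed
  qed (simp_all add: q_def)
  moreover have "(\<integral>x. q n x \<partial>lborel) = 0" for n
  proof -
    let ?c = "inverse (real (Suc n)) *\<^sub>R b"
    have "(\<integral>x. h (x + ?c) \<partial>lborel) = (\<integral>x. h x \<partial>distr lborel borel ((+) ?c))"
      by (subst integral_distr) (auto simp: add.commute)
    also have "\<dots> = (\<integral>x. h x \<partial>lborel)"
      by (simp add: lborel_distr_plus)
    finally have eq: "(\<integral>x. h (x + ?c) \<partial>lborel) = (\<integral>x. h x \<partial>lborel)" .
    have "integrable (distr lborel borel ((+) ?c)) h"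
      using int_h by (simp add: lborel_distr_plus)
    then have "integrable lborel (\<lambda>x. h (x + ?c))"
      by (subst (asm) integrable_distr_eq) (auto simp: add.commute)
    with eq int_h show ?thesis
      by (simp add: q_def)
  qed
  ultimately have "(\<integral>x. D x \<bullet> b \<partial>lborel) = 0"
    by (simp add: LIMSEQ_const_iff)
  then show ?thesis
    by (subst integral_completion) auto
qed

lemma integral_lebesgue_on_eq_lebesgue:
  fixes f :: "'a::euclidean_space \<Rightarrow> 'b::euclidean_space"
  assumes "\<Omega> \<in> sets lebesgue" "\<And>x. x \<notin> \<Omega> \<Longrightarrow> f x = 0"
  shows "(\<integral>x. f x \<partial>lebesgue_on \<Omega>) = (\<integral>x. f x \<partial>lebesgue)"
    and "integrable (lebesgue_on \<Omega>) f \<longleftrightarrow> integrable lebesgue f"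
proof -
  have eq: "(\<lambda>x. indicator \<Omega> x *\<^sub>R f x) = f"
    using assms(2) by (auto simp: indicator_def)
  show "(\<integral>x. f x \<partial>lebesgue_on \<Omega>) = (\<integral>x. f x \<partial>lebesgue)"
       "integrable (lebesgue_on \<Omega>) f \<longleftrightarrow> integrable lebesgue f"
    using assms(1) by (simp_all add: integral_restrict_space integrable_restrict_space eq)
qed

lemma locally_integrable_mult_integrable:
  assumes "open \<Omega>" "locally_integrable \<Omega> f" "continuous_on UNIV \<phi>"
    and K: "compact K" "K \<subseteq> \<Omega>" "\<And>x. x \<notin> K \<Longrightarrow> \<phi> x = 0"
  shows "integrable (lebesgue_on \<Omega>) (\<lambda>x. f x * (\<phi> x :: real))"
proof -
  obtain B where B: "B > 0" "\<And>x. norm (\<phi> x) \<le> B"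
    using continuous_compact_support_bounded[OF assms(3) K(1,3)] by blast
  have int: "integrable lebesgue (\<lambda>x. indicator K x *\<^sub>R f x)"
    using assms(2) K unfolding locally_integrable_def
    by (subst integrable_restrict_space[symmetric]) (auto intro: fmeasurableD lmeasurable_compact)
  have "\<phi> \<in> borel_measurable borel"
    using assms(3) by (rule borel_measurable_continuous_onI)
  then have [measurable]: "\<phi> \<in> borel_measurable lebesgue"
    by (simp add: borel_measurable_if_D measurable_completion)
  have "integrable lebesgue (\<lambda>x. (indicator K x *\<^sub>R f x) * \<phi> x)"
  proof (rule Bochner_Integration.integrable_bound)
    show "integrable lebesgue (\<lambda>x. B * (indicator K x *\<^sub>R f x))"
      using int by simp
    show "(\<lambda>x. (indicator K x *\<^sub>R f x) * \<phi> x) \<in> borel_measurable lebesgue"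
      using int by (intro borel_measurable_times) auto
    show "AE x in lebesgue. norm ((indicator K x *\<^sub>R f x) * \<phi> x) \<le> norm (B * (indicator K x *\<^sub>R f x))"
      using B by (auto simp: abs_mult mult.commute intro!: AE_I2 mult_right_mono)
  qed
  moreover have "(\<lambda>x. (indicator K x *\<^sub>R f x) * \<phi> x) = (\<lambda>x. f x * \<phi> x)"
    using K(3) by (force simp: indicator_def)
  ultimately show ?thesis
    using assms(1) K by (subst integral_lebesgue_on_eq_lebesgue) (auto simp: subset_iff)
qed

lemma continuous_imp_locally_integrable:
  fixes f :: "'a::euclidean_space \<Rightarrow> 'b::euclidean_space"
  assumes "continuous_on UNIV f"
  shows "locally_integrable \<Omega> f"
  unfolding locally_integrable_def
proof safe
  fix K :: "'a set" assume K: "compact K"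
  have "integrable lborel (\<lambda>x. indicator K x *\<^sub>R f x)"
    using assms K by (intro borel_integrable_compact) (auto intro: continuous_on_subset)
  then have "integrable lebesgue (\<lambda>x. indicator K x *\<^sub>R f x)"
    by (subst integrable_completion) auto
  then show "integrable (lebesgue_on K) f"
    using K by (subst integrable_restrict_space) (auto intro: fmeasurableD lmeasurable_compact)
qed

text \<open>The product of \<open>\<phi>\<close> and \<open>\<psi>\<close> has compact support, so
  its directional derivative integrates to 0; the product rule splits that integral into the two
  sides.\<close>

lemma test_function_has_weak_gradient:
  assumes "open \<Omega>" "\<phi> \<in> test_functions \<Omega>"
  shows "has_weak_gradient \<Omega> \<phi> (grad \<phi>)"
  unfolding has_weak_gradient_def
proof (intro conjI ballI)
  from assms(2) obtain K where K: "compact K" "K \<subseteq> \<Omega>" "\<And>x. x \<notin> K \<Longrightarrow> \<phi> x = 0"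
      "\<And>x. x \<notin> K \<Longrightarrow> grad \<phi> x = 0" "\<And>x. GDERIV \<phi> x :> grad \<phi> x"
      "continuous_on UNIV \<phi>" "continuous_on UNIV (grad \<phi>)"
    by (rule test_functionsE) blast
  show loc: "locally_integrable \<Omega> \<phi>" "locally_integrable \<Omega> (grad \<phi>)"
    using K by (auto intro: continuous_imp_locally_integrable)
  fix \<psi> and b :: 'a assume "\<psi> \<in> test_functions \<Omega>" "b \<in> Basis"
  then obtain L where L: "compact L" "L \<subseteq> \<Omega>" "\<And>x. x \<notin> L \<Longrightarrow> \<psi> x = 0"
      "\<And>x. x \<notin> L \<Longrightarrow> grad \<psi> x = 0" "\<And>x. GDERIV \<psi> x :> grad \<psi> x"
      "continuous_on UNIV \<psi>" "continuous_on UNIV (grad \<psi>)"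
    by (auto elim: test_functionsE)
  have "(\<integral>x. (\<phi> x *\<^sub>R grad \<psi> x + \<psi> x *\<^sub>R grad \<phi> x) \<bullet> b \<partial>lebesgue) = 0"
    by (rule integral_directional_derivative_eq_0[OF GDERIV_mult[OF K(5) L(5)] _ K(1)])
       (use K L in \<open>auto intro!: continuous_intros\<close>)
  then have 0: "(\<integral>x. \<phi> x * (grad \<psi> x \<bullet> b) + (grad \<phi> x \<bullet> b) * \<psi> x \<partial>lebesgue_on \<Omega>) = 0"
    using assms(1) L(2) L(3,4)[OF contra_subsetD[OF L(2)]]
    by (subst integral_lebesgue_on_eq_lebesgue) (auto simp: inner_add_left mult.commute)
  have "integrable (lebesgue_on \<Omega>) (\<lambda>x. \<phi> x * (grad \<psi> x \<bullet> b))"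
    using L by (intro locally_integrable_mult_integrable[OF assms(1) loc(1) _ L(1,2)] continuous_intros) auto
  moreover have "integrable (lebesgue_on \<Omega>) (\<lambda>x. (grad \<phi> x \<bullet> b) * \<psi> x)"
    using K by (intro locally_integrable_mult_integrable[OF assms(1) _ L(6,1,2,3)]
        continuous_imp_locally_integrable continuous_intros) auto
  ultimately show "(\<integral>x. \<phi> x * (grad \<psi> x \<bullet> b) \<partial>lebesgue_on \<Omega>) = - (\<integral>x. (grad \<phi> x \<bullet> b) * \<psi> x \<partial>lebesgue_on \<Omega>)"
    using 0 by simp
qed

text \<open>Poincare's inequality follows by integrating the \<open>b\<close>-derivative of \<open>(x \<bullet> b) * (\<phi> x)\<^sup>2\<close>.\<close>

lemma Poincare_test_function:
  fixes \<Omega> :: "'a::euclidean_space set"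
  assumes "open \<Omega>" "\<phi> \<in> test_functions \<Omega>" "\<And>x. x \<in> \<Omega> \<Longrightarrow> norm x \<le> R" "R \<ge> 0"
  shows "(\<integral>x. (\<phi> x)\<^sup>2 \<partial>lebesgue_on \<Omega>) \<le> 4 * R\<^sup>2 * (\<integral>x. (norm (grad \<phi> x))\<^sup>2 \<partial>lebesgue_on \<Omega>)"
proof -
  obtain b :: 'a where b: "b \<in> Basis" by (rule nonempty_Basis[THEN ex_in_conv[THEN iffD2], THEN exE])
  from assms(2) obtain K where K: "compact K" "K \<subseteq> \<Omega>" "\<And>x. x \<notin> K \<Longrightarrow> \<phi> x = 0"
      "\<And>x. x \<notin> K \<Longrightarrow> grad \<phi> x = 0" "\<And>x. GDERIV \<phi> x :> grad \<phi> x"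
      "continuous_on UNIV \<phi>" "continuous_on UNIV (grad \<phi>)"
    by (rule test_functionsE) blast
  let ?D = "\<lambda>x. (x \<bullet> b) *\<^sub>R (\<phi> x *\<^sub>R grad \<phi> x + \<phi> x *\<^sub>R grad \<phi> x) + (\<phi> x * \<phi> x) *\<^sub>R b"
  have "GDERIV (\<lambda>x. (x \<bullet> b) * (\<phi> x * \<phi> x)) x :> ?D x" for x
    by (intro GDERIV_mult K(5)) (auto simp: gderiv_def intro!: derivative_eq_intros)
  then have 0: "(\<integral>x. ?D x \<bullet> b \<partial>lebesgue) = 0"
    by (rule integral_directional_derivative_eq_0[OF _ _ K(1)])
       (use K in \<open>auto intro!: continuous_intros\<close>)
  have int: "integrable lebesgue f" if "continuous_on UNIV f" "\<And>x. x \<notin> K \<Longrightarrow> f x = 0" for f :: "'a \<Rightarrow> real"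
    using continuous_compact_support_integrable[OF that(1) K(1) that(2)]
    by (subst integrable_completion) (auto intro: borel_measurable_continuous_onI[OF that(1)])
  have i1: "integrable lebesgue (\<lambda>x. (\<phi> x)\<^sup>2)" "integrable lebesgue (\<lambda>x. (norm (grad \<phi> x))\<^sup>2)"
    using K by (auto intro!: int continuous_intros)
  have i2: "integrable lebesgue (\<lambda>x. ?D x \<bullet> b)"
    using K by (intro int continuous_intros) auto
  \<comment> \<open>Completing the square: with the \<open>b\<close>-components \<open>s\<close> of
    \<open>x\<close> and \<open>g\<close> of the gradient, \<open>?D x \<bullet> b\<close> is the
    square of \<open>\<phi> x\<close> plus \<open>2 * s * g * \<phi> x\<close>, and half of the
    first term absorbs the mixed one. Integrating and doubling gives the factor 4.\<close>
  have "0 \<le> ?D x \<bullet> b - (\<phi> x)\<^sup>2 / 2 + 2 * R\<^sup>2 * (norm (grad \<phi> x))\<^sup>2" for x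
  proof (cases "x \<in> K")
    case True
    define s g where "s = x \<bullet> b" and "g = grad \<phi> x \<bullet> b"
    have "\<bar>s\<bar> \<le> R"
      using assms(3)[of x] True K(2) Basis_le_norm[OF b, of x] by (force simp: s_def)
    moreover have "\<bar>g\<bar> \<le> norm (grad \<phi> x)"
      using Basis_le_norm[OF b] by (simp add: g_def)
    ultimately have "\<bar>s * g\<bar> \<le> \<bar>R * norm (grad \<phi> x)\<bar>"
      using assms(4) by (simp add: abs_mult mult_mono)
    then have "(s * g)\<^sup>2 \<le> (R * norm (grad \<phi> x))\<^sup>2"
      by (rule abs_le_square_iff[THEN iffD1])
    moreover have "?D x \<bullet> b - (\<phi> x)\<^sup>2 / 2 = (\<phi> x + 2 * s * g)\<^sup>2 / 2 - 2 * (s * g)\<^sup>2"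
      using b by (simp add: inner_add_left s_def[symmetric] g_def[symmetric] power2_eq_square field_simps)
    moreover have "0 \<le> (\<phi> x + 2 * s * g)\<^sup>2 / 2" by simp
    ultimately show ?thesis
      unfolding power_mult_distrib by linarith
  qed (use K in simp)
  then have "0 \<le> (\<integral>x. ?D x \<bullet> b - (\<phi> x)\<^sup>2 / 2 + 2 * R\<^sup>2 * (norm (grad \<phi> x))\<^sup>2 \<partial>lebesgue)"
    by simp
  also have "\<dots> = 2 * R\<^sup>2 * (\<integral>x. (norm (grad \<phi> x))\<^sup>2 \<partial>lebesgue) - (\<integral>x. (\<phi> x)\<^sup>2 \<partial>lebesgue) / 2"
    using i1 i2 0 by (simp del: inner_add_left)
  finally have "(\<integral>x. (\<phi> x)\<^sup>2 \<partial>lebesgue) \<le> 4 * R\<^sup>2 * (\<integral>x. (norm (grad \<phi> x))\<^sup>2 \<partial>lebesgue)"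
    by simp
  then show ?thesis
    using assms(1) K(2) K(3,4)[OF contra_subsetD[OF K(2)]]
    by (simp add: integral_lebesgue_on_eq_lebesgue)
qed

section \<open>The fundamental lemma and weak gradients\<close>

text \<open>First step from test functions towards measurable sets: the approximations of the
  indicator are bounded by 1, so \<open>\<bar>G\<bar>\<close> dominates.\<close>

lemma test_function_nonneg_imp_open_nonneg:
  fixes G :: "'a::euclidean_space \<Rightarrow> real"
  assumes "open V" and G: "integrable lebesgue G"
    and nonneg: "\<And>\<phi>. \<phi> \<in> test_functions V \<Longrightarrow> (\<And>x. 0 \<le> \<phi> x) \<Longrightarrow> 0 \<le> (\<integral>x. G x * \<phi> x \<partial>lebesgue)"
  shows "0 \<le> (\<integral>x. G x * indicator V x \<partial>lebesgue)"
proof -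
  obtain \<psi> :: "nat \<Rightarrow> 'a \<Rightarrow> real" where \<psi>: "\<And>n. \<psi> n \<in> test_functions V"
      "\<And>n x. 0 \<le> \<psi> n x" "\<And>n x. \<psi> n x \<le> 1" "\<And>x. (\<lambda>n. \<psi> n x) \<longlonglongrightarrow> indicator V x"
    using test_functions_open_indicator[OF \<open>open V\<close>] by blast
  have cont: "continuous_on UNIV (\<psi> n)" for n
    using \<psi>(1) by (rule test_functionsE)
  have meas: "\<psi> n \<in> borel_measurable lebesgue" for n
    using cont by (auto intro!: measurable_completion borel_measurable_continuous_onI)
  have "(\<lambda>n. \<integral>x. G x * \<psi> n x \<partial>lebesgue) \<longlonglongrightarrow> (\<integral>x. G x * indicator V x \<partial>lebesgue)"
  proof (rule integral_dominated_convergence)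
    show "integrable lebesgue (\<lambda>x. norm (G x))" using G by simp
    show "(\<lambda>x. G x * indicator V x) \<in> borel_measurable lebesgue"
      using G \<open>open V\<close> by (intro borel_measurable_times borel_measurable_indicator) auto
    show "(\<lambda>x. G x * \<psi> n x) \<in> borel_measurable lebesgue" for n
      using G meas by (intro borel_measurable_times) auto
    show "AE x in lebesgue. (\<lambda>n. G x * \<psi> n x) \<longlonglongrightarrow> G x * indicator V x"
      using \<psi>(4) by (intro AE_I2 tendsto_mult tendsto_const) auto
    show "AE x in lebesgue. norm (G x * \<psi> n x) \<le> norm (G x)" for n
      using \<psi>(2,3)[of n] by (intro AE_I2) (simp add: abs_mult mult_left_le)
  qed
  then show ?thesis
    using nonneg[OF \<psi>(1) \<psi>(2)] by (intro LIMSEQ_le_const) auto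
qed

text \<open>Outer regularity supplies open supersets of small excess. Their finite intersections
  decrease, so the indicators converge everywhere except at points outside \<open>E\<close> that lie
  in all of them, and these form a null set.\<close>

lemma lebesgue_indicator_limit_open:
  fixes E :: "'a::euclidean_space set"
  assumes "E \<in> sets lebesgue" "E \<subseteq> U" "open U"
  obtains V where "\<And>n::nat. open (V n)" "\<And>n. V n \<subseteq> U"
    "AE x in lebesgue. (\<lambda>n. indicator (V n) x :: real) \<longlonglongrightarrow> indicator E x"
proof -
  have "\<exists>T. open T \<and> E \<subseteq> T \<and> T - E \<in> lmeasurable \<and> emeasure lebesgue (T - E) < ennreal (1 / Suc n)" for n
    by (rule sets_lebesgue_outer_open[OF assms(1), of "1 / Suc n"]) auto
  then obtain T where T: "\<And>n. open (T n)" "\<And>n. E \<subseteq> T n" "\<And>n. T n - E \<in> lmeasurable"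
      "\<And>n. emeasure lebesgue (T n - E) < ennreal (1 / Suc n)"
    by metis
  define N where "N = (\<Inter>n. T n - E)"
  have N: "N \<in> sets lebesgue"
    unfolding N_def using T(3) by (intro sets.countable_INT) (auto intro: fmeasurableD)
  have "emeasure lebesgue N \<le> ennreal (1 / Suc n)" for n
  proof -
    have "emeasure lebesgue N \<le> emeasure lebesgue (T n - E)"
      unfolding N_def using T(3) by (intro emeasure_mono) (auto intro: fmeasurableD)
    then show ?thesis using T(4)[of n] by (meson less_imp_le order_trans)
  qed
  moreover have "(\<lambda>n. ennreal (1 / Suc n)) \<longlonglongrightarrow> ennreal 0"
    using LIMSEQ_inverse_real_of_nat by (intro tendsto_ennrealI) (simp add: inverse_eq_divide)
  ultimately have "emeasure lebesgue N \<le> ennreal 0"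
    by (intro LIMSEQ_le_const[of "\<lambda>n. ennreal (1 / Suc n)"]) auto
  then have "N \<in> null_sets lebesgue"
    using N by auto
  show thesis
  proof (rule that[of "\<lambda>n. U \<inter> (\<Inter>i\<le>n. T i)"])
    show "open (U \<inter> (\<Inter>i\<le>n. T i))" for n
      using T(1) assms(3) by auto
    show "AE x in lebesgue. (\<lambda>n. indicator (U \<inter> (\<Inter>i\<le>n. T i)) x :: real) \<longlonglongrightarrow> indicator E x"
    proof (rule AE_I'[OF \<open>N \<in> null_sets lebesgue\<close>], safe)
      fix x assume *: "\<not> (\<lambda>n. indicator (U \<inter> (\<Inter>i\<le>n. T i)) x :: real) \<longlonglongrightarrow> indicator E x"
      have "x \<notin> E"
      proof
        assume "x \<in> E"
        then have "indicator (U \<inter> (\<Inter>i\<le>n. T i)) x = (1::real)" for n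
          using T(2) assms(2) by (auto simp: indicator_def)
        with * \<open>x \<in> E\<close> show False by simp
      qed
      moreover have "x \<in> T i" for i
      proof (rule ccontr)
        assume "x \<notin> T i"
        then have "indicator (U \<inter> (\<Inter>i\<le>n. T i)) x = (0::real)" if "n \<ge> i" for n
          using that by (auto simp: indicator_def)
        then have "(\<lambda>n. indicator (U \<inter> (\<Inter>i\<le>n. T i)) x :: real) \<longlonglongrightarrow> 0"
          by (intro tendsto_eventually) (auto simp: eventually_sequentially)
        with * \<open>x \<notin> E\<close> show False by simp
      qed
      ultimately show "x \<in> N" by (simp add: N_def)
    qed
  qed auto
qed

text \<open>The sign of the integral passes from open sets to the set \<open>E\<close> where
  \<open>g\<close> is negative. There the integrand is strictly negative, so \<open>E\<close> must
  be null.\<close>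

lemma AE_nonneg_if_test_function_nonneg_box:
  fixes g :: "'a::euclidean_space \<Rightarrow> real"
  assumes "open \<Omega>" and g: "locally_integrable \<Omega> g" and K: "cbox a b \<subseteq> \<Omega>"
    and nonneg: "\<And>\<phi>. \<phi> \<in> test_functions \<Omega> \<Longrightarrow> (\<And>x. 0 \<le> \<phi> x) \<Longrightarrow> 0 \<le> (\<integral>x. g x * \<phi> x \<partial>lebesgue_on \<Omega>)"
  shows "AE x in lebesgue. x \<in> box a b \<longrightarrow> 0 \<le> g x"
proof -
  \<comment> \<open>The closed box is compact, so local integrability makes the cut-off function
    integrable on the whole space.\<close>
  define G where "G = (\<lambda>x. indicator (cbox a b) x *\<^sub>R g x)"
  have G: "integrable lebesgue G"
    unfolding G_def using g K by (subst integrable_restrict_space[symmetric]) (auto simp: locally_integrable_def)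
  have open_nonneg: "0 \<le> (\<integral>x. G x * indicator V x \<partial>lebesgue)" if "open V" "V \<subseteq> box a b" for V
  proof (rule test_function_nonneg_imp_open_nonneg[OF that(1) G])
    fix \<phi> :: "'a \<Rightarrow> real" assume \<phi>: "\<phi> \<in> test_functions V" "\<And>x. 0 \<le> \<phi> x"
    then have 0: "\<phi> x = 0" if "x \<notin> V" for x
      using that unfolding test_functions_def by blast
    have VK: "V \<subseteq> cbox a b" using that(2) box_subset_cbox by blast
    have "\<phi> \<in> test_functions \<Omega>"
      using \<phi>(1) test_functions_mono[of V \<Omega>] VK K by blast
    from nonneg[OF this \<phi>(2)] have "0 \<le> (\<integral>x. g x * \<phi> x \<partial>lebesgue_on \<Omega>)" .
    also have "\<dots> = (\<integral>x. g x * \<phi> x \<partial>lebesgue)"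
      using assms(1) 0 VK K by (intro integral_lebesgue_on_eq_lebesgue) auto
    also have "(\<lambda>x. g x * \<phi> x) = (\<lambda>x. G x * \<phi> x)"
      using 0 VK by (force simp: G_def indicator_def)
    finally show "0 \<le> (\<integral>x. G x * \<phi> x \<partial>lebesgue)" .
  qed
  define E where "E = {x \<in> box a b. G x < 0}"
  have G_meas [measurable]: "G \<in> borel_measurable lebesgue"
    using G by simp
  have "{x \<in> space lebesgue. G x < 0} \<in> sets lebesgue"
    using G_meas by (rule borel_measurable_less) simp
  moreover have "E = box a b \<inter> {x \<in> space lebesgue. G x < 0}" by (auto simp: E_def)
  ultimately have E: "E \<in> sets lebesgue"
    by (simp add: fmeasurableD sets.Int)
  obtain V where V: "\<And>n::nat. open (V n)" "\<And>n. V n \<subseteq> box a b"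
      "AE x in lebesgue. (\<lambda>n. indicator (V n) x :: real) \<longlonglongrightarrow> indicator E x"
    by (rule lebesgue_indicator_limit_open[OF E _ open_box, of a b]) (auto simp: E_def)
  have "(\<lambda>n. \<integral>x. G x * indicator (V n) x \<partial>lebesgue) \<longlonglongrightarrow> (\<integral>x. G x * indicator E x \<partial>lebesgue)"
  proof (rule integral_dominated_convergence)
    show "integrable lebesgue (\<lambda>x. norm (G x))" using G by simp
    show "(\<lambda>x. G x * indicator E x) \<in> borel_measurable lebesgue"
      using E by (intro borel_measurable_times borel_measurable_indicator G_meas)
    show "(\<lambda>x. G x * indicator (V n) x) \<in> borel_measurable lebesgue" for n
      using V(1) by (intro borel_measurable_times borel_measurable_indicator G_meas) auto
    show "AE x in lebesgue. (\<lambda>n. G x * indicator (V n) x) \<longlonglongrightarrow> G x * indicator E x"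
      using V(3) by eventually_elim (intro tendsto_intros)
    show "AE x in lebesgue. norm (G x * indicator (V n) x) \<le> norm (G x)" for n
      by (intro AE_I2) (simp add: indicator_def)
  qed
  then have "0 \<le> (\<integral>x. G x * indicator E x \<partial>lebesgue)"
    using open_nonneg V by (intro LIMSEQ_le_const) auto
  then have int_le: "(\<integral>x. - (G x * indicator E x) \<partial>lebesgue) \<le> 0"
    by simp
  have int: "integrable lebesgue (\<lambda>x. - (G x * indicator E x))"
    using integrable_real_mult_indicator[OF E G] by simp
  have nn: "AE x in lebesgue. 0 \<le> - (G x * indicator E x)"
    by (intro AE_I2) (auto simp: E_def indicator_def)
  have "(\<integral>x. - (G x * indicator E x) \<partial>lebesgue) = 0"
    using integral_nonneg_AE[OF nn] int_le by (rule antisym[rotated])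
  then have "AE x in lebesgue. - (G x * indicator E x) = 0"
    using integral_nonneg_eq_0_iff_AE[OF int nn] by blast
  then show ?thesis
  proof eventually_elim
    case (elim x)
    show ?case
    proof
      assume x: "x \<in> box a b"
      then have "G x = g x" using box_subset_cbox[of a b] by (auto simp: G_def)
      then show "0 \<le> g x"
        using elim x by (cases "G x < 0") (simp_all add: E_def)
    qed
  qed
qed

text \<open>By Lindelof countably many boxes cover the set, so the exceptional sets still unite to a
  null set.\<close>

lemma AE_nonneg_if_test_function_nonneg:
  fixes g :: "'a::euclidean_space \<Rightarrow> real"
  assumes "open \<Omega>" "locally_integrable \<Omega> g"
    and "\<And>\<phi>. \<phi> \<in> test_functions \<Omega> \<Longrightarrow> (\<And>x. 0 \<le> \<phi> x) \<Longrightarrow> 0 \<le> (\<integral>x. g x * \<phi> x \<partial>lebesgue_on \<Omega>)"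
  shows "AE x in lebesgue_on \<Omega>. 0 \<le> g x"
proof -
  define \<F> where "\<F> = {box a b | a b. cbox a b \<subseteq> \<Omega>}"
  have "\<And>S. S \<in> \<F> \<Longrightarrow> open S" by (auto simp: \<F>_def open_box)
  then obtain \<F>' where F': "\<F>' \<subseteq> \<F>" "countable \<F>'" "\<Union>\<F>' = \<Union>\<F>"
    using Lindelof by metis
  have "\<Omega> \<subseteq> \<Union>\<F>"
  proof
    fix x assume "x \<in> \<Omega>"
    then obtain a b where "cbox a b \<subseteq> \<Omega>" "x \<in> box a b"
      using open_contains_cbox[OF assms(1)] by metis
    then show "x \<in> \<Union>\<F>" by (auto simp: \<F>_def)
  qed
  moreover have "AE x in lebesgue. \<forall>S\<in>\<F>'. x \<in> S \<longrightarrow> 0 \<le> g x"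
  proof (intro AE_ball_countable[THEN iffD2] ballI F'(2))
    fix S assume "S \<in> \<F>'"
    then obtain a b where "S = box a b" "cbox a b \<subseteq> \<Omega>"
      using F'(1) by (auto simp: \<F>_def)
    then show "AE x in lebesgue. x \<in> S \<longrightarrow> 0 \<le> g x"
      using AE_nonneg_if_test_function_nonneg_box[OF assms(1,2) _ assms(3)] by simp
  qed
  then have "AE x in lebesgue. x \<in> \<Union>\<F> \<longrightarrow> 0 \<le> g x"
    unfolding F'(3)[symmetric] by eventually_elim blast
  ultimately have "AE x in lebesgue. x \<in> \<Omega> \<longrightarrow> 0 \<le> g x"
    by (elim eventually_mono) blast
  then show ?thesis
    using assms(1) by (subst AE_restrict_space_iff) auto
qed

lemma AE_zero_if_test_function_zero:
  fixes g :: "'a::euclidean_space \<Rightarrow> real"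
  assumes "open \<Omega>" and g: "locally_integrable \<Omega> g"
    and 0: "\<And>\<phi>. \<phi> \<in> test_functions \<Omega> \<Longrightarrow> (\<integral>x. g x * \<phi> x \<partial>lebesgue_on \<Omega>) = 0"
  shows "AE x in lebesgue_on \<Omega>. g x = 0"
proof -
  have "locally_integrable \<Omega> (\<lambda>x. - g x)"
    using g by (simp add: locally_integrable_def)
  then have "AE x in lebesgue_on \<Omega>. 0 \<le> - g x"
    using 0 by (intro AE_nonneg_if_test_function_nonneg[OF assms(1)]) auto
  moreover have "AE x in lebesgue_on \<Omega>. 0 \<le> g x"
    using 0 by (intro AE_nonneg_if_test_function_nonneg[OF assms(1,2)]) auto
  ultimately show ?thesis by eventually_elim simp
qed

section \<open>Linearity and uniqueness of weak gradients\<close>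

lemma locally_integrable_inner:
  "locally_integrable \<Omega> f \<Longrightarrow> locally_integrable \<Omega> (\<lambda>x. f x \<bullet> (b::'b::euclidean_space))"
  unfolding locally_integrable_def by auto

lemma test_function_mult_integrable:
  assumes "open \<Omega>" "locally_integrable \<Omega> f" "\<phi> \<in> test_functions \<Omega>"
  shows "integrable (lebesgue_on \<Omega>) (\<lambda>x. f x * \<phi> x)"
    and "integrable (lebesgue_on \<Omega>) (\<lambda>x. f x * (grad \<phi> x \<bullet> b))"
proof -
  from assms(3) obtain K where K: "compact K" "K \<subseteq> \<Omega>" "\<And>x. x \<notin> K \<Longrightarrow> \<phi> x = 0"
      "\<And>x. x \<notin> K \<Longrightarrow> grad \<phi> x = 0" "\<And>x. GDERIV \<phi> x :> grad \<phi> x"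
      "continuous_on UNIV \<phi>" "continuous_on UNIV (grad \<phi>)"
    by (rule test_functionsE) blast
  show "integrable (lebesgue_on \<Omega>) (\<lambda>x. f x * \<phi> x)"
      "integrable (lebesgue_on \<Omega>) (\<lambda>x. f x * (grad \<phi> x \<bullet> b))"
    using K by (auto intro!: locally_integrable_mult_integrable[OF assms(1,2) _ K(1,2)] continuous_intros)
qed

lemma has_weak_gradient_lincomb:
  fixes \<Omega> :: "'a::euclidean_space set"
  assumes "open \<Omega>" "has_weak_gradient \<Omega> v g" "has_weak_gradient \<Omega> w h"
  shows "has_weak_gradient \<Omega> (\<lambda>x. c * v x + d * w x) (\<lambda>x. c *\<^sub>R g x + d *\<^sub>R h x)"
  unfolding has_weak_gradient_def
proof (intro conjI ballI)
  have loc: "locally_integrable \<Omega> v" "locally_integrable \<Omega> w" "locally_integrable \<Omega> g" "locally_integrable \<Omega> h"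
    using assms unfolding has_weak_gradient_def by auto
  then show "locally_integrable \<Omega> (\<lambda>x. c * v x + d * w x)" "locally_integrable \<Omega> (\<lambda>x. c *\<^sub>R g x + d *\<^sub>R h x)"
    unfolding locally_integrable_def by auto
  fix \<phi> and b :: 'a assume \<phi>: "\<phi> \<in> test_functions \<Omega>" and b: "b \<in> Basis"
  note i = test_function_mult_integrable[OF assms(1) _ \<phi>]
  have "(\<integral>x. (c * v x + d * w x) * (grad \<phi> x \<bullet> b) \<partial>lebesgue_on \<Omega>)
      = c * (\<integral>x. v x * (grad \<phi> x \<bullet> b) \<partial>lebesgue_on \<Omega>) + d * (\<integral>x. w x * (grad \<phi> x \<bullet> b) \<partial>lebesgue_on \<Omega>)"
    using i(2)[OF loc(1), of b] i(2)[OF loc(2), of b] by (simp add: distrib_right mult.assoc)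
  also have "\<dots> = - (c * (\<integral>x. (g x \<bullet> b) * \<phi> x \<partial>lebesgue_on \<Omega>) + d * (\<integral>x. (h x \<bullet> b) * \<phi> x \<partial>lebesgue_on \<Omega>))"
    using assms(2,3) \<phi> b unfolding has_weak_gradient_def by auto
  also have "\<dots> = - (\<integral>x. ((c *\<^sub>R g x + d *\<^sub>R h x) \<bullet> b) * \<phi> x \<partial>lebesgue_on \<Omega>)"
    using i(1)[OF locally_integrable_inner[OF loc(3)], of b] i(1)[OF locally_integrable_inner[OF loc(4)], of b]
    by (simp add: distrib_right mult.assoc inner_add_left)
  finally show "(\<integral>x. (c * v x + d * w x) * (grad \<phi> x \<bullet> b) \<partial>lebesgue_on \<Omega>)
      = - (\<integral>x. ((c *\<^sub>R g x + d *\<^sub>R h x) \<bullet> b) * \<phi> x \<partial>lebesgue_on \<Omega>)" .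
qed

lemma locally_integrable_diff:
  "locally_integrable \<Omega> f \<Longrightarrow> locally_integrable \<Omega> g \<Longrightarrow> locally_integrable \<Omega> (\<lambda>x. f x - g x)"
  unfolding locally_integrable_def by auto

text \<open>The fundamental lemma is applied to each component of the difference. This determines
  the arbitrary choice \<open>weak_grad\<close> up to null sets.\<close>

lemma has_weak_gradient_unique:
  fixes \<Omega> :: "'a::euclidean_space set"
  assumes "open \<Omega>" "has_weak_gradient \<Omega> v g" "has_weak_gradient \<Omega> v h"
  shows "AE x in lebesgue_on \<Omega>. g x = h x"
proof -
  have loc: "locally_integrable \<Omega> g" "locally_integrable \<Omega> h"
    using assms unfolding has_weak_gradient_def by auto
  have "AE x in lebesgue_on \<Omega>. (g x - h x) \<bullet> b = 0" if b: "b \<in> Basis" for b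
  proof (rule AE_zero_if_test_function_zero[OF assms(1)])
    show "locally_integrable \<Omega> (\<lambda>x. (g x - h x) \<bullet> b)"
      using loc by (intro locally_integrable_inner locally_integrable_diff)
    fix \<phi> assume \<phi>: "\<phi> \<in> test_functions \<Omega>"
    have "(\<integral>x. (g x \<bullet> b) * \<phi> x \<partial>lebesgue_on \<Omega>) = (\<integral>x. (h x \<bullet> b) * \<phi> x \<partial>lebesgue_on \<Omega>)"
      using assms(2,3) \<phi> b unfolding has_weak_gradient_def by fastforce
    then show "(\<integral>x. ((g x - h x) \<bullet> b) * \<phi> x \<partial>lebesgue_on \<Omega>) = 0"
      using test_function_mult_integrable(1)[OF assms(1) locally_integrable_inner[OF loc(1)] \<phi>, of b]
        test_function_mult_integrable(1)[OF assms(1) locally_integrable_inner[OF loc(2)] \<phi>, of b]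
      by (simp add: inner_diff_left left_diff_distrib)
  qed
  then have "AE x in lebesgue_on \<Omega>. \<forall>b\<in>Basis. (g x - h x) \<bullet> b = 0"
    by (intro AE_finite_allI) auto
  then show ?thesis
    by eventually_elim (metis eq_iff_diff_eq_0 euclidean_all_zero_iff)
qed

section \<open>Transfer between a.e. equal functions\<close>

text \<open>An effect of the completeness of Lebesgue measure; extension by 0 moves the question
  from \<open>S\<close> to the whole space.\<close>

lemma measurable_lebesgue_on_cong_AE:
  fixes f g :: "'a::euclidean_space \<Rightarrow> 'b::euclidean_space"
  assumes S: "S \<in> sets lebesgue" and eq: "AE x in lebesgue_on S. f x = g x"
    and f: "f \<in> borel_measurable (lebesgue_on S)"
  shows "g \<in> borel_measurable (lebesgue_on S)"
proof -
  have "AE x in lebesgue. x \<in> S \<longrightarrow> f x = g x"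
    using S eq by (subst (asm) AE_restrict_space_iff) auto
  then have "AE x in lebesgue. indicator S x *\<^sub>R f x = indicator S x *\<^sub>R g x"
    by eventually_elim (auto simp: indicator_def)
  moreover have "(\<lambda>x. indicator S x *\<^sub>R f x) \<in> borel_measurable lebesgue"
    using S f by (subst borel_measurable_restrict_space_iff[symmetric]) auto
  ultimately have "(\<lambda>x. indicator S x *\<^sub>R g x) \<in> borel_measurable lebesgue"
    by (rule borel_measurable_AE[rotated])
  then show ?thesis
    using S by (subst borel_measurable_restrict_space_iff) auto
qed

lemma locally_integrable_cong_AE:
  fixes f g :: "'a::euclidean_space \<Rightarrow> 'b::euclidean_space"
  assumes "open \<Omega>" "AE x in lebesgue_on \<Omega>. f x = g x" "locally_integrable \<Omega> f"
  shows "locally_integrable \<Omega> g"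
  unfolding locally_integrable_def
proof safe
  fix K assume K: "compact K" "K \<subseteq> \<Omega>"
  have K': "K \<in> sets lebesgue"
    using K(1) by (auto intro: fmeasurableD lmeasurable_compact)
  have "AE x in lebesgue. x \<in> \<Omega> \<longrightarrow> f x = g x"
    using assms(1,2) by (subst (asm) AE_restrict_space_iff) auto
  then have "AE x in lebesgue. x \<in> K \<longrightarrow> f x = g x"
    using K(2) by (auto elim: eventually_mono)
  then have eq: "AE x in lebesgue_on K. f x = g x"
    using K' by (subst AE_restrict_space_iff) auto
  have "integrable (lebesgue_on K) f"
    using assms(3) K by (auto simp: locally_integrable_def)
  moreover from this have "g \<in> borel_measurable (lebesgue_on K)"
    by (intro measurable_lebesgue_on_cong_AE[OF K' eq]) auto
  ultimately show "integrable (lebesgue_on K) g"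
    using eq Bochner_Integration.integrable_cong_AE[of f "lebesgue_on K" g] by auto
qed

section \<open>Square integrable functions\<close>

lemma L2_iff:
  "f \<in> L2 \<Omega> \<longleftrightarrow> f \<in> borel_measurable (lebesgue_on \<Omega>) \<and> integrable (lebesgue_on \<Omega>) (\<lambda>x. (norm (f x))\<^sup>2)"
  by (simp add: Lp_def powr_numeral)

lemma L2_imp_measurable: "f \<in> L2 \<Omega> \<Longrightarrow> f \<in> borel_measurable (lebesgue_on \<Omega>)"
  by (simp add: L2_iff)

lemma L2_bounded_by:
  fixes f :: "'a::euclidean_space \<Rightarrow> 'b::real_normed_vector"
  assumes "f \<in> borel_measurable (lebesgue_on \<Omega>)" "integrable (lebesgue_on \<Omega>) h"
    and "\<And>x. (norm (f x))\<^sup>2 \<le> h x"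
  shows "f \<in> L2 \<Omega>"
proof -
  have "integrable (lebesgue_on \<Omega>) (\<lambda>x. (norm (f x))\<^sup>2)"
    by (rule Bochner_Integration.integrable_bound[OF assms(2)])
       (use assms(1,3) in \<open>auto intro!: AE_I2 intro: order_trans[OF _ abs_ge_self]\<close>)
  with assms(1) show ?thesis by (simp add: L2_iff)
qed

lemma L2_add:
  fixes f g :: "'a::euclidean_space \<Rightarrow> 'b::euclidean_space"
  assumes "f \<in> L2 \<Omega>" "g \<in> L2 \<Omega>"
  shows "(\<lambda>x. f x + g x) \<in> L2 \<Omega>"
proof (rule L2_bounded_by)
  show "(\<lambda>x. f x + g x) \<in> borel_measurable (lebesgue_on \<Omega>)"
    using assms by (intro borel_measurable_add L2_imp_measurable)
  show "integrable (lebesgue_on \<Omega>) (\<lambda>x. 2 * (norm (f x))\<^sup>2 + 2 * (norm (g x))\<^sup>2)"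
    using assms by (simp add: L2_iff)
  fix x
  have "(norm (f x + g x))\<^sup>2 \<le> (norm (f x) + norm (g x))\<^sup>2"
    by (intro power_mono norm_triangle_ineq) simp
  also have "\<dots> \<le> 2 * (norm (f x))\<^sup>2 + 2 * (norm (g x))\<^sup>2"
    using sum_squares_bound[of "norm (f x)" "norm (g x)"] by (simp add: power2_sum)
  finally show "(norm (f x + g x))\<^sup>2 \<le> 2 * (norm (f x))\<^sup>2 + 2 * (norm (g x))\<^sup>2" .
qed

lemma L2_scaleR:
  fixes f :: "'a::euclidean_space \<Rightarrow> 'b::euclidean_space"
  assumes "f \<in> L2 \<Omega>"
  shows "(\<lambda>x. c *\<^sub>R f x) \<in> L2 \<Omega>"
  using assms by (auto simp: L2_iff power_mult_distrib)

lemma L2_cmult: "f \<in> L2 \<Omega> \<Longrightarrow> (\<lambda>x. c * f x :: real) \<in> L2 \<Omega>"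
  using L2_scaleR[of f \<Omega> c] by simp

lemma L2_diff:
  fixes f g :: "'a::euclidean_space \<Rightarrow> 'b::euclidean_space"
  assumes "f \<in> L2 \<Omega>" "g \<in> L2 \<Omega>"
  shows "(\<lambda>x. f x - g x) \<in> L2 \<Omega>"
  using L2_add[OF assms(1) L2_scaleR[OF assms(2), of "-1"]] by simp

lemma L2_cong_AE:
  fixes f g :: "'a::euclidean_space \<Rightarrow> 'b::euclidean_space"
  assumes "\<Omega> \<in> sets lebesgue" "AE x in lebesgue_on \<Omega>. f x = g x" "f \<in> L2 \<Omega>"
  shows "g \<in> L2 \<Omega>"
proof -
  have f: "f \<in> borel_measurable (lebesgue_on \<Omega>)" and g: "g \<in> borel_measurable (lebesgue_on \<Omega>)"
    using assms measurable_lebesgue_on_cong_AE L2_imp_measurable by blast+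
  have "integrable (lebesgue_on \<Omega>) (\<lambda>x. (norm (f x))\<^sup>2) \<longleftrightarrow> integrable (lebesgue_on \<Omega>) (\<lambda>x. (norm (g x))\<^sup>2)"
    using f g assms(2) by (intro Bochner_Integration.integrable_cong_AE) auto
  then show ?thesis
    using assms(3) g by (simp add: L2_iff)
qed

lemma L2_inner_integrable:
  fixes f g :: "'a::euclidean_space \<Rightarrow> 'b::euclidean_space"
  assumes "f \<in> L2 \<Omega>" "g \<in> L2 \<Omega>"
  shows "integrable (lebesgue_on \<Omega>) (\<lambda>x. f x \<bullet> g x)"
proof (rule Bochner_Integration.integrable_bound)
  show "integrable (lebesgue_on \<Omega>) (\<lambda>x. (norm (f x))\<^sup>2 + (norm (g x))\<^sup>2)"
    using assms by (simp add: L2_iff)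
  show "(\<lambda>x. f x \<bullet> g x) \<in> borel_measurable (lebesgue_on \<Omega>)"
    using assms by (intro borel_measurable_inner L2_imp_measurable)
  have "norm (f x \<bullet> g x) \<le> norm ((norm (f x))\<^sup>2 + (norm (g x))\<^sup>2)" for x
  proof -
    have "\<bar>f x \<bullet> g x\<bar> \<le> norm (f x) * norm (g x)" by (rule Cauchy_Schwarz_ineq2)
    also have "\<dots> \<le> (norm (f x))\<^sup>2 + (norm (g x))\<^sup>2"
      using sum_squares_bound[of "norm (f x)" "norm (g x)"] mult_nonneg_nonneg[OF norm_ge_zero norm_ge_zero, of "f x" "g x"]
      by linarith
    finally show ?thesis by simp
  qed
  then show "AE x in lebesgue_on \<Omega>. norm (f x \<bullet> g x) \<le> norm ((norm (f x))\<^sup>2 + (norm (g x))\<^sup>2)"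
    by simp
qed

lemma L2_mult_integrable:
  fixes f g :: "'a::euclidean_space \<Rightarrow> real"
  assumes "f \<in> L2 \<Omega>" "g \<in> L2 \<Omega>"
  shows "integrable (lebesgue_on \<Omega>) (\<lambda>x. f x * g x)"
  using L2_inner_integrable[OF assms] by simp

lemma integral_norm_lincomb_squared:
  fixes f g :: "'a::euclidean_space \<Rightarrow> 'b::euclidean_space"
  assumes "f \<in> L2 \<Omega>" "g \<in> L2 \<Omega>"
  shows "(\<integral>x. (norm (c *\<^sub>R f x + d *\<^sub>R g x))\<^sup>2 \<partial>lebesgue_on \<Omega>) =
    c\<^sup>2 * (\<integral>x. (norm (f x))\<^sup>2 \<partial>lebesgue_on \<Omega>) + 2 * c * d * (\<integral>x. f x \<bullet> g x \<partial>lebesgue_on \<Omega>)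
      + d\<^sup>2 * (\<integral>x. (norm (g x))\<^sup>2 \<partial>lebesgue_on \<Omega>)"
proof -
  have "(norm (c *\<^sub>R f x + d *\<^sub>R g x))\<^sup>2
      = c\<^sup>2 * (norm (f x))\<^sup>2 + 2 * c * d * (f x \<bullet> g x) + d\<^sup>2 * (norm (g x))\<^sup>2" for x
    by (simp only: power2_norm_eq_inner)
       (simp add: inner_add_left inner_add_right inner_commute power2_eq_square algebra_simps)
  then show ?thesis
    using assms L2_inner_integrable[OF assms] by (simp add: L2_iff)
qed

text \<open>The discriminant argument for the nonnegative quadratic form given by the squared norm
  of \<open>c *\<^sub>R f + d *\<^sub>R g\<close>.\<close>

lemma L2_Cauchy_Schwarz:
  fixes f g :: "'a::euclidean_space \<Rightarrow> 'b::euclidean_space"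
  assumes "f \<in> L2 \<Omega>" "g \<in> L2 \<Omega>"
  shows "(\<integral>x. f x \<bullet> g x \<partial>lebesgue_on \<Omega>)\<^sup>2 \<le>
    (\<integral>x. (norm (f x))\<^sup>2 \<partial>lebesgue_on \<Omega>) * (\<integral>x. (norm (g x))\<^sup>2 \<partial>lebesgue_on \<Omega>)"
proof -
  define A B C where "A = (\<integral>x. (norm (f x))\<^sup>2 \<partial>lebesgue_on \<Omega>)"
    and "B = (\<integral>x. (norm (g x))\<^sup>2 \<partial>lebesgue_on \<Omega>)" and "C = (\<integral>x. f x \<bullet> g x \<partial>lebesgue_on \<Omega>)"
  have nonneg: "0 \<le> c\<^sup>2 * A + 2 * c * d * C + d\<^sup>2 * B" for c d
    using integral_norm_lincomb_squared[OF assms, of c d] integral_nonneg_AE[of "\<lambda>x. (norm (c *\<^sub>R f x + d *\<^sub>R g x))\<^sup>2" "lebesgue_on \<Omega>"]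
    by (simp add: A_def B_def C_def)
  have "B \<ge> 0" by (simp add: B_def)
  have "C\<^sup>2 \<le> A * B"
  proof (cases "B = 0")
    case True
    have "C = 0"
    proof (rule ccontr)
      assume "C \<noteq> 0"
      then have "C\<^sup>2 > 0" by simp
      \<comment> \<open>With first coefficient 1, the second is chosen such that the form takes the
        value \<open>A - (A + 1)\<close>.\<close>
      then show False
        using nonneg[of 1 "- (A + 1) / (2 * C)"] \<open>C \<noteq> 0\<close> True by (simp add: power2_eq_square field_simps)
    qed
    then show ?thesis using True by simp
  next
    case False
    \<comment> \<open>The coefficients \<open>B\<close> and \<open>- C\<close> minimise the form up
      to scaling; its value factors as stated.\<close>
    have "0 \<le> B * (A * B - C\<^sup>2)"
      using nonneg[of B "-C"] by (simp add: power2_eq_square algebra_simps)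
    with False \<open>B \<ge> 0\<close> show ?thesis
      by (simp add: zero_le_mult_iff)
  qed
  then show ?thesis by (simp add: A_def B_def C_def)
qed

lemma tendsto_zero_if_square_le:
  fixes a b :: "nat \<Rightarrow> real"
  assumes "\<And>n. (a n)\<^sup>2 \<le> b n" "b \<longlonglongrightarrow> 0"
  shows "a \<longlonglongrightarrow> 0"
proof -
  have "(\<lambda>n. (a n)\<^sup>2) \<longlonglongrightarrow> 0"
    by (rule tendsto_sandwich[OF _ _ tendsto_const assms(2)]) (use assms(1) in auto)
  then have "(\<lambda>n. sqrt ((a n)\<^sup>2)) \<longlonglongrightarrow> sqrt 0"
    by (rule tendsto_real_sqrt)
  then show ?thesis by (simp add: tendsto_rabs_zero_iff)
qed

text \<open>The inner product minus its limit splits into three terms, each with a factor tending to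
  0; Cauchy-Schwarz handles all of them.\<close>

lemma tendsto_L2_inner:
  fixes f g :: "'a::euclidean_space \<Rightarrow> 'b::euclidean_space"
  assumes "\<And>n. F n \<in> L2 \<Omega>" "f \<in> L2 \<Omega>" "\<And>n. G n \<in> L2 \<Omega>" "g \<in> L2 \<Omega>"
    and F: "(\<lambda>n. \<integral>x. (norm (F n x - f x))\<^sup>2 \<partial>lebesgue_on \<Omega>) \<longlonglongrightarrow> 0"
    and G: "(\<lambda>n. \<integral>x. (norm (G n x - g x))\<^sup>2 \<partial>lebesgue_on \<Omega>) \<longlonglongrightarrow> 0"
  shows "(\<lambda>n. \<integral>x. F n x \<bullet> G n x \<partial>lebesgue_on \<Omega>) \<longlonglongrightarrow> (\<integral>x. f x \<bullet> g x \<partial>lebesgue_on \<Omega>)"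
proof -
  have FL: "(\<lambda>x. F n x - f x) \<in> L2 \<Omega>" and GL: "(\<lambda>x. G n x - g x) \<in> L2 \<Omega>" for n
    using assms by (auto intro: L2_diff)
  let ?I = "\<lambda>u v. \<integral>x. u x \<bullet> v x \<partial>lebesgue_on \<Omega>"
  have 1: "(\<lambda>n. ?I (\<lambda>x. F n x - f x) (\<lambda>x. G n x - g x)) \<longlonglongrightarrow> 0"
    by (rule tendsto_zero_if_square_le[OF L2_Cauchy_Schwarz[OF FL GL] tendsto_mult_zero[OF F G]])
  have 2: "(\<lambda>n. ?I (\<lambda>x. F n x - f x) g) \<longlonglongrightarrow> 0"
    by (rule tendsto_zero_if_square_le[OF L2_Cauchy_Schwarz[OF FL assms(4)] tendsto_mult_left_zero[OF F]])
  have 3: "(\<lambda>n. ?I f (\<lambda>x. G n x - g x)) \<longlonglongrightarrow> 0"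
    by (rule tendsto_zero_if_square_le[OF L2_Cauchy_Schwarz[OF assms(2) GL] tendsto_mult_right_zero[OF G]])
  have "?I (F n) (G n) = ?I (\<lambda>x. F n x - f x) (\<lambda>x. G n x - g x) + ?I (\<lambda>x. F n x - f x) g
      + ?I f (\<lambda>x. G n x - g x) + ?I f g" for n
  proof -
    note i = L2_inner_integrable[OF FL[of n] GL[of n]] L2_inner_integrable[OF FL[of n] assms(4)]
      L2_inner_integrable[OF assms(2) GL[of n]] L2_inner_integrable[OF assms(2,4)]
    have "F n x \<bullet> G n x = (F n x - f x) \<bullet> (G n x - g x) + (F n x - f x) \<bullet> g x
        + f x \<bullet> (G n x - g x) + f x \<bullet> g x" for x
      by (simp add: inner_diff_left inner_diff_right)
    then have "?I (F n) (G n) = (\<integral>x. (F n x - f x) \<bullet> (G n x - g x) + (F n x - f x) \<bullet> g x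
        + f x \<bullet> (G n x - g x) + f x \<bullet> g x \<partial>lebesgue_on \<Omega>)"
      by presburger
    then show ?thesis
      using i by (simp only: Bochner_Integration.integral_add Bochner_Integration.integrable_add)
  qed
  then show ?thesis
    using tendsto_add[OF tendsto_add[OF tendsto_add[OF 1 2] 3] tendsto_const[of "?I f g"]] by simp
qed

lemma L2_const:
  assumes "\<Omega> \<in> lmeasurable"
  shows "(\<lambda>x. c) \<in> L2 \<Omega>"
  using assms finite_measure.integrable_const[OF finite_measure_lebesgue_on[OF assms]] by (simp add: L2_iff)

lemma L2_norm_in_L2: "f \<in> L2 \<Omega> \<Longrightarrow> (\<lambda>x. norm (f x)) \<in> L2 \<Omega>"
  by (auto simp: L2_iff)

lemma L2_imp_integrable:
  fixes f :: "'a::euclidean_space \<Rightarrow> 'b::euclidean_space"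
  assumes "\<Omega> \<in> lmeasurable" "f \<in> L2 \<Omega>"
  shows "integrable (lebesgue_on \<Omega>) f"
proof -
  have "integrable (lebesgue_on \<Omega>) (\<lambda>x. norm (f x) * 1)"
    using L2_mult_integrable[OF L2_norm_in_L2 L2_const] assms by blast
  then show ?thesis
    using L2_imp_measurable[OF assms(2)] by (simp add: integrable_norm_iff)
qed

lemma L1_le_L2:
  fixes f :: "'a::euclidean_space \<Rightarrow> 'b::euclidean_space"
  assumes "\<Omega> \<in> lmeasurable" "f \<in> L2 \<Omega>"
  shows "(\<integral>x. norm (f x) \<partial>lebesgue_on \<Omega>)\<^sup>2 \<le> (\<integral>x. (norm (f x))\<^sup>2 \<partial>lebesgue_on \<Omega>) * measure lebesgue \<Omega>"
  using L2_Cauchy_Schwarz[OF L2_norm_in_L2[OF assms(2)] L2_const[OF assms(1), of "1::real"]] assms(1)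
  by (simp add: measure_restrict_space fmeasurableD)

lemma Linf_imp_L2:
  assumes "\<Omega> \<in> lmeasurable" "f \<in> Linf \<Omega>"
  shows "f \<in> L2 \<Omega>"
proof -
  obtain c where f: "f \<in> borel_measurable (lebesgue_on \<Omega>)" and c: "AE x in lebesgue_on \<Omega>. \<bar>f x\<bar> \<le> c"
    using assms(2) by (auto simp: Linf_def)
  have "integrable (lebesgue_on \<Omega>) (\<lambda>x. (norm (f x))\<^sup>2)"
  proof (rule Bochner_Integration.integrable_bound)
    show "integrable (lebesgue_on \<Omega>) (\<lambda>x. c\<^sup>2)"
      using finite_measure.integrable_const[OF finite_measure_lebesgue_on[OF assms(1)]] .
    show "AE x in lebesgue_on \<Omega>. norm ((norm (f x))\<^sup>2) \<le> norm (c\<^sup>2)"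
      using c
    proof eventually_elim
      case (elim x)
      then show ?case using power_mono[of "\<bar>f x\<bar>" c 2] by simp
    qed
  qed (use f in simp)
  with f show ?thesis by (simp add: L2_iff)
qed

text \<open>Riesz-Fischer. On finite measure a Cauchy sequence in \<open>L2\<close> is Cauchy in
  \<open>L1\<close> and hence has an a.e. convergent subsequence. Fatou's lemma then bounds the
  distance of the whole sequence to the pointwise limit.\<close>

lemma L2_complete:
  fixes f :: "nat \<Rightarrow> 'a::euclidean_space \<Rightarrow> 'b::euclidean_space"
  assumes \<Omega>: "\<Omega> \<in> lmeasurable" and f: "\<And>n. f n \<in> L2 \<Omega>"
    and Cauchy: "\<And>e. e > 0 \<Longrightarrow> \<exists>N. \<forall>m\<ge>N. \<forall>n\<ge>N. (\<integral>x. (norm (f m x - f n x))\<^sup>2 \<partial>lebesgue_on \<Omega>) < e"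
  obtains g where "g \<in> L2 \<Omega>" "(\<lambda>n. \<integral>x. (norm (f n x - g x))\<^sup>2 \<partial>lebesgue_on \<Omega>) \<longlonglongrightarrow> 0"
proof -
  let ?M = "lebesgue_on \<Omega>"
  have [measurable]: "f n \<in> borel_measurable ?M" for n
    using f L2_imp_measurable by blast
  have "\<exists>N. \<forall>i\<ge>N. \<forall>j\<ge>N. (\<integral>x. norm (f i x - f j x) \<partial>?M) < e" if "e > 0" for e
  proof -
    \<comment> \<open>The tolerance is divided by \<open>m + 1\<close>, since \<open>m\<close> may
      be 0.\<close>
    define m where "m = measure lebesgue \<Omega>"
    have "m \<ge> 0" by (simp add: m_def)
    have "e\<^sup>2 / (m + 1) > 0" using \<open>e > 0\<close> \<open>m \<ge> 0\<close> by simp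
    from Cauchy[OF this] obtain N where
      N: "\<And>i j. i \<ge> N \<Longrightarrow> j \<ge> N \<Longrightarrow> (\<integral>x. (norm (f i x - f j x))\<^sup>2 \<partial>?M) < e\<^sup>2 / (m + 1)"
      by blast
    have "(\<integral>x. norm (f i x - f j x) \<partial>?M) < e" if "i \<ge> N" "j \<ge> N" for i j
    proof -
      have "(\<integral>x. norm (f i x - f j x) \<partial>?M)\<^sup>2 \<le> (\<integral>x. (norm (f i x - f j x))\<^sup>2 \<partial>?M) * m"
        unfolding m_def using L1_le_L2[OF \<Omega> L2_diff[OF f f]] .
      also have "\<dots> \<le> e\<^sup>2 / (m + 1) * m"
        using N[OF that] \<open>m \<ge> 0\<close> by (intro mult_right_mono) auto
      also have "\<dots> < e\<^sup>2"
        using \<open>m \<ge> 0\<close> \<open>e > 0\<close> by (simp add: divide_less_eq)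
      finally show ?thesis
        using \<open>e > 0\<close> by (intro power_less_imp_less_base[of _ 2 e]) auto
    qed
    then show ?thesis by blast
  qed
  then obtain r where r: "strict_mono r" "AE x in ?M. Cauchy (\<lambda>i. f (r i) x)"
    using cauchy_L1_AE_cauchy_subseq[of ?M f] L2_imp_integrable[OF \<Omega> f] by blast
  define g where "g = (\<lambda>x. lim (\<lambda>i. f (r i) x))"
  have [measurable]: "g \<in> borel_measurable ?M"
    unfolding g_def by (rule borel_measurable_lim_metric) measurable
  have lim: "AE x in ?M. (\<lambda>i. f (r i) x) \<longlonglongrightarrow> g x"
    using r(2) by eventually_elim (simp add: g_def Cauchy_convergent_iff convergent_LIMSEQ_iff)
  \<comment> \<open>Integrability is asserted with the bound: the Bochner integral of a
    nonintegrable function is 0, so the bound alone would say nothing.\<close>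
  have small: "integrable ?M (\<lambda>x. (norm (f n x - g x))\<^sup>2) \<and> (\<integral>x. (norm (f n x - g x))\<^sup>2 \<partial>?M) \<le> e"
    if "e > 0" and N: "\<forall>m\<ge>N. \<forall>n\<ge>N. (\<integral>x. (norm (f m x - f n x))\<^sup>2 \<partial>?M) < e" and "n \<ge> N" for e N n
  proof -
    have "(\<integral>\<^sup>+x. ennreal ((norm (f n x - g x))\<^sup>2) \<partial>?M)
        = (\<integral>\<^sup>+x. liminf (\<lambda>i. ennreal ((norm (f n x - f (r i) x))\<^sup>2)) \<partial>?M)"
    proof (rule nn_integral_cong_AE)
      show "AE x in ?M. ennreal ((norm (f n x - g x))\<^sup>2) = liminf (\<lambda>i. ennreal ((norm (f n x - f (r i) x))\<^sup>2))"
        using lim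
      proof eventually_elim
        case (elim x)
        then have "(\<lambda>i. ennreal ((norm (f n x - f (r i) x))\<^sup>2)) \<longlonglongrightarrow> ennreal ((norm (f n x - g x))\<^sup>2)"
          by (intro tendsto_ennrealI tendsto_intros)
        then show ?case
          using lim_imp_Liminf trivial_limit_sequentially by metis
      qed
    qed
    also have "\<dots> \<le> liminf (\<lambda>i. \<integral>\<^sup>+x. ennreal ((norm (f n x - f (r i) x))\<^sup>2) \<partial>?M)"
      by (rule nn_integral_liminf) measurable
    also have "\<dots> \<le> ennreal e"
    proof (rule Liminf_le)
      show "eventually (\<lambda>i. (\<integral>\<^sup>+x. ennreal ((norm (f n x - f (r i) x))\<^sup>2) \<partial>?M) \<le> ennreal e) sequentially"
        using eventually_ge_at_top[of N]
      proof eventually_elim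
        case (elim i)
        then have "r i \<ge> N" using seq_suble[OF r(1), of i] by linarith
        have "(\<integral>\<^sup>+x. ennreal ((norm (f n x - f (r i) x))\<^sup>2) \<partial>?M) = ennreal (\<integral>x. (norm (f n x - f (r i) x))\<^sup>2 \<partial>?M)"
          using L2_diff[OF f f, of n "r i"] by (intro nn_integral_eq_integral) (auto simp: L2_iff)
        also have "\<dots> \<le> ennreal e"
          using N \<open>n \<ge> N\<close> \<open>r i \<ge> N\<close> by (intro ennreal_leI less_imp_le) auto
        finally show ?case .
      qed
    qed simp
    finally have le: "(\<integral>\<^sup>+x. ennreal ((norm (f n x - g x))\<^sup>2) \<partial>?M) \<le> ennreal e" .
    have int: "integrable ?M (\<lambda>x. (norm (f n x - g x))\<^sup>2)"
      using le_less_trans[OF le ennreal_less_top] by (intro integrableI_nonneg) auto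
    then have "ennreal (\<integral>x. (norm (f n x - g x))\<^sup>2 \<partial>?M) \<le> ennreal e"
      using le by (subst nn_integral_eq_integral[symmetric]) auto
    then show ?thesis
      using int \<open>e > 0\<close> by (simp add: ennreal_le_iff)
  qed
  obtain N where "\<forall>m\<ge>N. \<forall>n\<ge>N. (\<integral>x. (norm (f m x - f n x))\<^sup>2 \<partial>?M) < 1"
    using Cauchy[of 1] by auto
  from small[OF _ this order_refl] have "(\<lambda>x. f N x - g x) \<in> L2 \<Omega>"
    by (simp add: L2_iff)
  from L2_diff[OF f[of N] this] have "g \<in> L2 \<Omega>" by simp
  moreover have "(\<lambda>n. \<integral>x. (norm (f n x - g x))\<^sup>2 \<partial>?M) \<longlonglongrightarrow> 0"
  proof (rule LIMSEQ_I)
    fix e :: real assume "e > 0"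
    then obtain N where "\<forall>m\<ge>N. \<forall>n\<ge>N. (\<integral>x. (norm (f m x - f n x))\<^sup>2 \<partial>?M) < e / 2"
      using Cauchy[of "e / 2"] by auto
    then show "\<exists>N. \<forall>n\<ge>N. norm ((\<integral>x. (norm (f n x - g x))\<^sup>2 \<partial>?M) - 0) < e"
      using small[of "e / 2" N] \<open>e > 0\<close> by (intro exI[of _ N]) fastforce
  qed
  ultimately show thesis by (rule that)
qed

section \<open>Sobolev functions on bounded open sets\<close>

lemma tendsto_L2_lincomb_zero:
  fixes F G :: "nat \<Rightarrow> 'a::euclidean_space \<Rightarrow> 'b::euclidean_space"
  assumes L2: "\<And>n. F n \<in> L2 \<Omega>" "\<And>n. G n \<in> L2 \<Omega>"
    and F: "(\<lambda>n. \<integral>x. (norm (F n x))\<^sup>2 \<partial>lebesgue_on \<Omega>) \<longlonglongrightarrow> 0"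
    and G: "(\<lambda>n. \<integral>x. (norm (G n x))\<^sup>2 \<partial>lebesgue_on \<Omega>) \<longlonglongrightarrow> 0"
  shows "(\<lambda>n. \<integral>x. (norm (c *\<^sub>R F n x + d *\<^sub>R G n x))\<^sup>2 \<partial>lebesgue_on \<Omega>) \<longlonglongrightarrow> 0"
proof -
  have FG: "(\<lambda>n. \<integral>x. F n x \<bullet> G n x \<partial>lebesgue_on \<Omega>) \<longlonglongrightarrow> 0"
    by (rule tendsto_zero_if_square_le[OF L2_Cauchy_Schwarz[OF L2] tendsto_mult_zero[OF F G]])
  have "(\<lambda>n. c\<^sup>2 * (\<integral>x. (norm (F n x))\<^sup>2 \<partial>lebesgue_on \<Omega>)
      + 2 * c * d * (\<integral>x. F n x \<bullet> G n x \<partial>lebesgue_on \<Omega>)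
      + d\<^sup>2 * (\<integral>x. (norm (G n x))\<^sup>2 \<partial>lebesgue_on \<Omega>)) \<longlonglongrightarrow> 0"
    by (intro tendsto_add_zero tendsto_mult_right_zero F G FG)
  then show ?thesis
    by (simp only: integral_norm_lincomb_squared[OF L2])
qed

locale bounded_open_set =
  fixes \<Omega> :: "'a::euclidean_space set"
  assumes open_set: "open \<Omega>" and bounded_set: "bounded \<Omega>"
begin

lemma lmeasurable_set: "\<Omega> \<in> lmeasurable"
  using open_set bounded_set by (rule lmeasurable_open[rotated])

lemma sets_set: "\<Omega> \<in> sets lebesgue"
  using lmeasurable_set by (rule fmeasurableD)

lemma L2_locally_integrable:
  fixes f :: "'a \<Rightarrow> 'b::euclidean_space"
  assumes "f \<in> L2 \<Omega>"
  shows "locally_integrable \<Omega> f"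
  unfolding locally_integrable_def
proof safe
  fix K assume K: "compact K" "K \<subseteq> \<Omega>"
  have K': "K \<in> sets lebesgue"
    using K(1) by (auto intro: fmeasurableD lmeasurable_compact)
  have "set_integrable lebesgue \<Omega> f"
    using L2_imp_integrable[OF lmeasurable_set assms] sets_set
    by (simp add: set_integrable_def integrable_restrict_space)
  then have "set_integrable lebesgue K f"
    using K' K(2) by (rule set_integrable_subset)
  then show "integrable (lebesgue_on K) f"
    using K' by (simp add: set_integrable_def integrable_restrict_space)
qed

lemma test_function_L2:
  assumes "\<phi> \<in> test_functions \<Omega>"
  shows "\<phi> \<in> L2 \<Omega>" "grad \<phi> \<in> L2 \<Omega>"
proof -
  from assms obtain K where K: "compact K" "K \<subseteq> \<Omega>" "\<And>x. x \<notin> K \<Longrightarrow> \<phi> x = 0"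
      "\<And>x. x \<notin> K \<Longrightarrow> grad \<phi> x = 0" "\<And>x. GDERIV \<phi> x :> grad \<phi> x"
      "continuous_on UNIV \<phi>" "continuous_on UNIV (grad \<phi>)"
    by (rule test_functionsE) blast
  have "f \<in> L2 \<Omega>" if f: "continuous_on UNIV f" "\<And>x. x \<notin> K \<Longrightarrow> f x = 0" for f :: "'a \<Rightarrow> 'b::euclidean_space"
  proof -
    have "continuous_on UNIV (\<lambda>x. (norm (f x))\<^sup>2)"
      using f(1) by (intro continuous_intros)
    then have "integrable lborel (\<lambda>x. (norm (f x))\<^sup>2)"
      using K(1) f(2) by (intro continuous_compact_support_integrable[of _ K]) auto
    then have "integrable lebesgue (\<lambda>x. (norm (f x))\<^sup>2)"
      by (subst integrable_completion) auto
    moreover have "(norm (f x))\<^sup>2 = 0" if "x \<notin> \<Omega>" for x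
      using f(2)[of x] K(2) that by auto
    ultimately have "integrable (lebesgue_on \<Omega>) (\<lambda>x. (norm (f x))\<^sup>2)"
      by (subst integral_lebesgue_on_eq_lebesgue(2)[OF sets_set])
    moreover have "f \<in> borel_measurable lebesgue"
      using f(1) by (intro measurable_completion) (auto intro: borel_measurable_continuous_onI)
    then have "f \<in> borel_measurable (lebesgue_on \<Omega>)"
      by (rule measurable_restrict_space1)
    ultimately show ?thesis by (simp add: L2_iff)
  qed
  then show "\<phi> \<in> L2 \<Omega>" "grad \<phi> \<in> L2 \<Omega>"
    using K by blast+
qed

section \<open>The chosen weak gradient, \<open>H1\<close> and \<open>H10\<close>\<close>

lemma has_weak_gradient_weak_grad: "has_weak_gradient \<Omega> v g \<Longrightarrow> has_weak_gradient \<Omega> v (weak_grad \<Omega> v)"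
  unfolding weak_grad_def by (rule someI[of "has_weak_gradient \<Omega> v"])

lemma weak_grad_AE_eq:
  "has_weak_gradient \<Omega> v g \<Longrightarrow> AE x in lebesgue_on \<Omega>. g x = weak_grad \<Omega> v x"
  using has_weak_gradient_unique[OF open_set] has_weak_gradient_weak_grad by blast

text \<open>Membership in \<open>H1\<close> provides some square integrable weak gradient, while
  \<open>weak_grad\<close> may have picked another; a.e. uniqueness carries integrability
  over.\<close>

lemma H1D:
  assumes "v \<in> H1 \<Omega>"
  shows "v \<in> L2 \<Omega>" "weak_grad \<Omega> v \<in> L2 \<Omega>" "has_weak_gradient \<Omega> v (weak_grad \<Omega> v)"
proof -
  obtain g where g: "g \<in> L2 \<Omega>" "has_weak_gradient \<Omega> v g"
    using assms by (auto simp: H1_def)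
  then show "weak_grad \<Omega> v \<in> L2 \<Omega>" "has_weak_gradient \<Omega> v (weak_grad \<Omega> v)"
    using L2_cong_AE[OF sets_set weak_grad_AE_eq] has_weak_gradient_weak_grad by blast+
  show "v \<in> L2 \<Omega>" using assms by (simp add: H1_def)
qed

lemma test_function_H1:
  assumes "\<phi> \<in> test_functions \<Omega>"
  shows "\<phi> \<in> H1 \<Omega>"
  using test_function_L2[OF assms] test_function_has_weak_gradient[OF open_set assms]
  by (auto simp: H1_def)

lemma weak_grad_lincomb_AE:
  assumes "v \<in> H1 \<Omega>" "w \<in> H1 \<Omega>"
  shows "AE x in lebesgue_on \<Omega>. c *\<^sub>R weak_grad \<Omega> v x + d *\<^sub>R weak_grad \<Omega> w x = weak_grad \<Omega> (\<lambda>x. c * v x + d * w x) x"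
  using has_weak_gradient_lincomb[OF open_set] assms H1D(3) weak_grad_AE_eq by blast

lemma H1_lincomb:
  assumes "v \<in> H1 \<Omega>" "w \<in> H1 \<Omega>"
  shows "(\<lambda>x. c * v x + d * w x) \<in> H1 \<Omega>"
proof -
  have "(\<lambda>x. c * v x + d * w x) \<in> L2 \<Omega>"
    using assms by (intro L2_add L2_cmult H1D(1))
  moreover have "(\<lambda>x. c *\<^sub>R weak_grad \<Omega> v x + d *\<^sub>R weak_grad \<Omega> w x) \<in> L2 \<Omega>"
    using assms by (intro L2_add L2_scaleR H1D(2))
  ultimately show ?thesis
    unfolding H1_def using has_weak_gradient_lincomb[OF open_set] assms H1D(3) by blast
qed

lemma H1_norm_diff_squared:
  assumes "v \<in> H1 \<Omega>" "w \<in> H1 \<Omega>"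
  shows "(H1_norm \<Omega> (\<lambda>x. v x - w x))\<^sup>2 = (\<integral>x. (v x - w x)\<^sup>2 \<partial>lebesgue_on \<Omega>)
    + (\<integral>x. (norm (weak_grad \<Omega> v x - weak_grad \<Omega> w x))\<^sup>2 \<partial>lebesgue_on \<Omega>)"
proof -
  have g: "weak_grad \<Omega> (\<lambda>x. v x - w x) \<in> L2 \<Omega>"
    using H1D(2)[OF H1_lincomb[OF assms, of 1 "-1"]] by simp
  have "AE x in lebesgue_on \<Omega>. weak_grad \<Omega> v x - weak_grad \<Omega> w x = weak_grad \<Omega> (\<lambda>x. v x - w x) x"
    using weak_grad_lincomb_AE[OF assms, of 1 "-1"] by simp
  then have "(\<integral>x. (norm (weak_grad \<Omega> (\<lambda>x. v x - w x) x))\<^sup>2 \<partial>lebesgue_on \<Omega>)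
      = (\<integral>x. (norm (weak_grad \<Omega> v x - weak_grad \<Omega> w x))\<^sup>2 \<partial>lebesgue_on \<Omega>)"
    using L2_imp_measurable[OF g] L2_imp_measurable[OF L2_diff[OF H1D(2)[OF assms(1)] H1D(2)[OF assms(2)]]]
    by (intro integral_cong_AE) (auto elim: eventually_mono)
  then show ?thesis by (simp add: H1_norm_def)
qed

lemma weak_grad_test_function_AE:
  "\<phi> \<in> test_functions \<Omega> \<Longrightarrow> AE x in lebesgue_on \<Omega>. grad \<phi> x = weak_grad \<Omega> \<phi> x"
  using weak_grad_AE_eq test_function_has_weak_gradient[OF open_set] by blast

lemma integral_weak_grad_test_function:
  assumes "\<phi> \<in> test_functions \<Omega>" "g \<in> L2 \<Omega>"
  shows "(\<integral>x. (norm (weak_grad \<Omega> \<phi> x - g x))\<^sup>2 \<partial>lebesgue_on \<Omega>)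
    = (\<integral>x. (norm (grad \<phi> x - g x))\<^sup>2 \<partial>lebesgue_on \<Omega>)"
proof (rule integral_cong_AE)
  show "AE x in lebesgue_on \<Omega>. (norm (weak_grad \<Omega> \<phi> x - g x))\<^sup>2 = (norm (grad \<phi> x - g x))\<^sup>2"
    using weak_grad_test_function_AE[OF assms(1)] by eventually_elim simp
qed (use L2_imp_measurable[OF assms(2)] L2_imp_measurable[OF test_function_L2(2)[OF assms(1)]]
      L2_imp_measurable[OF H1D(2)[OF test_function_H1[OF assms(1)]]] in measurable)

text \<open>The \<open>H1\<close> norm dominates both parts separately. The approximants appear with
  their classical gradient, so limit arguments meet the choice \<open>weak_grad\<close> only at
  \<open>v\<close>.\<close>

lemma H10_approx:
  assumes "v \<in> H10 \<Omega>"
  obtains \<phi> :: "nat \<Rightarrow> 'a \<Rightarrow> real" where "\<And>n. \<phi> n \<in> test_functions \<Omega>"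
    "(\<lambda>n. \<integral>x. (norm (\<phi> n x - v x))\<^sup>2 \<partial>lebesgue_on \<Omega>) \<longlonglongrightarrow> 0"
    "(\<lambda>n. \<integral>x. (norm (grad (\<phi> n) x - weak_grad \<Omega> v x))\<^sup>2 \<partial>lebesgue_on \<Omega>) \<longlonglongrightarrow> 0"
proof -
  obtain \<phi> :: "nat \<Rightarrow> 'a \<Rightarrow> real" where \<phi>: "\<And>n. \<phi> n \<in> test_functions \<Omega>"
      and lim: "(\<lambda>n. H1_norm \<Omega> (\<lambda>x. \<phi> n x - v x)) \<longlonglongrightarrow> 0"
    using assms by (auto simp: H10_def)
  have v: "v \<in> H1 \<Omega>" using assms by (simp add: H10_def)
  have sq: "(\<lambda>n. (H1_norm \<Omega> (\<lambda>x. \<phi> n x - v x))\<^sup>2) \<longlonglongrightarrow> 0"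
    using tendsto_power[OF lim, of 2] by simp
  have eq: "(H1_norm \<Omega> (\<lambda>x. \<phi> n x - v x))\<^sup>2 = (\<integral>x. (norm (\<phi> n x - v x))\<^sup>2 \<partial>lebesgue_on \<Omega>)
    + (\<integral>x. (norm (grad (\<phi> n) x - weak_grad \<Omega> v x))\<^sup>2 \<partial>lebesgue_on \<Omega>)" for n
    using H1_norm_diff_squared[OF test_function_H1[OF \<phi>] v] integral_weak_grad_test_function[OF \<phi> H1D(2)[OF v]]
    by simp
  show thesis
  proof (rule that[OF \<phi>])
    show "(\<lambda>n. \<integral>x. (norm (\<phi> n x - v x))\<^sup>2 \<partial>lebesgue_on \<Omega>) \<longlonglongrightarrow> 0"
      by (rule tendsto_sandwich[OF _ _ tendsto_const sq]) (auto simp: eq)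
    show "(\<lambda>n. \<integral>x. (norm (grad (\<phi> n) x - weak_grad \<Omega> v x))\<^sup>2 \<partial>lebesgue_on \<Omega>) \<longlonglongrightarrow> 0"
      by (rule tendsto_sandwich[OF _ _ tendsto_const sq]) (auto simp: eq)
  qed
qed

text \<open>Both sides of the integration by parts formula are \<open>L2\<close> inner products with
  a fixed function, hence continuous along the sequence.\<close>

lemma has_weak_gradient_limit:
  assumes \<phi>: "\<And>n. \<phi> n \<in> test_functions \<Omega>" and v: "v \<in> L2 \<Omega>" and g: "g \<in> L2 \<Omega>"
    and lim: "(\<lambda>n. \<integral>x. (norm (\<phi> n x - v x))\<^sup>2 \<partial>lebesgue_on \<Omega>) \<longlonglongrightarrow> 0"
      "(\<lambda>n. \<integral>x. (norm (grad (\<phi> n) x - g x))\<^sup>2 \<partial>lebesgue_on \<Omega>) \<longlonglongrightarrow> 0"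
  shows "has_weak_gradient \<Omega> v g"
  unfolding has_weak_gradient_def
proof (intro conjI ballI)
  show "locally_integrable \<Omega> v" "locally_integrable \<Omega> g"
    using v g by (auto intro: L2_locally_integrable)
  fix \<psi> and b :: 'a assume \<psi>: "\<psi> \<in> test_functions \<Omega>" and b: "b \<in> Basis"
  have \<psi>b: "(\<lambda>x. grad \<psi> x \<bullet> b) \<in> L2 \<Omega>"
  proof (rule L2_bounded_by)
    show "integrable (lebesgue_on \<Omega>) (\<lambda>x. (norm (grad \<psi> x))\<^sup>2)"
      using test_function_L2(2)[OF \<psi>] by (simp add: L2_iff)
    show "(norm (grad \<psi> x \<bullet> b))\<^sup>2 \<le> (norm (grad \<psi> x))\<^sup>2" for x
      using Basis_le_norm[OF b, of "grad \<psi> x"] by (intro power_mono) auto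
  qed (use L2_imp_measurable[OF test_function_L2(2)[OF \<psi>]] in measurable)
  have \<psi>b': "(\<lambda>x. \<psi> x *\<^sub>R b) \<in> L2 \<Omega>"
    using test_function_L2(1)[OF \<psi>] by (auto simp: L2_iff power_mult_distrib norm_Basis[OF b])
  have const: "(\<lambda>n::nat. \<integral>x. (norm (f x - f x))\<^sup>2 \<partial>lebesgue_on \<Omega>) \<longlonglongrightarrow> 0" for f :: "'a \<Rightarrow> 'b::euclidean_space"
    by simp
  have 1: "(\<lambda>n. \<integral>x. \<phi> n x \<bullet> (grad \<psi> x \<bullet> b) \<partial>lebesgue_on \<Omega>) \<longlonglongrightarrow> (\<integral>x. v x \<bullet> (grad \<psi> x \<bullet> b) \<partial>lebesgue_on \<Omega>)"
    by (rule tendsto_L2_inner[OF test_function_L2(1)[OF \<phi>] v \<psi>b \<psi>b lim(1) const])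
  have 2: "(\<lambda>n. \<integral>x. grad (\<phi> n) x \<bullet> (\<psi> x *\<^sub>R b) \<partial>lebesgue_on \<Omega>) \<longlonglongrightarrow> (\<integral>x. g x \<bullet> (\<psi> x *\<^sub>R b) \<partial>lebesgue_on \<Omega>)"
    by (rule tendsto_L2_inner[OF test_function_L2(2)[OF \<phi>] g \<psi>b' \<psi>b' lim(2) const])
  have "(\<integral>x. \<phi> n x \<bullet> (grad \<psi> x \<bullet> b) \<partial>lebesgue_on \<Omega>) = - (\<integral>x. grad (\<phi> n) x \<bullet> (\<psi> x *\<^sub>R b) \<partial>lebesgue_on \<Omega>)" for n
    using test_function_has_weak_gradient[OF open_set \<phi>, of n] \<psi> b
    unfolding has_weak_gradient_def by (simp add: mult.commute)
  then have "(\<integral>x. v x \<bullet> (grad \<psi> x \<bullet> b) \<partial>lebesgue_on \<Omega>) = - (\<integral>x. g x \<bullet> (\<psi> x *\<^sub>R b) \<partial>lebesgue_on \<Omega>)"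
    using LIMSEQ_unique[OF 1] tendsto_minus[OF 2] by simp
  then show "(\<integral>x. v x * (grad \<psi> x \<bullet> b) \<partial>lebesgue_on \<Omega>) = - (\<integral>x. (g x \<bullet> b) * \<psi> x \<partial>lebesgue_on \<Omega>)"
    by (simp add: mult.commute)
qed

text \<open>Converse of \<open>H10_approx\<close> and the way into \<open>H10\<close>:
  \<open>g\<close> is merely a limit of gradients, and its being a weak gradient is part of what is
  proved.\<close>

lemma H10I:
  assumes \<phi>: "\<And>n. \<phi> n \<in> test_functions \<Omega>" and v: "v \<in> L2 \<Omega>" and g: "g \<in> L2 \<Omega>"
    and lim: "(\<lambda>n. \<integral>x. (norm (\<phi> n x - v x))\<^sup>2 \<partial>lebesgue_on \<Omega>) \<longlonglongrightarrow> 0"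
      "(\<lambda>n. \<integral>x. (norm (grad (\<phi> n) x - g x))\<^sup>2 \<partial>lebesgue_on \<Omega>) \<longlonglongrightarrow> 0"
  shows "v \<in> H10 \<Omega>" "AE x in lebesgue_on \<Omega>. g x = weak_grad \<Omega> v x"
proof -
  have wg: "has_weak_gradient \<Omega> v g"
    by (rule has_weak_gradient_limit[OF assms])
  then show ae: "AE x in lebesgue_on \<Omega>. g x = weak_grad \<Omega> v x"
    by (rule weak_grad_AE_eq)
  have v1: "v \<in> H1 \<Omega>"
    using v g wg by (auto simp: H1_def)
  have "(\<integral>x. (norm (grad (\<phi> n) x - g x))\<^sup>2 \<partial>lebesgue_on \<Omega>)
      = (\<integral>x. (norm (grad (\<phi> n) x - weak_grad \<Omega> v x))\<^sup>2 \<partial>lebesgue_on \<Omega>)" for n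
  proof (rule integral_cong_AE)
    show "AE x in lebesgue_on \<Omega>. (norm (grad (\<phi> n) x - g x))\<^sup>2 = (norm (grad (\<phi> n) x - weak_grad \<Omega> v x))\<^sup>2"
      using ae by eventually_elim simp
  qed (use L2_imp_measurable[OF g] L2_imp_measurable[OF test_function_L2(2)[OF \<phi>, of n]]
      L2_imp_measurable[OF H1D(2)[OF v1]] in measurable)
  then have "(H1_norm \<Omega> (\<lambda>x. \<phi> n x - v x))\<^sup>2 = (\<integral>x. (norm (\<phi> n x - v x))\<^sup>2 \<partial>lebesgue_on \<Omega>)
    + (\<integral>x. (norm (grad (\<phi> n) x - g x))\<^sup>2 \<partial>lebesgue_on \<Omega>)" for n
    using H1_norm_diff_squared[OF test_function_H1[OF \<phi>] v1] integral_weak_grad_test_function[OF \<phi> H1D(2)[OF v1]]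
    by simp
  then have "(\<lambda>n. H1_norm \<Omega> (\<lambda>x. \<phi> n x - v x)) \<longlonglongrightarrow> 0"
    by (intro tendsto_zero_if_square_le[OF _ tendsto_add_zero[OF lim]]) simp
  then show "v \<in> H10 \<Omega>"
    using v1 \<phi> by (auto simp: H10_def)
qed

lemma test_function_H10:
  assumes "\<phi> \<in> test_functions \<Omega>"
  shows "\<phi> \<in> H10 \<Omega>"
  using assms by (intro H10I(1)[where \<phi> = "\<lambda>n. \<phi>" and g = "grad \<phi>"] test_function_L2) auto

lemma H10D:
  assumes "v \<in> H10 \<Omega>"
  shows "v \<in> H1 \<Omega>" "v \<in> L2 \<Omega>" "weak_grad \<Omega> v \<in> L2 \<Omega>"
  using assms H1D by (auto simp: H10_def)

lemma grad_lincomb: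
  assumes "\<phi> \<in> test_functions \<Omega>" "\<psi> \<in> test_functions \<Omega>"
  shows "grad (\<lambda>x. c * \<phi> x + d * \<psi> x) x = c *\<^sub>R grad \<phi> x + d *\<^sub>R grad \<psi> x"
proof (rule GDERIV_imp_grad)
  have "GDERIV \<phi> x :> grad \<phi> x" "GDERIV \<psi> x :> grad \<psi> x"
    using assms by (auto elim: test_functionsE)
  from GDERIV_add[OF GDERIV_mult[OF GDERIV_const this(1), of c] GDERIV_mult[OF GDERIV_const this(2), of d]]
  show "GDERIV (\<lambda>x. c * \<phi> x + d * \<psi> x) x :> c *\<^sub>R grad \<phi> x + d *\<^sub>R grad \<psi> x" by simp
qed

lemma H10_lincomb:
  assumes v: "v \<in> H10 \<Omega>" and w: "w \<in> H10 \<Omega>"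
  shows "(\<lambda>x. c * v x + d * w x) \<in> H10 \<Omega>"
proof -
  obtain \<phi> where \<phi>: "\<And>n. \<phi> n \<in> test_functions \<Omega>"
      "(\<lambda>n. \<integral>x. (norm (\<phi> n x - v x))\<^sup>2 \<partial>lebesgue_on \<Omega>) \<longlonglongrightarrow> 0"
      "(\<lambda>n. \<integral>x. (norm (grad (\<phi> n) x - weak_grad \<Omega> v x))\<^sup>2 \<partial>lebesgue_on \<Omega>) \<longlonglongrightarrow> 0"
    using H10_approx[OF v] by blast
  obtain \<psi> where \<psi>: "\<And>n. \<psi> n \<in> test_functions \<Omega>"
      "(\<lambda>n. \<integral>x. (norm (\<psi> n x - w x))\<^sup>2 \<partial>lebesgue_on \<Omega>) \<longlonglongrightarrow> 0"
      "(\<lambda>n. \<integral>x. (norm (grad (\<psi> n) x - weak_grad \<Omega> w x))\<^sup>2 \<partial>lebesgue_on \<Omega>) \<longlonglongrightarrow> 0"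
    using H10_approx[OF w] by blast
  note L = test_function_L2[OF \<phi>(1)] test_function_L2[OF \<psi>(1)] H10D[OF v] H10D[OF w]
  show ?thesis
  proof (rule H10I(1))
    show "(\<lambda>x. c * \<phi> n x + d * \<psi> n x) \<in> test_functions \<Omega>" for n
      by (intro test_functions_add test_functions_cmult \<phi> \<psi>)
    show "(\<lambda>x. c * v x + d * w x) \<in> L2 \<Omega>"
      by (intro L2_add L2_cmult L)
    show "(\<lambda>x. c *\<^sub>R weak_grad \<Omega> v x + d *\<^sub>R weak_grad \<Omega> w x) \<in> L2 \<Omega>"
      by (intro L2_add L2_scaleR L)
    have "(\<lambda>n. \<integral>x. (norm (c *\<^sub>R (\<phi> n x - v x) + d *\<^sub>R (\<psi> n x - w x)))\<^sup>2 \<partial>lebesgue_on \<Omega>) \<longlonglongrightarrow> 0"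
      by (intro tendsto_L2_lincomb_zero L2_diff L \<phi> \<psi>)
    then show "(\<lambda>n. \<integral>x. (norm (c * \<phi> n x + d * \<psi> n x - (c * v x + d * w x)))\<^sup>2 \<partial>lebesgue_on \<Omega>) \<longlonglongrightarrow> 0"
      by (simp add: algebra_simps)
    have "(\<lambda>n. \<integral>x. (norm (c *\<^sub>R (grad (\<phi> n) x - weak_grad \<Omega> v x) + d *\<^sub>R (grad (\<psi> n) x - weak_grad \<Omega> w x)))\<^sup>2
        \<partial>lebesgue_on \<Omega>) \<longlonglongrightarrow> 0"
      by (intro tendsto_L2_lincomb_zero L2_diff L \<phi> \<psi>)
    then show "(\<lambda>n. \<integral>x. (norm (grad (\<lambda>x. c * \<phi> n x + d * \<psi> n x) x
        - (c *\<^sub>R weak_grad \<Omega> v x + d *\<^sub>R weak_grad \<Omega> w x)))\<^sup>2 \<partial>lebesgue_on \<Omega>) \<longlonglongrightarrow> 0"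
      by (simp add: grad_lincomb[OF \<phi>(1) \<psi>(1)] algebra_simps)
  qed
qed

lemma H10_diff: "v \<in> H10 \<Omega> \<Longrightarrow> w \<in> H10 \<Omega> \<Longrightarrow> (\<lambda>x. v x - w x) \<in> H10 \<Omega>"
  using H10_lincomb[of v w 1 "-1"] by simp

lemma has_weak_gradient_cong_AE:
  assumes eq: "AE x in lebesgue_on \<Omega>. v x = w x" and v: "has_weak_gradient \<Omega> v g"
  shows "has_weak_gradient \<Omega> w g"
  unfolding has_weak_gradient_def
proof (intro conjI ballI)
  have lv: "locally_integrable \<Omega> v" using v by (simp add: has_weak_gradient_def)
  then show lw: "locally_integrable \<Omega> w"
    using locally_integrable_cong_AE[OF open_set eq] by blast
  show "locally_integrable \<Omega> g" using v by (simp add: has_weak_gradient_def)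
  fix \<phi> and b :: 'a assume \<phi>: "\<phi> \<in> test_functions \<Omega>" and b: "b \<in> Basis"
  have "(\<integral>x. w x * (grad \<phi> x \<bullet> b) \<partial>lebesgue_on \<Omega>) = (\<integral>x. v x * (grad \<phi> x \<bullet> b) \<partial>lebesgue_on \<Omega>)"
  proof (rule integral_cong_AE)
    show "AE x in lebesgue_on \<Omega>. w x * (grad \<phi> x \<bullet> b) = v x * (grad \<phi> x \<bullet> b)"
      using eq by eventually_elim simp
  qed (intro borel_measurable_integrable test_function_mult_integrable(2)[OF open_set _ \<phi>] lv lw)+
  then show "(\<integral>x. w x * (grad \<phi> x \<bullet> b) \<partial>lebesgue_on \<Omega>) = - (\<integral>x. (g x \<bullet> b) * \<phi> x \<partial>lebesgue_on \<Omega>)"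
    using v \<phi> b by (simp add: has_weak_gradient_def)
qed

text \<open>Genuine equality of functions: a.e. equal arguments have the same weak gradients, so
  \<open>SOME\<close> makes the same choice.\<close>

lemma weak_grad_cong_AE:
  assumes "AE x in lebesgue_on \<Omega>. v x = w x"
  shows "weak_grad \<Omega> v = weak_grad \<Omega> w"
proof -
  have "AE x in lebesgue_on \<Omega>. w x = v x"
    using assms by eventually_elim simp
  then have "has_weak_gradient \<Omega> v = has_weak_gradient \<Omega> w"
    using has_weak_gradient_cong_AE assms by blast
  then show ?thesis by (simp add: weak_grad_def)
qed

text \<open>Makes \<open>ybar\<close> usable as an element of \<open>H10\<close>, being given only
  as an a.e. copy of the state.\<close>

lemma H10_cong_AE:
  assumes eq: "AE x in lebesgue_on \<Omega>. v x = w x" and v: "v \<in> H10 \<Omega>"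
  shows "w \<in> H10 \<Omega>"
proof -
  obtain \<phi> where \<phi>: "\<And>n. \<phi> n \<in> test_functions \<Omega>"
      "(\<lambda>n. \<integral>x. (norm (\<phi> n x - v x))\<^sup>2 \<partial>lebesgue_on \<Omega>) \<longlonglongrightarrow> 0"
      "(\<lambda>n. \<integral>x. (norm (grad (\<phi> n) x - weak_grad \<Omega> v x))\<^sup>2 \<partial>lebesgue_on \<Omega>) \<longlonglongrightarrow> 0"
    using H10_approx[OF v] by blast
  have w: "w \<in> L2 \<Omega>"
    using L2_cong_AE[OF sets_set eq] H10D(2)[OF v] .
  have "(\<integral>x. (norm (\<phi> n x - v x))\<^sup>2 \<partial>lebesgue_on \<Omega>) = (\<integral>x. (norm (\<phi> n x - w x))\<^sup>2 \<partial>lebesgue_on \<Omega>)" for n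
  proof (rule integral_cong_AE)
    show "AE x in lebesgue_on \<Omega>. (norm (\<phi> n x - v x))\<^sup>2 = (norm (\<phi> n x - w x))\<^sup>2"
      using eq by eventually_elim simp
  qed (use L2_imp_measurable[OF w] L2_imp_measurable[OF test_function_L2(1)[OF \<phi>(1), of n]]
      L2_imp_measurable[OF H10D(2)[OF v]] in measurable)
  with \<phi>(2) show ?thesis
    by (intro H10I(1)[OF \<phi>(1) w H10D(3)[OF v] _ \<phi>(3)]) simp
qed

section \<open>The Dirichlet form and Poincare's inequality\<close>

lemma bilin_a_commute: "bilin_a \<Omega> v w = bilin_a \<Omega> w v"
  by (simp add: bilin_a_def inner_commute)

lemma bilin_a_lincomb_right:
  assumes "v \<in> H10 \<Omega>" "w \<in> H10 \<Omega>" "z \<in> H10 \<Omega>"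
  shows "bilin_a \<Omega> z (\<lambda>x. c * v x + d * w x) = c * bilin_a \<Omega> z v + d * bilin_a \<Omega> z w"
proof -
  note L = H10D(3)[OF assms(1)] H10D(3)[OF assms(2)] H10D(3)[OF assms(3)]
  have L': "weak_grad \<Omega> (\<lambda>x. c * v x + d * w x) \<in> L2 \<Omega>"
    using H10D(3)[OF H10_lincomb[OF assms(1,2)]] .
  note i = L2_inner_integrable[OF L(3) L(1)] L2_inner_integrable[OF L(3) L(2)]
  have "bilin_a \<Omega> z (\<lambda>x. c * v x + d * w x) =
      (\<integral>x. c * (weak_grad \<Omega> z x \<bullet> weak_grad \<Omega> v x) + d * (weak_grad \<Omega> z x \<bullet> weak_grad \<Omega> w x) \<partial>lebesgue_on \<Omega>)"
    unfolding bilin_a_def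
  proof (rule integral_cong_AE)
    show "AE x in lebesgue_on \<Omega>. weak_grad \<Omega> z x \<bullet> weak_grad \<Omega> (\<lambda>x. c * v x + d * w x) x =
        c * (weak_grad \<Omega> z x \<bullet> weak_grad \<Omega> v x) + d * (weak_grad \<Omega> z x \<bullet> weak_grad \<Omega> w x)"
      using weak_grad_lincomb_AE[OF H10D(1)[OF assms(1)] H10D(1)[OF assms(2)], of c d]
    proof eventually_elim
      case (elim x)
      show ?case unfolding elim[symmetric] by (simp add: inner_add_right)
    qed
    show "(\<lambda>x. weak_grad \<Omega> z x \<bullet> weak_grad \<Omega> (\<lambda>x. c * v x + d * w x) x) \<in> borel_measurable (lebesgue_on \<Omega>)"
      using L2_inner_integrable[OF L(3) L'] by (rule borel_measurable_integrable)
  qed (use i in \<open>auto intro!: borel_measurable_add borel_measurable_times\<close>)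
  also have "\<dots> = c * bilin_a \<Omega> z v + d * bilin_a \<Omega> z w"
    using i by (simp add: bilin_a_def)
  finally show ?thesis .
qed

lemma bilin_a_diff_right:
  "v \<in> H10 \<Omega> \<Longrightarrow> w \<in> H10 \<Omega> \<Longrightarrow> z \<in> H10 \<Omega> \<Longrightarrow>
    bilin_a \<Omega> z (\<lambda>x. v x - w x) = bilin_a \<Omega> z v - bilin_a \<Omega> z w"
  using bilin_a_lincomb_right[of v w z 1 "-1"] by simp

lemma bilin_a_diff_left:
  "v \<in> H10 \<Omega> \<Longrightarrow> w \<in> H10 \<Omega> \<Longrightarrow> z \<in> H10 \<Omega> \<Longrightarrow>
    bilin_a \<Omega> (\<lambda>x. v x - w x) z = bilin_a \<Omega> v z - bilin_a \<Omega> w z"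
  using bilin_a_diff_right[of v w z] by (simp add: bilin_a_commute)

lemma bilin_a_cong_AE:
  assumes "AE x in lebesgue_on \<Omega>. v x = w x"
  shows "bilin_a \<Omega> v z = bilin_a \<Omega> w z" "bilin_a \<Omega> z v = bilin_a \<Omega> z w"
  using weak_grad_cong_AE[OF assms] by (simp_all add: bilin_a_def)

lemma bilin_a_test_function:
  assumes "\<phi> \<in> test_functions \<Omega>"
  shows "bilin_a \<Omega> \<phi> \<phi> = (\<integral>x. (norm (grad \<phi> x))\<^sup>2 \<partial>lebesgue_on \<Omega>)"
  unfolding bilin_a_def
proof (rule integral_cong_AE)
  show "AE x in lebesgue_on \<Omega>. weak_grad \<Omega> \<phi> x \<bullet> weak_grad \<Omega> \<phi> x = (norm (grad \<phi> x))\<^sup>2"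
    using weak_grad_test_function_AE[OF assms] by eventually_elim (simp add: power2_norm_eq_inner)
qed (use L2_imp_measurable[OF test_function_L2(2)[OF assms]]
      L2_imp_measurable[OF H1D(2)[OF test_function_H1[OF assms]]] in measurable)

lemma tendsto_integral_square:
  fixes f :: "'a \<Rightarrow> 'b::euclidean_space"
  assumes "\<And>n. F n \<in> L2 \<Omega>" "f \<in> L2 \<Omega>"
    and "(\<lambda>n. \<integral>x. (norm (F n x - f x))\<^sup>2 \<partial>lebesgue_on \<Omega>) \<longlonglongrightarrow> 0"
  shows "(\<lambda>n. \<integral>x. (norm (F n x))\<^sup>2 \<partial>lebesgue_on \<Omega>) \<longlonglongrightarrow> (\<integral>x. (norm (f x))\<^sup>2 \<partial>lebesgue_on \<Omega>)"
  using tendsto_L2_inner[OF assms(1,2) assms(1,2) assms(3) assms(3)] by (simp add: power2_norm_eq_inner)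

text \<open>The inequality for test functions survives the limit because its constant depends only
  on the radius of a ball containing the domain.\<close>

lemma Poincare:
  obtains P where "P > 0" "\<And>v. v \<in> H10 \<Omega> \<Longrightarrow> (\<integral>x. (v x)\<^sup>2 \<partial>lebesgue_on \<Omega>) \<le> P * bilin_a \<Omega> v v"
proof -
  obtain R where R: "R > 0" "\<And>x. x \<in> \<Omega> \<Longrightarrow> norm x \<le> R"
    using bounded_set bounded_pos by blast
  show thesis
  proof (rule that)
    show "4 * R\<^sup>2 > 0" using R(1) by simp
    fix v assume v: "v \<in> H10 \<Omega>"
    obtain \<phi> where \<phi>: "\<And>n. \<phi> n \<in> test_functions \<Omega>"
      "(\<lambda>n. \<integral>x. (norm (\<phi> n x - v x))\<^sup>2 \<partial>lebesgue_on \<Omega>) \<longlonglongrightarrow> 0"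
      "(\<lambda>n. \<integral>x. (norm (grad (\<phi> n) x - weak_grad \<Omega> v x))\<^sup>2 \<partial>lebesgue_on \<Omega>) \<longlonglongrightarrow> 0"
      using H10_approx[OF v] by blast
    note L = test_function_L2[OF \<phi>(1)] H10D[OF v]
    have 1: "(\<lambda>n. \<integral>x. (norm (\<phi> n x))\<^sup>2 \<partial>lebesgue_on \<Omega>) \<longlonglongrightarrow> (\<integral>x. (norm (v x))\<^sup>2 \<partial>lebesgue_on \<Omega>)"
      by (intro tendsto_integral_square L \<phi>)
    have 2: "(\<lambda>n. \<integral>x. (norm (grad (\<phi> n) x))\<^sup>2 \<partial>lebesgue_on \<Omega>) \<longlonglongrightarrow> (\<integral>x. (norm (weak_grad \<Omega> v x))\<^sup>2 \<partial>lebesgue_on \<Omega>)"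
      by (intro tendsto_integral_square L \<phi>)
    have "(\<integral>x. (norm (v x))\<^sup>2 \<partial>lebesgue_on \<Omega>) \<le> 4 * R\<^sup>2 * (\<integral>x. (norm (weak_grad \<Omega> v x))\<^sup>2 \<partial>lebesgue_on \<Omega>)"
      by (rule LIMSEQ_le[OF 1 tendsto_mult_left[OF 2]])
         (use Poincare_test_function[OF open_set \<phi>(1) R(2)] R(1) in auto)
    then show "(\<integral>x. (v x)\<^sup>2 \<partial>lebesgue_on \<Omega>) \<le> 4 * R\<^sup>2 * bilin_a \<Omega> v v"
      by (simp add: bilin_a_def power2_norm_eq_inner)
  qed
qed

end

section \<open>Existence of the state and of the slack variable\<close>

text \<open>\<open>midpoint\<close> is an abstract parallelogram law: \<open>z\<close> stands for
  the midpoint and \<open>N\<close> for a multiple of the squared distance. As \<open>J z\<close>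
  cannot fall below the infimum, \<open>N\<close> is controlled by how far \<open>J v\<close> and
  \<open>J w\<close> exceed it. The lemma serves both the state and the slack variable.\<close>

lemma minimizing_sequence:
  fixes J :: "'v \<Rightarrow> real" and N :: "'v \<Rightarrow> 'v \<Rightarrow> real"
  assumes "T \<noteq> {}" and lower: "\<And>v. v \<in> T \<Longrightarrow> B \<le> J v"
    and midpoint: "\<And>v w. v \<in> T \<Longrightarrow> w \<in> T \<Longrightarrow> \<exists>z\<in>T. 4 * J z + N v w \<le> 2 * J v + 2 * J w"
  shows "\<exists>\<phi> m. (\<forall>n::nat. \<phi> n \<in> T) \<and> (\<lambda>n. J (\<phi> n)) \<longlonglongrightarrow> m \<and> (\<forall>w\<in>T. m \<le> J w) \<and>
    (\<forall>e>0. \<exists>n0. \<forall>i\<ge>n0. \<forall>j\<ge>n0. N (\<phi> i) (\<phi> j) < e)"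
proof -
  define m where "m = Inf (J ` T)"
  have bdd: "bdd_below (J ` T)"
    using lower by (auto intro!: bdd_belowI)
  have m: "m \<le> J w" if "w \<in> T" for w
    unfolding m_def using bdd that by (intro cInf_lower) auto
  have "\<exists>v\<in>T. J v < m + inverse (real (Suc n))" for n
  proof -
    have "Inf (J ` T) < m + inverse (real (Suc n))" by (simp add: m_def)
    then show ?thesis
      using cInf_less_iff[OF _ bdd] \<open>T \<noteq> {}\<close> by auto
  qed
  then obtain \<phi> where \<phi>: "\<And>n. \<phi> n \<in> T" "\<And>n. J (\<phi> n) < m + inverse (real (Suc n))"
    by metis
  have lim: "(\<lambda>n. J (\<phi> n)) \<longlonglongrightarrow> m"
  proof (rule tendsto_sandwich[OF _ _ tendsto_const])
    show "(\<lambda>n. m + inverse (real (Suc n))) \<longlonglongrightarrow> m"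
      using tendsto_add[OF tendsto_const LIMSEQ_inverse_real_of_nat, of m] by simp
  qed (use m \<phi> in \<open>auto intro!: always_eventually less_imp_le\<close>)
  have "\<exists>n0. \<forall>i\<ge>n0. \<forall>j\<ge>n0. N (\<phi> i) (\<phi> j) < e" if "e > 0" for e
  proof -
    have "\<forall>\<^sub>F n in sequentially. J (\<phi> n) < m + e / 4"
      using lim \<open>e > 0\<close> by (intro order_tendstoD(2)) auto
    \<comment> \<open>The excess \<open>e / 4\<close> enters four times, twice for each of the two
      indices, and so adds up to \<open>e\<close>.\<close>
    then obtain n0 where n0: "\<And>n. n \<ge> n0 \<Longrightarrow> J (\<phi> n) < m + e / 4"
      by (auto simp: eventually_sequentially)
    have "N (\<phi> i) (\<phi> j) < e" if "i \<ge> n0" "j \<ge> n0" for i j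
    proof -
      obtain z where "z \<in> T" "4 * J z + N (\<phi> i) (\<phi> j) \<le> 2 * J (\<phi> i) + 2 * J (\<phi> j)"
        using midpoint \<phi>(1) by blast
      then show ?thesis using m[of z] n0[OF that(1)] n0[OF that(2)] by linarith
    qed
    then show ?thesis by blast
  qed
  then show ?thesis using \<phi>(1) lim m by blast
qed

text \<open>Divide by \<open>t\<close> and let it tend to 0 from the right. This turns minimality
  along a segment into a first-order condition.\<close>

lemma nonneg_slope_if_quadratic_nonneg:
  fixes A B :: real
  assumes "\<And>t. 0 < t \<Longrightarrow> t \<le> 1 \<Longrightarrow> 0 \<le> t * A + t\<^sup>2 * B"
  shows "0 \<le> A"
proof (rule tendsto_lowerbound)
  show "((\<lambda>t. A + t * B) \<longlongrightarrow> A) (at_right 0)"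
    by (auto intro!: tendsto_eq_intros)
  have "\<forall>\<^sub>F t in at_right (0::real). 0 < t \<and> t < 1"
    by (rule eventually_at_rightI[of 0 1]) auto
  then show "\<forall>\<^sub>F t in at_right 0. 0 \<le> A + t * B"
  proof eventually_elim
    case (elim t)
    then have "0 \<le> t * (A + t * B)"
      using assms[of t] by (simp add: algebra_simps power2_eq_square)
    with elim show ?case by (simp add: zero_le_mult_iff)
  qed
qed simp

context bounded_open_set
begin

section \<open>Expansions and limits of the terms of the energy\<close>

lemma L1_norm_nonneg: "0 \<le> L1_norm \<Omega> v"
  by (simp add: L1_norm_def)

lemma L2_abs_integrable:
  fixes v :: "'a \<Rightarrow> real"
  assumes "v \<in> L2 \<Omega>"
  shows "integrable (lebesgue_on \<Omega>) (\<lambda>x. \<bar>v x\<bar>)"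
  using L2_imp_integrable[OF lmeasurable_set assms] by simp

lemma L1_norm_lincomb_le:
  assumes "v \<in> L2 \<Omega>" "w \<in> L2 \<Omega>"
  shows "L1_norm \<Omega> (\<lambda>x. c * v x + d * w x) \<le> \<bar>c\<bar> * L1_norm \<Omega> v + \<bar>d\<bar> * L1_norm \<Omega> w"
proof -
  have "L1_norm \<Omega> (\<lambda>x. c * v x + d * w x) \<le> (\<integral>x. \<bar>c\<bar> * \<bar>v x\<bar> + \<bar>d\<bar> * \<bar>w x\<bar> \<partial>lebesgue_on \<Omega>)"
    unfolding L1_norm_def
  proof (rule integral_mono)
    show "integrable (lebesgue_on \<Omega>) (\<lambda>x. \<bar>c * v x + d * w x\<bar>)"
      using assms by (intro L2_abs_integrable L2_add L2_cmult)
    show "\<bar>c * v x + d * w x\<bar> \<le> \<bar>c\<bar> * \<bar>v x\<bar> + \<bar>d\<bar> * \<bar>w x\<bar>" for x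
      using abs_triangle_ineq[of "c * v x" "d * w x"] by (simp add: abs_mult)
  qed (use assms L2_abs_integrable in auto)
  also have "\<dots> = \<bar>c\<bar> * L1_norm \<Omega> v + \<bar>d\<bar> * L1_norm \<Omega> w"
    using assms L2_abs_integrable by (simp add: L1_norm_def)
  finally show ?thesis .
qed

lemma L1_norm_squared_le:
  assumes "v \<in> L2 \<Omega>"
  shows "(L1_norm \<Omega> v)\<^sup>2 \<le> (\<integral>x. (v x)\<^sup>2 \<partial>lebesgue_on \<Omega>) * measure lebesgue \<Omega>"
  using L1_le_L2[OF lmeasurable_set assms] by (simp add: L1_norm_def)

lemma L2_inner_lincomb_right:
  assumes "u \<in> L2 \<Omega>" "v \<in> L2 \<Omega>" "w \<in> L2 \<Omega>"
  shows "L2_inner \<Omega> u (\<lambda>x. c * v x + d * w x) = c * L2_inner \<Omega> u v + d * L2_inner \<Omega> u w"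
proof -
  have "(\<integral>x. u x * (c * v x + d * w x) \<partial>lebesgue_on \<Omega>) = (\<integral>x. c * (u x * v x) + d * (u x * w x) \<partial>lebesgue_on \<Omega>)"
    by (simp add: algebra_simps)
  then show ?thesis
    using L2_mult_integrable[OF assms(1,2)] L2_mult_integrable[OF assms(1,3)] by (simp add: L2_inner_def)
qed

lemma L2_inner_commute: "L2_inner \<Omega> u v = L2_inner \<Omega> v u"
  by (simp add: L2_inner_def mult.commute)

lemma L2_inner_diff_left:
  "u \<in> L2 \<Omega> \<Longrightarrow> v \<in> L2 \<Omega> \<Longrightarrow> w \<in> L2 \<Omega> \<Longrightarrow>
    L2_inner \<Omega> (\<lambda>x. v x - w x) u = L2_inner \<Omega> v u - L2_inner \<Omega> w u"
  using L2_inner_lincomb_right[of u v w 1 "-1"] by (simp add: L2_inner_commute)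

lemma integral_square_lincomb:
  assumes "v \<in> L2 \<Omega>" "w \<in> L2 \<Omega>"
  shows "(\<integral>x. (c * v x + d * w x)\<^sup>2 \<partial>lebesgue_on \<Omega>) = c\<^sup>2 * (\<integral>x. (v x)\<^sup>2 \<partial>lebesgue_on \<Omega>)
    + 2 * c * d * L2_inner \<Omega> v w + d\<^sup>2 * (\<integral>x. (w x)\<^sup>2 \<partial>lebesgue_on \<Omega>)"
  using integral_norm_lincomb_squared[OF assms, of c d] by (simp add: L2_inner_def)

lemma bilin_a_square_lincomb:
  assumes v: "v \<in> H10 \<Omega>" and w: "w \<in> H10 \<Omega>"
  shows "bilin_a \<Omega> (\<lambda>x. c * v x + d * w x) (\<lambda>x. c * v x + d * w x)
    = c\<^sup>2 * bilin_a \<Omega> v v + 2 * c * d * bilin_a \<Omega> v w + d\<^sup>2 * bilin_a \<Omega> w w"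
proof -
  define z where "z = (\<lambda>x. c * v x + d * w x)"
  have z: "z \<in> H10 \<Omega>"
    unfolding z_def by (rule H10_lincomb[OF v w])
  have "bilin_a \<Omega> z z = c * bilin_a \<Omega> z v + d * bilin_a \<Omega> z w"
    using bilin_a_lincomb_right[OF v w z, of c d] by (simp add: z_def)
  moreover have "bilin_a \<Omega> z v = c * bilin_a \<Omega> v v + d * bilin_a \<Omega> v w"
    using bilin_a_lincomb_right[OF v w v, of c d] bilin_a_commute[of z v] by (simp add: z_def)
  moreover have "bilin_a \<Omega> z w = c * bilin_a \<Omega> v w + d * bilin_a \<Omega> w w"
    using bilin_a_lincomb_right[OF v w w, of c d] bilin_a_commute[of z w] bilin_a_commute[of w v] by (simp add: z_def)
  ultimately show ?thesis
    by (simp add: z_def[symmetric] power2_eq_square algebra_simps)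
qed

lemma tendsto_L2_inner_const:
  assumes "u \<in> L2 \<Omega>" "\<And>n. F n \<in> L2 \<Omega>" "f \<in> L2 \<Omega>"
    and "(\<lambda>n. \<integral>x. (norm (F n x - f x))\<^sup>2 \<partial>lebesgue_on \<Omega>) \<longlonglongrightarrow> 0"
  shows "(\<lambda>n. L2_inner \<Omega> u (F n)) \<longlonglongrightarrow> L2_inner \<Omega> u f"
  using tendsto_L2_inner[of "\<lambda>n. u" \<Omega> u F f] assms by (simp add: L2_inner_def)

lemma tendsto_L1_norm_diff:
  assumes F: "\<And>n. F n \<in> L2 \<Omega>" "f \<in> L2 \<Omega>"
    and lim: "(\<lambda>n. \<integral>x. (norm (F n x - f x))\<^sup>2 \<partial>lebesgue_on \<Omega>) \<longlonglongrightarrow> 0"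
  shows "(\<lambda>n. L1_norm \<Omega> (\<lambda>x. F n x - f x)) \<longlonglongrightarrow> 0"
  by (rule tendsto_zero_if_square_le[OF _ tendsto_mult_left_zero[OF lim]])
     (use L1_norm_squared_le[OF L2_diff[OF F]] in simp)

section \<open>Minimisation of the energy\<close>

definition energy :: "('a \<Rightarrow> real) \<Rightarrow> ('a \<Rightarrow> real) \<Rightarrow> real" where
  "energy u v = bilin_a \<Omega> v v / 2 + L1_norm \<Omega> v - L2_inner \<Omega> u v"

lemma tendsto_energy:
  assumes u: "u \<in> L2 \<Omega>" and v: "v \<in> H10 \<Omega>" and \<phi>: "\<And>n. \<phi> n \<in> test_functions \<Omega>"
    and lim: "(\<lambda>n. \<integral>x. (norm (\<phi> n x - v x))\<^sup>2 \<partial>lebesgue_on \<Omega>) \<longlonglongrightarrow> 0"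
      "(\<lambda>n. \<integral>x. (norm (grad (\<phi> n) x - weak_grad \<Omega> v x))\<^sup>2 \<partial>lebesgue_on \<Omega>) \<longlonglongrightarrow> 0"
  shows "(\<lambda>n. energy u (\<phi> n)) \<longlonglongrightarrow> energy u v"
proof -
  note L = test_function_L2[OF \<phi>] H10D[OF v]
  have 1: "(\<lambda>n. bilin_a \<Omega> (\<phi> n) (\<phi> n)) \<longlonglongrightarrow> bilin_a \<Omega> v v"
    using tendsto_integral_square[OF L(2) L(5) lim(2)]
    by (simp add: bilin_a_test_function[OF \<phi>]) (simp add: bilin_a_def power2_norm_eq_inner)
  \<comment> \<open>The reverse triangle inequality, obtained by writing \<open>\<phi> n\<close> and
    \<open>v\<close> each as a combination of the other one and the difference.\<close>
  have "\<bar>L1_norm \<Omega> (\<phi> n) - L1_norm \<Omega> v\<bar> \<le> L1_norm \<Omega> (\<lambda>x. \<phi> n x - v x)" for n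
    using L1_norm_lincomb_le[OF L2_diff[OF L(1) L(4)] L(4), of 1 n 1]
      L1_norm_lincomb_le[OF L2_diff[OF L(1) L(4)] L(1), of "-1" n 1 n]
    by simp
  then have "(\<lambda>n. L1_norm \<Omega> (\<phi> n) - L1_norm \<Omega> v) \<longlonglongrightarrow> 0"
    by (intro Lim_null_comparison[OF _ tendsto_L1_norm_diff[OF L(1) L(4) lim(1)]]) simp
  then have 2: "(\<lambda>n. L1_norm \<Omega> (\<phi> n)) \<longlonglongrightarrow> L1_norm \<Omega> v"
    by (simp add: LIM_zero_iff)
  show ?thesis
    unfolding energy_def
    by (intro tendsto_intros 1 2 tendsto_L2_inner_const u L lim) simp
qed

text \<open>Expanding the square of \<open>P * u - v\<close> and applying Poincare's inequality
  bounds the linear term by half the Dirichlet form plus a multiple of the squared norm of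
  \<open>u\<close>. The weight \<open>P\<close> is chosen so that the quadratic part of the energy
  absorbs the former exactly.\<close>

lemma energy_bounded_below:
  assumes "u \<in> L2 \<Omega>"
  obtains B where "\<And>v. v \<in> H10 \<Omega> \<Longrightarrow> B \<le> energy u v"
proof -
  obtain P where P: "P > 0" "\<And>v. v \<in> H10 \<Omega> \<Longrightarrow> (\<integral>x. (v x)\<^sup>2 \<partial>lebesgue_on \<Omega>) \<le> P * bilin_a \<Omega> v v"
    using Poincare by blast
  show thesis
  proof (rule that)
    fix v assume v: "v \<in> H10 \<Omega>"
    have "0 \<le> (\<integral>x. (P * u x + (-1) * v x)\<^sup>2 \<partial>lebesgue_on \<Omega>)"
      by simp
    also have "\<dots> = P\<^sup>2 * (\<integral>x. (u x)\<^sup>2 \<partial>lebesgue_on \<Omega>) - 2 * P * L2_inner \<Omega> u v + (\<integral>x. (v x)\<^sup>2 \<partial>lebesgue_on \<Omega>)"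
      by (subst integral_square_lincomb[OF assms H10D(2)[OF v]]) simp
    also have "\<dots> \<le> P\<^sup>2 * (\<integral>x. (u x)\<^sup>2 \<partial>lebesgue_on \<Omega>) - 2 * P * L2_inner \<Omega> u v + P * bilin_a \<Omega> v v"
      using P(2)[OF v] by simp
    also have "\<dots> = P * (P * (\<integral>x. (u x)\<^sup>2 \<partial>lebesgue_on \<Omega>) - 2 * L2_inner \<Omega> u v + bilin_a \<Omega> v v)"
      by (simp add: algebra_simps power2_eq_square)
    finally have "0 \<le> P * (\<integral>x. (u x)\<^sup>2 \<partial>lebesgue_on \<Omega>) - 2 * L2_inner \<Omega> u v + bilin_a \<Omega> v v"
      using P(1) by (simp add: zero_le_mult_iff)
    then show "- (P * (\<integral>x. (u x)\<^sup>2 \<partial>lebesgue_on \<Omega>)) / 2 \<le> energy u v"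
      using L1_norm_nonneg[of v] by (simp add: energy_def)
  qed
qed

text \<open>Parallelogram law for the quadratic part, convexity for the \<open>L1\<close> norm,
  equality for the linear part. The surplus on the left is the quantity \<open>N\<close> of
  \<open>minimizing_sequence\<close>.\<close>

lemma energy_midpoint:
  assumes u: "u \<in> L2 \<Omega>" and v: "v \<in> H10 \<Omega>" and w: "w \<in> H10 \<Omega>"
  shows "4 * energy u (\<lambda>x. 1 / 2 * v x + 1 / 2 * w x) + bilin_a \<Omega> (\<lambda>x. v x - w x) (\<lambda>x. v x - w x) / 2
    \<le> 2 * energy u v + 2 * energy u w"
  using L1_norm_lincomb_le[OF H10D(2)[OF v] H10D(2)[OF w], of "1/2" "1/2"]
    L2_inner_lincomb_right[OF u H10D(2)[OF v] H10D(2)[OF w], of "1/2" "1/2"]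
    bilin_a_square_lincomb[OF v w, of "1/2" "1/2"] bilin_a_square_lincomb[OF v w, of 1 "-1"]
  by (simp add: energy_def power2_eq_square add_divide_distrib diff_divide_distrib)

text \<open>The infimum is taken over test functions. Continuity of the energy along approximating
  sequences is used twice: to evaluate it at the limit, and to extend minimality to
  \<open>H10\<close>.\<close>

lemma energy_minimizer:
  assumes u: "u \<in> L2 \<Omega>"
  obtains y where "y \<in> H10 \<Omega>" "\<And>v. v \<in> H10 \<Omega> \<Longrightarrow> energy u y \<le> energy u v"
proof -
  obtain B where B: "\<And>v. v \<in> H10 \<Omega> \<Longrightarrow> B \<le> energy u v"
    using energy_bounded_below[OF u] by blast
  obtain P where P: "P > 0" "\<And>v. v \<in> H10 \<Omega> \<Longrightarrow> (\<integral>x. (v x)\<^sup>2 \<partial>lebesgue_on \<Omega>) \<le> P * bilin_a \<Omega> v v"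
    using Poincare by blast
  let ?N = "\<lambda>v w. bilin_a \<Omega> (\<lambda>x. v x - w x) (\<lambda>x. v x - w x) / 2"
  have mid: "\<exists>z\<in>test_functions \<Omega>. 4 * energy u z + ?N v w \<le> 2 * energy u v + 2 * energy u w"
    if "v \<in> test_functions \<Omega>" "w \<in> test_functions \<Omega>" for v w
    using energy_midpoint[OF u test_function_H10[OF that(1)] test_function_H10[OF that(2)]]
      test_functions_add[OF test_functions_cmult[OF that(1)] test_functions_cmult[OF that(2)]] by blast
  have nonempty: "test_functions \<Omega> \<noteq> {}"
    using test_functions_zero by blast
  obtain \<phi> m where \<phi>: "\<And>n::nat. \<phi> n \<in> test_functions \<Omega>" and m: "(\<lambda>n. energy u (\<phi> n)) \<longlonglongrightarrow> m"
      "\<And>w. w \<in> test_functions \<Omega> \<Longrightarrow> m \<le> energy u w"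
    and Cauchy: "\<And>e. e > 0 \<Longrightarrow> \<exists>n0. \<forall>i\<ge>n0. \<forall>j\<ge>n0. ?N (\<phi> i) (\<phi> j) < e"
    using minimizing_sequence[OF nonempty B[OF test_function_H10] mid] by blast
  note L = test_function_L2[OF \<phi>]
  have diff: "(\<lambda>x. \<phi> i x - \<phi> j x) \<in> test_functions \<Omega>" for i j
    using test_functions_add[OF \<phi> test_functions_cmult[OF \<phi>, of "-1"], of i j] by simp
  have bilin: "bilin_a \<Omega> (\<lambda>x. \<phi> i x - \<phi> j x) (\<lambda>x. \<phi> i x - \<phi> j x)
      = (\<integral>x. (norm (grad (\<phi> i) x - grad (\<phi> j) x))\<^sup>2 \<partial>lebesgue_on \<Omega>)" for i j
    using bilin_a_test_function[OF diff, of i j] grad_lincomb[OF \<phi> \<phi>, of 1 i "-1" j] by simp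
  have "\<exists>n0. \<forall>i\<ge>n0. \<forall>j\<ge>n0. (\<integral>x. (norm (grad (\<phi> i) x - grad (\<phi> j) x))\<^sup>2 \<partial>lebesgue_on \<Omega>) < e" if "e > 0" for e
  proof -
    obtain n0 where "\<forall>i\<ge>n0. \<forall>j\<ge>n0. ?N (\<phi> i) (\<phi> j) < e / 2"
      using Cauchy[of "e / 2"] \<open>e > 0\<close> by auto
    then show ?thesis unfolding bilin by (intro exI[of _ n0]) auto
  qed
  then obtain g where g: "g \<in> L2 \<Omega>" "(\<lambda>n. \<integral>x. (norm (grad (\<phi> n) x - g x))\<^sup>2 \<partial>lebesgue_on \<Omega>) \<longlonglongrightarrow> 0"
    using L2_complete[of \<Omega> "\<lambda>n. grad (\<phi> n)", OF lmeasurable_set L(2)] by blast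
  have "\<exists>n0. \<forall>i\<ge>n0. \<forall>j\<ge>n0. (\<integral>x. (norm (\<phi> i x - \<phi> j x))\<^sup>2 \<partial>lebesgue_on \<Omega>) < e" if "e > 0" for e
  proof -
    \<comment> \<open>\<open>?N\<close> is half the Dirichlet form and Poincare costs a factor
      \<open>P\<close>, hence the tolerance.\<close>
    obtain n0 where n0: "\<forall>i\<ge>n0. \<forall>j\<ge>n0. ?N (\<phi> i) (\<phi> j) < e / (2 * P)"
      using Cauchy[of "e / (2 * P)"] \<open>e > 0\<close> P(1) by auto
    have "(\<integral>x. (norm (\<phi> i x - \<phi> j x))\<^sup>2 \<partial>lebesgue_on \<Omega>) < e" if "i \<ge> n0" "j \<ge> n0" for i j
      using n0[rule_format, OF that] P(1) P(2)[OF test_function_H10[OF diff], of i j]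
      by (simp add: field_simps)
    then show ?thesis by blast
  qed
  then obtain y where y: "y \<in> L2 \<Omega>" "(\<lambda>n. \<integral>x. (norm (\<phi> n x - y x))\<^sup>2 \<partial>lebesgue_on \<Omega>) \<longlonglongrightarrow> 0"
    using L2_complete[of \<Omega> \<phi>, OF lmeasurable_set L(1)] by blast
  have yH: "y \<in> H10 \<Omega>" and ae: "AE x in lebesgue_on \<Omega>. g x = weak_grad \<Omega> y x"
    using H10I[OF \<phi> y(1) g(1) y(2) g(2)] by blast+
  have "(\<integral>x. (norm (grad (\<phi> n) x - g x))\<^sup>2 \<partial>lebesgue_on \<Omega>)
      = (\<integral>x. (norm (grad (\<phi> n) x - weak_grad \<Omega> y x))\<^sup>2 \<partial>lebesgue_on \<Omega>)" for n
  proof (rule integral_cong_AE)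
    show "AE x in lebesgue_on \<Omega>. (norm (grad (\<phi> n) x - g x))\<^sup>2 = (norm (grad (\<phi> n) x - weak_grad \<Omega> y x))\<^sup>2"
      using ae by eventually_elim simp
  qed (use L2_imp_measurable[OF g(1)] L2_imp_measurable[OF L(2), of n] L2_imp_measurable[OF H10D(3)[OF yH]] in measurable)
  then have "(\<lambda>n. energy u (\<phi> n)) \<longlonglongrightarrow> energy u y"
    using tendsto_energy[OF u yH \<phi> y(2)] g(2) by simp
  then have my: "energy u y = m"
    using m(1) LIMSEQ_unique by blast
  show thesis
  proof (rule that[OF yH])
    fix v assume v: "v \<in> H10 \<Omega>"
    obtain \<psi> where \<psi>: "\<And>n. \<psi> n \<in> test_functions \<Omega>"
      "(\<lambda>n. \<integral>x. (norm (\<psi> n x - v x))\<^sup>2 \<partial>lebesgue_on \<Omega>) \<longlonglongrightarrow> 0"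
      "(\<lambda>n. \<integral>x. (norm (grad (\<psi> n) x - weak_grad \<Omega> v x))\<^sup>2 \<partial>lebesgue_on \<Omega>) \<longlonglongrightarrow> 0"
      using H10_approx[OF v] by blast
    have "(\<lambda>n. energy u (\<psi> n)) \<longlonglongrightarrow> energy u v"
      by (rule tendsto_energy[OF u v \<psi>])
    then show "energy u y \<le> energy u v"
      unfolding my using m(2) \<psi>(1) by (intro LIMSEQ_le_const) auto
  qed
qed

text \<open>The \<open>L1\<close> norm is not differentiable, so its variation is replaced by the
  convexity bound on the segment from \<open>y\<close> to \<open>v\<close>; what survives is an
  inequality.\<close>

lemma energy_minimizer_solves_VI:
  assumes u: "u \<in> L2 \<Omega>" and y: "y \<in> H10 \<Omega>" and min: "\<And>v. v \<in> H10 \<Omega> \<Longrightarrow> energy u y \<le> energy u v"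
  shows "solves_VI \<Omega> (L2_functional \<Omega> u) y"
  unfolding solves_VI_def
proof (intro conjI ballI y)
  fix v assume v: "v \<in> H10 \<Omega>"
  define h where "h = (\<lambda>x. v x - y x)"
  have h: "h \<in> H10 \<Omega>" unfolding h_def by (rule H10_diff[OF v y])
  have "0 \<le> bilin_a \<Omega> y h + L1_norm \<Omega> v - L1_norm \<Omega> y - L2_inner \<Omega> u h"
  proof (rule nonneg_slope_if_quadratic_nonneg)
    fix t :: real assume t: "0 < t" "t \<le> 1"
    \<comment> \<open>The left form suits the expansion of the quadratic part, the right one the
      convexity of the norm.\<close>
    have z: "(\<lambda>x. 1 * y x + t * h x) = (\<lambda>x. (1 - t) * y x + t * v x)"
      by (simp add: h_def algebra_simps)
    have "L1_norm \<Omega> (\<lambda>x. 1 * y x + t * h x) \<le> (1 - t) * L1_norm \<Omega> y + t * L1_norm \<Omega> v"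
      unfolding z using L1_norm_lincomb_le[OF H10D(2)[OF y] H10D(2)[OF v], of "1 - t" t] t by simp
    moreover have "energy u y \<le> energy u (\<lambda>x. 1 * y x + t * h x)"
      by (rule min[OF H10_lincomb[OF y h]])
    ultimately show "0 \<le> t * (bilin_a \<Omega> y h + L1_norm \<Omega> v - L1_norm \<Omega> y - L2_inner \<Omega> u h) + t\<^sup>2 * (bilin_a \<Omega> h h / 2)"
      unfolding energy_def bilin_a_square_lincomb[OF y h] L2_inner_lincomb_right[OF u H10D(2)[OF y] H10D(2)[OF h]]
      by (simp add: algebra_simps add_divide_distrib)
  qed
  then show "L2_functional \<Omega> u (\<lambda>x. v x - y x) \<le> bilin_a \<Omega> y (\<lambda>x. v x - y x) + L1_norm \<Omega> v - L1_norm \<Omega> y"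
    by (simp add: L2_functional_def h_def)
qed

lemma sol_op_solves_VI:
  assumes "u \<in> L2 \<Omega>"
  shows "solves_VI \<Omega> (L2_functional \<Omega> u) (sol_op \<Omega> (L2_functional \<Omega> u))"
proof -
  obtain y where "y \<in> H10 \<Omega>" "\<And>v. v \<in> H10 \<Omega> \<Longrightarrow> energy u y \<le> energy u v"
    using energy_minimizer[OF assms] by blast
  then show ?thesis
    unfolding sol_op_def using energy_minimizer_solves_VI[OF assms] by (metis someI_ex)
qed

text \<open>
  The representing function is the \<open>L\<^sup>2\<close> limit of a minimising sequence of
  \<open>w \<mapsto> \<integral>w\<^sup>2 / 2 - F w\<close>; the bound by the \<open>L\<^sup>1\<close> norm then yields \<open>\<bar>q\<bar> \<le> 1\<close>.
\<close>

lemma L1_bounded_functional_representation: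
  assumes lincomb: "\<And>c d v w. v \<in> test_functions \<Omega> \<Longrightarrow> w \<in> test_functions \<Omega> \<Longrightarrow>
      F (\<lambda>x. c * v x + d * w x) = c * F v + d * F w"
    and bound: "\<And>v. v \<in> test_functions \<Omega> \<Longrightarrow> \<bar>F v\<bar> \<le> L1_norm \<Omega> v"
  obtains q where "q \<in> L2 \<Omega>" "AE x in lebesgue_on \<Omega>. \<bar>q x\<bar> \<le> 1"
    "\<And>w. w \<in> test_functions \<Omega> \<Longrightarrow> F w = L2_inner \<Omega> q w"
proof -
  define J where "J = (\<lambda>w. (\<integral>x. (w x)\<^sup>2 \<partial>lebesgue_on \<Omega>) / 2 - F w)"
  \<comment> \<open>The summand 1 keeps this positive on an empty domain, so that it can be divided
    out.\<close>
  define \<mu> where "\<mu> = measure lebesgue \<Omega> + 1"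
  have "\<mu> > 0" by (simp add: \<mu>_def add_nonneg_pos)
  have J_lincomb: "J (\<lambda>x. c * v x + d * w x) = (c\<^sup>2 * (\<integral>x. (v x)\<^sup>2 \<partial>lebesgue_on \<Omega>)
      + 2 * c * d * L2_inner \<Omega> v w + d\<^sup>2 * (\<integral>x. (w x)\<^sup>2 \<partial>lebesgue_on \<Omega>)) / 2 - (c * F v + d * F w)"
    if "v \<in> test_functions \<Omega>" "w \<in> test_functions \<Omega>" for v w c d
    using integral_square_lincomb[OF test_function_L2(1)[OF that(1)] test_function_L2(1)[OF that(2)]] lincomb[OF that]
    by (simp add: J_def)
  \<comment> \<open>With \<open>?s\<close> the \<open>L1\<close> norm of \<open>w\<close>,
    Cauchy-Schwarz bounds its square by \<open>?I * \<mu>\<close>. The square of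
    \<open>?s - \<mu>\<close> being nonnegative then bounds \<open>?s\<close> by
    \<open>(?I + \<mu>) / 2\<close>.\<close>
  have lower: "- \<mu> / 2 \<le> J w" if w: "w \<in> test_functions \<Omega>" for w
  proof -
    let ?I = "\<integral>x. (w x)\<^sup>2 \<partial>lebesgue_on \<Omega>" and ?s = "L1_norm \<Omega> w"
    have "?I \<ge> 0" by simp
    then have "?s\<^sup>2 \<le> ?I * \<mu>"
      using L1_norm_squared_le[OF test_function_L2(1)[OF w]] unfolding \<mu>_def distrib_left by linarith
    moreover have "0 \<le> (?s - \<mu>)\<^sup>2" by simp
    ultimately have "0 \<le> \<mu> * (?I - 2 * ?s + \<mu>)"
      by (simp add: power2_eq_square algebra_simps)
    then have "0 \<le> ?I - 2 * ?s + \<mu>"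
      using \<open>\<mu> > 0\<close> by (simp add: zero_le_mult_iff)
    then show ?thesis using bound[OF w] by (simp add: J_def)
  qed
  let ?N = "\<lambda>v w. (\<integral>x. (v x - w x)\<^sup>2 \<partial>lebesgue_on \<Omega>) / 2"
  have mid: "\<exists>z\<in>test_functions \<Omega>. 4 * J z + ?N v w \<le> 2 * J v + 2 * J w"
    if "v \<in> test_functions \<Omega>" "w \<in> test_functions \<Omega>" for v w
  proof
    show "(\<lambda>x. 1 / 2 * v x + 1 / 2 * w x) \<in> test_functions \<Omega>"
      by (intro test_functions_add test_functions_cmult that)
    show "4 * J (\<lambda>x. 1 / 2 * v x + 1 / 2 * w x) + ?N v w \<le> 2 * J v + 2 * J w"
      unfolding J_lincomb[OF that]
      using integral_square_lincomb[OF test_function_L2(1)[OF that(1)] test_function_L2(1)[OF that(2)], of 1 "-1"]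
      by (simp add: J_def power2_eq_square add_divide_distrib diff_divide_distrib)
  qed
  have nonempty: "test_functions \<Omega> \<noteq> {}"
    using test_functions_zero by blast
  obtain \<phi> m where \<phi>: "\<And>n::nat. \<phi> n \<in> test_functions \<Omega>" and m: "(\<lambda>n. J (\<phi> n)) \<longlonglongrightarrow> m"
      "\<And>w. w \<in> test_functions \<Omega> \<Longrightarrow> m \<le> J w"
    and Cauchy: "\<And>e. e > 0 \<Longrightarrow> \<exists>n0. \<forall>i\<ge>n0. \<forall>j\<ge>n0. ?N (\<phi> i) (\<phi> j) < e"
    using minimizing_sequence[OF nonempty lower mid] by blast
  have "\<exists>n0. \<forall>i\<ge>n0. \<forall>j\<ge>n0. (\<integral>x. (norm (\<phi> i x - \<phi> j x))\<^sup>2 \<partial>lebesgue_on \<Omega>) < e" if "e > 0" for e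
    using Cauchy[of "e / 2"] that by simp
  then obtain q where q: "q \<in> L2 \<Omega>" "(\<lambda>n. \<integral>x. (norm (\<phi> n x - q x))\<^sup>2 \<partial>lebesgue_on \<Omega>) \<longlonglongrightarrow> 0"
    using L2_complete[of \<Omega> \<phi>, OF lmeasurable_set test_function_L2(1)[OF \<phi>]] by blast
  \<comment> \<open>\<open>F\<close> is known only on test functions, so \<open>J\<close> is not
    evaluated at the limit \<open>q\<close>. Instead the expansion around \<open>\<phi> n\<close> is
    passed to the limit.\<close>
  have variation: "0 \<le> t * (L2_inner \<Omega> q w - F w) + t\<^sup>2 * ((\<integral>x. (w x)\<^sup>2 \<partial>lebesgue_on \<Omega>) / 2)"
    if w: "w \<in> test_functions \<Omega>" for t w
  proof -
    have "m \<le> J (\<phi> n) + t * (L2_inner \<Omega> (\<phi> n) w - F w) + t\<^sup>2 * ((\<integral>x. (w x)\<^sup>2 \<partial>lebesgue_on \<Omega>) / 2)" for n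
      using m(2)[OF test_functions_add[OF test_functions_cmult[OF \<phi>, of 1 n] test_functions_cmult[OF w, of t]]]
      unfolding J_lincomb[OF \<phi> w] by (simp add: J_def algebra_simps)
    moreover have "(\<lambda>n. L2_inner \<Omega> (\<phi> n) w) \<longlonglongrightarrow> L2_inner \<Omega> q w"
      using tendsto_L2_inner_const[OF test_function_L2(1)[OF w] test_function_L2(1)[OF \<phi>] q] by (simp add: L2_inner_commute)
    then have "(\<lambda>n. J (\<phi> n) + t * (L2_inner \<Omega> (\<phi> n) w - F w) + t\<^sup>2 * ((\<integral>x. (w x)\<^sup>2 \<partial>lebesgue_on \<Omega>) / 2))
        \<longlonglongrightarrow> m + t * (L2_inner \<Omega> q w - F w) + t\<^sup>2 * ((\<integral>x. (w x)\<^sup>2 \<partial>lebesgue_on \<Omega>) / 2)"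
      using m(1) by (intro tendsto_intros)
    ultimately have "m \<le> m + t * (L2_inner \<Omega> q w - F w) + t\<^sup>2 * ((\<integral>x. (w x)\<^sup>2 \<partial>lebesgue_on \<Omega>) / 2)"
      by (intro LIMSEQ_le_const) auto
    then show ?thesis by linarith
  qed
  have repr: "F w = L2_inner \<Omega> q w" if w: "w \<in> test_functions \<Omega>" for w
  proof (rule antisym)
    have "0 \<le> L2_inner \<Omega> q w - F w"
      using variation[OF w] by (rule nonneg_slope_if_quadratic_nonneg)
    then show "F w \<le> L2_inner \<Omega> q w" by simp
    have "0 \<le> t * (F w - L2_inner \<Omega> q w) + t\<^sup>2 * ((\<integral>x. (w x)\<^sup>2 \<partial>lebesgue_on \<Omega>) / 2)" for t
      using variation[OF w, of "- t"] by (simp add: algebra_simps)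
    then have "0 \<le> F w - L2_inner \<Omega> q w"
      by (rule nonneg_slope_if_quadratic_nonneg)
    then show "L2_inner \<Omega> q w \<le> F w" by simp
  qed
  \<comment> \<open>Tested with a nonnegative \<open>w\<close>, the function
    \<open>1 + s * q\<close> yields the \<open>L1\<close> norm of \<open>w\<close> plus
    \<open>s * F w\<close>, which is nonnegative by \<open>bound\<close>. The two signs give the two
    bounds on \<open>q\<close>.\<close>
  have "AE x in lebesgue_on \<Omega>. 0 \<le> 1 + s * q x" if s: "\<bar>s\<bar> = 1" for s
  proof (rule AE_nonneg_if_test_function_nonneg[OF open_set])
    have L: "(\<lambda>x. 1) \<in> L2 \<Omega>" "(\<lambda>x. s * q x) \<in> L2 \<Omega>"
      by (intro L2_const[OF lmeasurable_set] L2_cmult q(1))+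
    then show "locally_integrable \<Omega> (\<lambda>x. 1 + s * q x)"
      by (intro L2_locally_integrable L2_add)
    fix w assume w: "w \<in> test_functions \<Omega>" "\<And>x. 0 \<le> w x"
    have "(\<integral>x. (1 + s * q x) * w x \<partial>lebesgue_on \<Omega>) = (\<integral>x. \<bar>w x\<bar> + s * (q x * w x) \<partial>lebesgue_on \<Omega>)"
      using w(2) by (simp add: algebra_simps)
    also have "\<dots> = L1_norm \<Omega> w + s * L2_inner \<Omega> q w"
      using L2_abs_integrable[OF test_function_L2(1)[OF w(1)]] L2_mult_integrable[OF q(1) test_function_L2(1)[OF w(1)]]
      by (simp add: L1_norm_def L2_inner_def)
    also have "\<dots> \<ge> 0"
      using bound[OF w(1)] repr[OF w(1)] s abs_ge_minus_self[of "s * F w"] by (simp add: abs_mult)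
    finally show "0 \<le> (\<integral>x. (1 + s * q x) * w x \<partial>lebesgue_on \<Omega>)" .
  qed
  from this[of 1] this[of "-1"] have "AE x in lebesgue_on \<Omega>. \<bar>q x\<bar> \<le> 1"
    by simp (erule (1) AE_mp[OF _ AE_mp], simp add: abs_le_iff)
  with q(1) repr that show thesis by blast
qed

text \<open>Equality in the bound of the residual at \<open>w = y\<close> gives complementarity:
  \<open>\<bar>y\<bar> - q * y\<close> is nonnegative because \<open>\<bar>q\<bar> \<le> 1\<close>,
  and its integral is then 0.\<close>

lemma solves_VI_imp_slack:
  assumes u: "u \<in> L2 \<Omega>" and VI: "solves_VI \<Omega> (L2_functional \<Omega> u) y"
  obtains q where "is_slack \<Omega> (L2_functional \<Omega> u) y q"
proof -
  define F where "F = (\<lambda>w. L2_inner \<Omega> u w - bilin_a \<Omega> y w)"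
  have y: "y \<in> H10 \<Omega>" and ineq: "\<And>v. v \<in> H10 \<Omega> \<Longrightarrow>
      F (\<lambda>x. v x - y x) \<le> L1_norm \<Omega> v - L1_norm \<Omega> y"
    using VI by (auto simp: solves_VI_def F_def L2_functional_def algebra_simps)
  have lincomb: "F (\<lambda>x. c * v x + d * w x) = c * F v + d * F w"
    if "v \<in> H10 \<Omega>" "w \<in> H10 \<Omega>" for c d v w
    using bilin_a_lincomb_right[OF that y] L2_inner_lincomb_right[OF u H10D(2)[OF that(1)] H10D(2)[OF that(2)]]
    by (simp add: F_def algebra_simps)
  \<comment> \<open>The inequality is tested with \<open>y + s * w\<close>; subadditivity removes
    the norm of \<open>y\<close>, and both signs of \<open>s\<close> are used afterwards.\<close>
  have one_sided: "s * F w \<le> \<bar>s\<bar> * L1_norm \<Omega> w" if w: "w \<in> H10 \<Omega>" for w s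
    using ineq[OF H10_lincomb[OF y w, of 1 s]] lincomb[OF w w, of s 0]
      L1_norm_lincomb_le[OF H10D(2)[OF y] H10D(2)[OF w], of 1 s] by simp
  have bound: "\<bar>F w\<bar> \<le> L1_norm \<Omega> w" if "w \<in> H10 \<Omega>" for w
    using one_sided[OF that, of 1] one_sided[OF that, of "-1"] by simp
  obtain q where q: "q \<in> L2 \<Omega>" "AE x in lebesgue_on \<Omega>. \<bar>q x\<bar> \<le> 1"
      "\<And>w. w \<in> test_functions \<Omega> \<Longrightarrow> F w = L2_inner \<Omega> q w"
    using L1_bounded_functional_representation[OF lincomb bound] test_function_H10 by blast
  \<comment> \<open>The \<open>L1\<close> bound makes \<open>F\<close> continuous along test
    functions converging in \<open>L2\<close>, as the domain has finite measure.\<close>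
  have repr: "F v = L2_inner \<Omega> q v" if v: "v \<in> H10 \<Omega>" for v
  proof -
    obtain \<phi> where \<phi>: "\<And>n. \<phi> n \<in> test_functions \<Omega>"
      "(\<lambda>n. \<integral>x. (norm (\<phi> n x - v x))\<^sup>2 \<partial>lebesgue_on \<Omega>) \<longlonglongrightarrow> 0"
      using H10_approx[OF v] by blast
    note L = test_function_L2(1)[OF \<phi>(1)] H10D(2)[OF v]
    have "\<bar>F (\<phi> n) - F v\<bar> \<le> L1_norm \<Omega> (\<lambda>x. \<phi> n x - v x)" for n
      using bound[OF H10_diff[OF test_function_H10[OF \<phi>(1)] v], of n]
        lincomb[OF test_function_H10[OF \<phi>(1)] v, of 1 n "-1"] by simp
    then have "(\<lambda>n. F (\<phi> n) - F v) \<longlonglongrightarrow> 0"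
      by (intro Lim_null_comparison[OF _ tendsto_L1_norm_diff[OF L \<phi>(2)]]) simp
    then have "(\<lambda>n. F (\<phi> n)) \<longlonglongrightarrow> F v"
      by (simp add: LIM_zero_iff)
    moreover have "(\<lambda>n. F (\<phi> n)) \<longlonglongrightarrow> L2_inner \<Omega> q v"
      unfolding q(3)[OF \<phi>(1)] by (rule tendsto_L2_inner_const[OF q(1) L \<phi>(2)])
    ultimately show ?thesis by (rule LIMSEQ_unique)
  qed
  \<comment> \<open>Testing with the zero function, here the combination with coefficients 0 and 0,
    gives the lower bound; \<open>bound\<close> gives the upper one.\<close>
  have "F y = L1_norm \<Omega> y"
    using ineq[OF H10_lincomb[OF y y, of 0 0]] lincomb[OF y y, of "-1" 0] bound[OF y]
    by (simp add: L1_norm_def)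
  then have eq: "L2_inner \<Omega> q y = L1_norm \<Omega> y"
    using repr[OF y] by simp
  have int: "integrable (lebesgue_on \<Omega>) (\<lambda>x. \<bar>y x\<bar> - q x * y x)"
    using L2_abs_integrable[OF H10D(2)[OF y]] L2_mult_integrable[OF q(1) H10D(2)[OF y]] by simp
  have nn: "AE x in lebesgue_on \<Omega>. 0 \<le> \<bar>y x\<bar> - q x * y x"
    using q(2)
  proof eventually_elim
    case (elim x)
    have "q x * y x \<le> \<bar>q x\<bar> * \<bar>y x\<bar>" by (metis abs_ge_self abs_mult)
    also have "\<dots> \<le> \<bar>y x\<bar>" using elim by (simp add: mult_left_le_one_le)
    finally show ?case by simp
  qed
  have "(\<integral>x. \<bar>y x\<bar> - q x * y x \<partial>lebesgue_on \<Omega>) = 0"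
    using eq L2_abs_integrable[OF H10D(2)[OF y]] L2_mult_integrable[OF q(1) H10D(2)[OF y]]
    by (simp add: L1_norm_def L2_inner_def)
  then have "AE x in lebesgue_on \<Omega>. \<bar>y x\<bar> - q x * y x = 0"
    using integral_nonneg_eq_0_iff_AE[OF int nn] by blast
  then have "AE x in lebesgue_on \<Omega>. q x * y x = \<bar>y x\<bar> \<and> \<bar>q x\<bar> \<le> 1"
    using q(2) by eventually_elim simp
  moreover have "q \<in> Linf \<Omega>"
    using q(2) L2_imp_measurable[OF q(1)] by (auto simp: Linf_def)
  ultimately have "is_slack \<Omega> (L2_functional \<Omega> u) y q"
    using repr by (auto simp: is_slack_def F_def L2_functional_def algebra_simps)
  then show thesis by (rule that)
qed

lemma slack_op_is_slack:
  assumes "u \<in> L2 \<Omega>"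
  shows "is_slack \<Omega> (L2_functional \<Omega> u) (sol_op \<Omega> (L2_functional \<Omega> u)) (slack_op \<Omega> (L2_functional \<Omega> u))"
  unfolding slack_op_def
  using solves_VI_imp_slack[OF assms sol_op_solves_VI[OF assms]] by (metis someI_ex)

end

section \<open>Quadratic growth\<close>

lemma admissible_domain_imp_bounded_open:
  assumes "admissible_domain \<Omega>"
  shows "bounded_open_set \<Omega>"
proof -
  have "open \<Omega> \<and> bounded \<Omega>" if poly: "polyhedral_domain \<Omega>"
  proof -
    obtain \<P> where \<P>: "finite \<P>" "\<forall>P\<in>\<P>. polytope P" "\<Omega> = interior (\<Union>\<P>)"
      using poly by (auto simp: polyhedral_domain_def)
    then have "bounded (\<Union>\<P>)"
      using polytope_imp_bounded by (intro bounded_Union) auto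
    then show ?thesis
      unfolding \<P>(3) using bounded_subset interior_subset by blast
  qed
  then show ?thesis
    using assms by (auto simp: admissible_domain_def bounded_open_set_def open_box bounded_box)
qed

context bounded_open_set
begin

lemma L2_norm_squared: "(L2_norm \<Omega> v)\<^sup>2 = (\<integral>x. (v x)\<^sup>2 \<partial>lebesgue_on \<Omega>)"
  by (simp add: L2_norm_def)

lemma L2_norm_diff_expand:
  assumes "v \<in> L2 \<Omega>" "w \<in> L2 \<Omega>" "z \<in> L2 \<Omega>"
  shows "(L2_norm \<Omega> (\<lambda>x. v x - z x))\<^sup>2 = (L2_norm \<Omega> (\<lambda>x. w x - z x))\<^sup>2
    + 2 * L2_inner \<Omega> (\<lambda>x. w x - z x) (\<lambda>x. v x - w x) + (L2_norm \<Omega> (\<lambda>x. v x - w x))\<^sup>2"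
proof -
  have "(\<lambda>x. 1 * (w x - z x) + 1 * (v x - w x)) = (\<lambda>x. v x - z x)" by simp
  with integral_square_lincomb[OF L2_diff[OF assms(2,3)] L2_diff[OF assms(1,2)], of 1 1]
  show ?thesis by (simp add: L2_norm_squared)
qed

lemma L2_inner_cong_AE:
  assumes "u \<in> L2 \<Omega>" "v \<in> L2 \<Omega>" "AE x in lebesgue_on \<Omega>. v x = w x"
  shows "L2_inner \<Omega> v u = L2_inner \<Omega> w u"
  unfolding L2_inner_def
proof (rule integral_cong_AE)
  have "w \<in> L2 \<Omega>" using L2_cong_AE[OF sets_set assms(3,2)] .
  then show "(\<lambda>x. v x * u x) \<in> borel_measurable (lebesgue_on \<Omega>)" "(\<lambda>x. w x * u x) \<in> borel_measurable (lebesgue_on \<Omega>)"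
    using assms by (intro borel_measurable_times L2_imp_measurable; simp)+
  show "AE x in lebesgue_on \<Omega>. v x * u x = w x * u x"
    using assms(3) by eventually_elim simp
qed

lemma sol_op_H10: "u \<in> L2 \<Omega> \<Longrightarrow> sol_op \<Omega> (L2_functional \<Omega> u) \<in> H10 \<Omega>"
  using sol_op_solves_VI by (simp add: solves_VI_def)

lemma slack_op_L2: "u \<in> L2 \<Omega> \<Longrightarrow> slack_op \<Omega> (L2_functional \<Omega> u) \<in> L2 \<Omega>"
  using slack_op_is_slack Linf_imp_L2[OF lmeasurable_set] by (simp add: is_slack_def)

lemma state_equation:
  assumes "u \<in> L2 \<Omega>" "v \<in> H10 \<Omega>"
  shows "bilin_a \<Omega> (sol_op \<Omega> (L2_functional \<Omega> u)) v + L2_inner \<Omega> (slack_op \<Omega> (L2_functional \<Omega> u)) v = L2_inner \<Omega> u v"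
  using slack_op_is_slack[OF assms(1)] assms(2) by (simp add: is_slack_def L2_functional_def)

text \<open>An identity, valid for every control \<open>u\<close> and not only near
  \<open>ubar\<close>. Since \<open>ybar\<close> and \<open>qbar\<close> are a.e. copies of the
  operator values, every term is first moved across null sets.\<close>

lemma reduced_cost_diff:
  assumes data: "y\<^sub>d \<in> L2 \<Omega>" "u\<^sub>d \<in> L2 \<Omega>" and u: "u \<in> L2 \<Omega>" and ubar: "ubar \<in> L2 \<Omega>"
    and ybar: "AE x in lebesgue_on \<Omega>. ybar x = sol_op \<Omega> (L2_functional \<Omega> ubar) x"
    and qbar: "AE x in lebesgue_on \<Omega>. qbar x = slack_op \<Omega> (L2_functional \<Omega> ubar) x"
    and p: "p \<in> H10 \<Omega>"
    and gradient_eq: "AE x in lebesgue_on \<Omega>. p x + \<nu> * (ubar x - u\<^sub>d x) = 0"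
    and adjoint_eq: "\<forall>v\<in>H10 \<Omega>. bilin_a \<Omega> p v = L2_inner \<Omega> (\<lambda>x. ybar x - y\<^sub>d x) v - \<mu> v"
  shows "reduced_cost \<Omega> y\<^sub>d u\<^sub>d \<nu> u - reduced_cost \<Omega> y\<^sub>d u\<^sub>d \<nu> ubar =
    \<mu> (\<lambda>x. sol_op \<Omega> (L2_functional \<Omega> u) x - ybar x)
    - L2_inner \<Omega> (\<lambda>x. slack_op \<Omega> (L2_functional \<Omega> u) x - qbar x) p
    + (L2_norm \<Omega> (\<lambda>x. sol_op \<Omega> (L2_functional \<Omega> u) x - ybar x))\<^sup>2 / 2
    + \<nu> / 2 * (L2_norm \<Omega> (\<lambda>x. u x - ubar x))\<^sup>2"
proof -
  define y yb q qb where "y = sol_op \<Omega> (L2_functional \<Omega> u)" and "yb = sol_op \<Omega> (L2_functional \<Omega> ubar)"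
    and "q = slack_op \<Omega> (L2_functional \<Omega> u)" and "qb = slack_op \<Omega> (L2_functional \<Omega> ubar)"
  have ae: "AE x in lebesgue_on \<Omega>. yb x = ybar x" "AE x in lebesgue_on \<Omega>. qb x = qbar x"
    using ybar qbar unfolding yb_def qb_def by (auto elim: eventually_mono)
  have y: "y \<in> H10 \<Omega>" and yb: "yb \<in> H10 \<Omega>" and q: "q \<in> L2 \<Omega>" and qb: "qb \<in> L2 \<Omega>"
    unfolding y_def yb_def q_def qb_def by (intro sol_op_H10 slack_op_L2 u ubar)+
  have ybarH: "ybar \<in> H10 \<Omega>" by (rule H10_cong_AE[OF ae(1) yb])
  have qbarL: "qbar \<in> L2 \<Omega>" by (rule L2_cong_AE[OF sets_set ae(2) qb])
  note L = H10D(2)[OF y] H10D(2)[OF yb] H10D(2)[OF ybarH] H10D(2)[OF p]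
  let ?r = "\<lambda>x. ubar x - u\<^sub>d x" and ?d = "\<lambda>x. u x - ubar x"
  have state: "bilin_a \<Omega> (\<lambda>x. y x - ybar x) p + L2_inner \<Omega> (\<lambda>x. q x - qbar x) p = L2_inner \<Omega> ?d p"
    using state_equation[OF u p] state_equation[OF ubar p] bilin_a_cong_AE(1)[OF ae(1), of p] L2_inner_cong_AE[OF L(4) qb ae(2)]
    by (simp add: y_def[symmetric] yb_def[symmetric] q_def[symmetric] qb_def[symmetric]
        bilin_a_diff_left[OF y ybarH p] L2_inner_diff_left[OF L(4) q qbarL] L2_inner_diff_left[OF L(4) u ubar])
  have adjoint: "bilin_a \<Omega> p (\<lambda>x. y x - ybar x)
      = L2_inner \<Omega> (\<lambda>x. ybar x - y\<^sub>d x) (\<lambda>x. y x - ybar x) - \<mu> (\<lambda>x. y x - ybar x)"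
    using adjoint_eq H10_diff[OF y ybarH] by blast
  have "L2_inner \<Omega> (\<lambda>x. - \<nu> * ?r x) ?d = L2_inner \<Omega> p ?d"
  proof (rule L2_inner_cong_AE)
    show "AE x in lebesgue_on \<Omega>. - \<nu> * ?r x = p x"
      using gradient_eq by eventually_elim simp
  qed (intro L2_cmult L2_diff u ubar data)+
  then have gradient: "\<nu> * L2_inner \<Omega> ?r ?d = - L2_inner \<Omega> ?d p"
    by (simp add: L2_inner_commute[of ?d p]) (simp add: L2_inner_def mult.assoc)
  \<comment> \<open>The cost is evaluated at the representative chosen by \<open>sol_op\<close>, the
    expansion at \<open>ybar\<close>.\<close>
  have "L2_norm \<Omega> (\<lambda>x. yb x - y\<^sub>d x) = L2_norm \<Omega> (\<lambda>x. ybar x - y\<^sub>d x)"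
  proof -
    have "(\<integral>x. (yb x - y\<^sub>d x)\<^sup>2 \<partial>lebesgue_on \<Omega>) = (\<integral>x. (ybar x - y\<^sub>d x)\<^sup>2 \<partial>lebesgue_on \<Omega>)"
    proof (rule integral_cong_AE)
      show "AE x in lebesgue_on \<Omega>. (yb x - y\<^sub>d x)\<^sup>2 = (ybar x - y\<^sub>d x)\<^sup>2"
        using ae(1) by eventually_elim simp
    qed (use L2_imp_measurable[OF L(2)] L2_imp_measurable[OF L(3)] L2_imp_measurable[OF data(1)] in measurable)
    then show ?thesis by (simp add: L2_norm_def)
  qed
  then have cost: "reduced_cost \<Omega> y\<^sub>d u\<^sub>d \<nu> u - reduced_cost \<Omega> y\<^sub>d u\<^sub>d \<nu> ubar
      = L2_inner \<Omega> (\<lambda>x. ybar x - y\<^sub>d x) (\<lambda>x. y x - ybar x) + (L2_norm \<Omega> (\<lambda>x. y x - ybar x))\<^sup>2 / 2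
        + \<nu> * L2_inner \<Omega> ?r ?d + \<nu> / 2 * (L2_norm \<Omega> ?d)\<^sup>2"
    unfolding reduced_cost_def cost_J_def y_def[symmetric] yb_def[symmetric]
      L2_norm_diff_expand[OF L(1,3) data(1)] L2_norm_diff_expand[OF u ubar data(2)]
    by (simp add: algebra_simps add_divide_distrib)
  \<comment> \<open>Three substitutions: \<open>adjoint\<close> turns the tracking term into the
    Dirichlet form plus the multiplier, \<open>state\<close> turns the form into
    \<open>L2_inner \<Omega> ?d p\<close> minus the slack term, and \<open>gradient\<close> cancels
    that inner product against the control term.\<close>
  show ?thesis
    using cost state adjoint gradient bilin_a_commute[of p "\<lambda>x. y x - ybar x"]
    unfolding y_def q_def by linarith
qed

end

theorem theorem5p3:
  fixes \<Omega> :: "'a::euclidean_space set"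
    and y\<^sub>d u\<^sub>d ubar ybar qbar pbar :: "'a \<Rightarrow> real"
    and \<mu>bar :: "('a \<Rightarrow> real) \<Rightarrow> real"
    and \<nu> :: real
    and C :: "'a set"
  assumes domain: "admissible_domain \<Omega>"
    and data: "y\<^sub>d \<in> L2 \<Omega>" "u\<^sub>d \<in> Linf \<Omega>" "\<nu> > 0"
    and ubar: "ubar \<in> L2 \<Omega>"
    and ybar: "AE x in lebesgue_on \<Omega>. ybar x = sol_op \<Omega> (L2_functional \<Omega> ubar) x"
    and qbar: "AE x in lebesgue_on \<Omega>. qbar x = slack_op \<Omega> (L2_functional \<Omega> ubar) x"
    and regularity: "C_k_on 1 \<Omega> ybar"
    and C_subset: "C \<subseteq> active_interface \<Omega> ybar"
    and C_closed: "closed C"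
    and C_capacity: "H1_capacity C = 0"
    and submanifold: "strong_lipschitz_submanifold (active_interface \<Omega> ybar - C)"
    and N_plus_open: "openin (top_of_set (active_interface \<Omega> ybar - C)) (N_plus \<Omega> ybar C)"
    and N_minus_open: "openin (top_of_set (active_interface \<Omega> ybar - C)) (N_minus \<Omega> ybar C)"
    and M_empty: "{x\<in>\<Omega>. ybar x = 0 \<and> grad ybar x \<noteq> 0} = {}"
    and pbar: "pbar \<in> H10 \<Omega>"
    and \<mu>bar: "\<mu>bar \<in> Hm1 \<Omega>"
    and gradient_eq: "AE x in lebesgue_on \<Omega>. pbar x + \<nu> * (ubar x - u\<^sub>d x) = 0"
    and adjoint_eq: "\<forall>v\<in>H10 \<Omega>. bilin_a \<Omega> pbar v = L2_inner \<Omega> (\<lambda>x. ybar x - y\<^sub>d x) v - \<mu>bar v"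
    and pbar_cone: "pbar \<in> cone_K \<Omega> ybar qbar C"
    and \<mu>bar_cone: "\<forall>v\<in>cone_K \<Omega> ybar qbar C. \<mu>bar v \<ge> 0"
    and local_sign: "\<exists>\<epsilon>>0. \<forall>u\<in>L2 \<Omega>. L2_norm \<Omega> (\<lambda>x. u x - ubar x) \<le> \<epsilon> \<longrightarrow>
        \<mu>bar (\<lambda>x. sol_op \<Omega> (L2_functional \<Omega> u) x - ybar x)
        - L2_inner \<Omega> (\<lambda>x. slack_op \<Omega> (L2_functional \<Omega> u) x - qbar x) pbar \<ge> 0"
  shows "\<exists>\<epsilon>'>0. \<exists>\<delta>>0. \<forall>u\<in>L2 \<Omega>. L2_norm \<Omega> (\<lambda>x. u x - ubar x) \<le> \<epsilon>' \<longrightarrow>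
    reduced_cost \<Omega> y\<^sub>d u\<^sub>d \<nu> ubar
      \<le> reduced_cost \<Omega> y\<^sub>d u\<^sub>d \<nu> u - \<delta> * (L2_norm \<Omega> (\<lambda>x. u x - ubar x))\<^sup>2"
proof -
  interpret bounded_open_set \<Omega>
    using domain by (rule admissible_domain_imp_bounded_open)
  obtain \<epsilon> where "\<epsilon> > 0" and sign: "\<And>u. u \<in> L2 \<Omega> \<Longrightarrow> L2_norm \<Omega> (\<lambda>x. u x - ubar x) \<le> \<epsilon> \<Longrightarrow>
      \<mu>bar (\<lambda>x. sol_op \<Omega> (L2_functional \<Omega> u) x - ybar x)
        - L2_inner \<Omega> (\<lambda>x. slack_op \<Omega> (L2_functional \<Omega> u) x - qbar x) pbar \<ge> 0"
    using local_sign by blast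
  have "reduced_cost \<Omega> y\<^sub>d u\<^sub>d \<nu> ubar \<le>
      reduced_cost \<Omega> y\<^sub>d u\<^sub>d \<nu> u - \<nu> / 2 * (L2_norm \<Omega> (\<lambda>x. u x - ubar x))\<^sup>2"
    if u: "u \<in> L2 \<Omega>" "L2_norm \<Omega> (\<lambda>x. u x - ubar x) \<le> \<epsilon>" for u
  proof -
    \<comment> \<open>The tracking part of the second-order term is discarded by sign; growth comes
      from the control cost alone, and the radius \<open>\<epsilon>\<close> is kept.\<close>
    have "0 \<le> (L2_norm \<Omega> (\<lambda>x. sol_op \<Omega> (L2_functional \<Omega> u) x - ybar x))\<^sup>2" by simp
    then show ?thesis
      using sign[OF u] reduced_cost_diff[OF data(1) Linf_imp_L2[OF lmeasurable_set data(2)] u(1) ubar ybar qbar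
          pbar gradient_eq adjoint_eq]
      by linarith
  qed
  moreover have "\<nu> / 2 > 0" using data(3) by simp
  ultimately show ?thesis
    using \<open>\<epsilon> > 0\<close> by blast
qed

end
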